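(* Let $\mathcal{C}$ be either an algebraically closed field complete with respect to a non-Archimedean absolute value $|\cdot|$, or $\mathcal{C}=\mathbb{C}$. Let $q\in\mathcal{C}$ with $0<|q|<1$, let $\mathcal{K}_q$ be the field of meromorphic functions $f(z)$ on $\mathcal{C}^\times$ with $f(qz)=f(z)$, let $s\in\mathcal{C}^\times$ be multiplicatively independent of $q$, and let $\tau(f)(z)=f(sz)$. Let $\mathcal{R}=\{\alpha_\omega:\omega\in\mathcal{E}_q/\tau\}$ be any $\tau$-pinning of $\mathcal{E}_q=\mathcal{C}^\times/q^{\mathbb{Z}}$, and let $f(z)\in\mathcal{K}_q$. Then $f$ is elliptically summable (i.e. $f=\tau(g)-g$ for some $g\in\mathcal{K}_q$) if and only if $\mathrm{PanOres}^{\mathcal{R}}(f,0)=0$, $\mathrm{PanOres}^{\mathcal{R}}(f,1)=0$, and $\mathrm{Ores}(f,\omega,k)=0$ for every $\omega\in\mathcal{E}_q/\tau$ and $k\geq1$.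
   Context: Meromorphic functions on $\mathcal{C}^\times$ are meant in the rigid analytic sense in the non-Archimedean case (any characteristic allowed) and in the usual sense if $\mathcal{C}=\mathbb{C}$. For $t\in\mathcal{C}^\times$, $\check t=t\cdot q^{\mathbb{Z}}\in\mathcal{E}_q$. The set of $\tau$-orbits is $\mathcal{E}_q/\tau:=\mathcal{E}_q/\mathbb{Z}\check s$ (cosets of the cyclic subgroup generated by $\check s$). A $\tau$-pinning is a choice $\mathcal{R}=\{\alpha_\omega\in\mathcal{C}^\times:\omega\in\mathcal{E}_q/\tau\}$ with $\check\alpha_\omega\in\omega$ for each $\omega$. For $f$ meromorphic on $\mathcal{C}^\times$ and $\alpha\in\mathcal{C}^\times$, the $c_k(f,\alpha)\in\mathcal{C}$ ($k\geq1$) are defined by $f(z)=\sum_{k\geq1}\frac{c_k(f,\alpha)}{(1-\alpha^{-1}z)^k}+h(z)$ with $h\in\mathcal{C}[[1-\alpha^{-1}z]]$; for $f\in\mathcal{K}_q$ they depend only on $\check\alpha$ and are also written $c_k(f,\check\alpha)$. Orbital residue: $\mathrm{Ores}(f,\omega,k):=\sum_{\check\alpha\in\omega}c_k(f,\check\alpha)$, a finite sum over points $\check\alpha\in\omega\subset\mathcal{E}_q$. Let $\zeta_q(z)=\frac1{1-z}+\sum_{m\geq1}\left(\frac{q^mz}{1-q^mz}-\frac{q^mz^{-1}}{1-q^mz^{-1}}\right)$ (which satisfies $\zeta_q(qz)=\zeta_q(z)+1$), $\zeta_q^{(0)}:=\zeta_q$, and $\zeta_q^{(k)}(z):=\sum_{m\in\mathbb{Z}}\frac{q^{km}z^k}{(1-q^mz)^{k+1}}$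 for $k\geq1$. For each $f\in\mathcal{K}_q$ there is a unique constant $c_0^{\mathcal{R}}(f)\in\mathcal{C}$ with $$f(z)=c_0^{\mathcal{R}}(f)+\sum_{\omega\in\mathcal{E}_q/\tau}\sum_{n\in\mathbb{Z}}\sum_{k\geq1}c_k(f,s^n\alpha_\omega)\sum_{i=1}^k\binom{k-1}{i-1}\zeta_q^{(i-1)}\bigl(s^{-n}\alpha_\omega^{-1}z\bigr).$$ Panorbital residues: $\mathrm{PanOres}^{\mathcal{R}}(f,0):=c_0^{\mathcal{R}}(f)$ and $\mathrm{PanOres}^{\mathcal{R}}(f,1):=\sum_{\omega\in\mathcal{E}_q/\tau}\sum_{n\in\mathbb{Z}}\sum_{k\geq1}n\cdot c_k(f,s^n\alpha_\omega)$. *)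

theory Defs
  imports "HOL-Complex_Analysis.Complex_Analysis"
begin

section \<open>Fields with an absolute value\<close>

text \<open>
  The class covers both kinds of base field, so that all notions that do not depend on the
  meaning of ``meromorphic'' are defined once.  The absolute value is the distance to \<open>0\<close>
  (the library reserves \<open>norm\<close> for real vector spaces).
\<close>

class valued_field = field + metric_space +
  assumes dist_diff: "dist x y = dist (x - y) 0"
    and dist_mult_0: "dist (x * y) 0 = dist x 0 * dist y 0"

definition absval :: "'a::valued_field \<Rightarrow> real" where
  "absval x = dist x 0"

instance real_normed_field \<subseteq> valued_field
proof
  fix x y :: 'a
  show "dist x y = dist (x - y) 0" by (simp add: dist_norm)
  show "dist (x * y) 0 = dist x 0 * dist y 0" by (simp add: norm_mult)
qed

lemma absval_eq_norm: "absval x = norm x" for x :: "'a::real_normed_field"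
  by (simp add: absval_def)

class nonarch_valued_field = valued_field +
  assumes ultrametric: "dist (x + y) 0 \<le> max (dist x 0) (dist y 0)"


section \<open>Meromorphic functions on the punctured line\<close>

text \<open>
  A meromorphic function is represented by a total function; its values at poles (and on any
  set meeting each closed annulus around the origin in finitely many points) are irrelevant.
  Equality of meromorphic functions is therefore the following relation.
\<close>

definition mero_eq :: "('a::valued_field \<Rightarrow> 'a) \<Rightarrow> ('a \<Rightarrow> 'a) \<Rightarrow> bool" where
  "mero_eq f g \<longleftrightarrow> (\<forall>a b. 0 < a \<longrightarrow> finite {z. a \<le> absval z \<and> absval z \<le> b \<and> f z \<noteq> g z})"

text \<open>
  Rigid analytic functions on the closed annulus with radii \<open>a < b\<close> are the Laurent series
  (with coefficients \<open>u\<close>) converging on it, and meromorphic functions on this affinoid are the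
  fractions of such series.  A global meromorphic function is one which is meromorphic on each
  member of the admissible covering by closed annuli.
\<close>

definition laurent_sum :: "(int \<Rightarrow> 'a::valued_field) \<Rightarrow> 'a \<Rightarrow> 'a" where
  "laurent_sum u z = (\<Sum>\<^sub>\<infinity>n. u n * z powi n)"

definition laurent_converges :: "real \<Rightarrow> real \<Rightarrow> (int \<Rightarrow> 'a::valued_field) \<Rightarrow> bool" where
  "laurent_converges a b u \<longleftrightarrow>
     (\<forall>z. a \<le> absval z \<and> absval z \<le> b \<longrightarrow> (\<lambda>n. u n * z powi n) summable_on UNIV)"

definition rigid_meromorphic :: "('a::nonarch_valued_field \<Rightarrow> 'a) set" where
  "rigid_meromorphic =
     {f. \<forall>a b. 0 < a \<and> a < b \<longrightarrow>
        (\<exists>u v. laurent_converges a b u \<and> laurent_converges a b v \<and> (\<exists>n. v n \<noteq> 0) \<and>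
           (\<forall>z. a \<le> absval z \<and> absval z \<le> b \<and> laurent_sum v z \<noteq> 0 \<longrightarrow>
              f z = laurent_sum u z / laurent_sum v z))}"

definition complex_meromorphic :: "(complex \<Rightarrow> complex) set" where
  "complex_meromorphic = {f. f meromorphic_on (- {0})}"

text \<open>
  In what follows \<open>M\<close> is the set of meromorphic functions, i.e. one of the two sets above.
\<close>

definition elliptic_functions :: "('a::valued_field \<Rightarrow> 'a) set \<Rightarrow> 'a \<Rightarrow> ('a \<Rightarrow> 'a) set" where
  "elliptic_functions M q = {f \<in> M. mero_eq (\<lambda>z. f (q * z)) f}"

definition elliptically_summable ::
    "('a::valued_field \<Rightarrow> 'a) set \<Rightarrow> 'a \<Rightarrow> 'a \<Rightarrow> ('a \<Rightarrow> 'a) \<Rightarrow> bool" where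
  "elliptically_summable M q s f \<longleftrightarrow>
     (\<exists>g \<in> elliptic_functions M q. mero_eq f (\<lambda>z. g (s * z) - g z))"


section \<open>The Tate curve, orbits and pinnings\<close>

definition mult_independent :: "'a::valued_field \<Rightarrow> 'a \<Rightarrow> bool" where
  "mult_independent s q \<longleftrightarrow> (\<forall>m n :: int. s powi m * q powi n = 1 \<longrightarrow> m = 0 \<and> n = 0)"

definition q_class :: "'a::valued_field \<Rightarrow> 'a \<Rightarrow> 'a set" where
  "q_class q t = range (\<lambda>n::int. t * q powi n)"

definition tate_curve :: "'a::valued_field \<Rightarrow> 'a set set" where
  "tate_curve q = q_class q ` (- {0})"

text \<open>An orbit is a coset in \<^term>\<open>tate_curve q\<close> of the cyclic group generated by the class of \<open>s\<close>.\<close>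

definition tau_orbit :: "'a::valued_field \<Rightarrow> 'a \<Rightarrow> 'a \<Rightarrow> 'a set set" where
  "tau_orbit q s t = range (\<lambda>n::int. q_class q (s powi n * t))"

definition tau_orbits :: "'a::valued_field \<Rightarrow> 'a \<Rightarrow> 'a set set set" where
  "tau_orbits q s = tau_orbit q s ` (- {0})"

definition tau_pinning :: "'a::valued_field \<Rightarrow> 'a \<Rightarrow> ('a set set \<Rightarrow> 'a) \<Rightarrow> bool" where
  "tau_pinning q s \<alpha> \<longleftrightarrow> (\<forall>\<omega> \<in> tau_orbits q s. \<alpha> \<omega> \<noteq> 0 \<and> q_class q (\<alpha> \<omega>) \<in> \<omega>)"


section \<open>Polar coefficients and orbital residues\<close>

text \<open>
  \<open>polar_expansion f \<alpha> c\<close>: near \<open>\<alpha>\<close>, \<open>f z\<close> is the sum of \<open>c k / (1 - z / \<alpha>) ^ k\<close> over \<open>k \<ge> 1\<close> and a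
  power series in \<open>1 - z / \<alpha>\<close> with coefficients \<open>h\<close>.  The unused \<open>c 0\<close> is normalised to \<open>0\<close>.
\<close>

definition polar_expansion :: "('a::valued_field \<Rightarrow> 'a) \<Rightarrow> 'a \<Rightarrow> (nat \<Rightarrow> 'a) \<Rightarrow> bool" where
  "polar_expansion f \<alpha> c \<longleftrightarrow> c 0 = 0 \<and> finite {k. c k \<noteq> 0} \<and>
     (\<exists>h. \<exists>r>0. \<forall>z. 0 < absval (1 - z / \<alpha>) \<and> absval (1 - z / \<alpha>) < r \<longrightarrow>
        (\<lambda>j. h j * (1 - z / \<alpha>) ^ j) sums
          (f z - (\<Sum>k | c k \<noteq> 0. c k / (1 - z / \<alpha>) ^ k)))"

definition polar_coeff :: "('a::valued_field \<Rightarrow> 'a) \<Rightarrow> 'a \<Rightarrow> nat \<Rightarrow> 'a" where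
  "polar_coeff f \<alpha> = (THE c. polar_expansion f \<alpha> c)"

text \<open>For elliptic \<open>f\<close> the coefficients only depend on the class \<open>e\<close> of \<open>\<alpha>\<close> in the Tate curve.\<close>

definition class_polar_coeff :: "('a::valued_field \<Rightarrow> 'a) \<Rightarrow> 'a set \<Rightarrow> nat \<Rightarrow> 'a" where
  "class_polar_coeff f e k = (THE c. \<forall>\<alpha>\<in>e. polar_coeff f \<alpha> k = c)"

text \<open>
  Sums of finitely many nonzero terms over infinite index sets are written as sums over
  the support.
\<close>

definition ores :: "('a::valued_field \<Rightarrow> 'a) \<Rightarrow> 'a set set \<Rightarrow> nat \<Rightarrow> 'a" where
  "ores f \<omega> k = (\<Sum>e | e \<in> \<omega> \<and> class_polar_coeff f e k \<noteq> 0. class_polar_coeff f e k)"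


section \<open>Zeta functions and panorbital residues\<close>

text \<open>
  The summation index of the series for \<open>k = 0\<close> starts at \<open>1\<close>, whence the \<^term>\<open>Suc m\<close>.
\<close>

definition zeta_q :: "'a::valued_field \<Rightarrow> nat \<Rightarrow> 'a \<Rightarrow> 'a" where
  "zeta_q q k z =
     (if k = 0 then
        1 / (1 - z) +
        (\<Sum>m. q ^ Suc m * z / (1 - q ^ Suc m * z)
             - q ^ Suc m * inverse z / (1 - q ^ Suc m * inverse z))
      else
        (\<Sum>\<^sub>\<infinity>m::int. q powi (int k * m) * z ^ k / (1 - q powi m * z) ^ (k + 1)))"

definition polar_support ::
    "'a::valued_field \<Rightarrow> 'a \<Rightarrow> ('a set set \<Rightarrow> 'a) \<Rightarrow> ('a \<Rightarrow> 'a) \<Rightarrow> ('a set set \<times> int \<times> nat) set" where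
  "polar_support q s \<alpha> f =
     {(\<omega>, n, k). \<omega> \<in> tau_orbits q s \<and> 1 \<le> k \<and> polar_coeff f (s powi n * \<alpha> \<omega>) k \<noteq> 0}"

definition zeta_expansion ::
    "'a::valued_field \<Rightarrow> 'a \<Rightarrow> ('a set set \<Rightarrow> 'a) \<Rightarrow> ('a \<Rightarrow> 'a) \<Rightarrow> 'a \<Rightarrow> 'a" where
  "zeta_expansion q s \<alpha> f z =
     (\<Sum>(\<omega>, n, k) \<in> polar_support q s \<alpha> f.
        polar_coeff f (s powi n * \<alpha> \<omega>) k *
        (\<Sum>i = 1..k. of_nat ((k - 1) choose (i - 1)) *
           zeta_q q (i - 1) (s powi (- n) * inverse (\<alpha> \<omega>) * z)))"

definition panores_0 ::
    "'a::valued_field \<Rightarrow> 'a \<Rightarrow> ('a set set \<Rightarrow> 'a) \<Rightarrow> ('a \<Rightarrow> 'a) \<Rightarrow> 'a" where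
  "panores_0 q s \<alpha> f = (THE c. mero_eq f (\<lambda>z. c + zeta_expansion q s \<alpha> f z))"

definition panores_1 ::
    "'a::valued_field \<Rightarrow> 'a \<Rightarrow> ('a set set \<Rightarrow> 'a) \<Rightarrow> ('a \<Rightarrow> 'a) \<Rightarrow> 'a" where
  "panores_1 q s \<alpha> f =
     (\<Sum>(\<omega>, n, k) \<in> polar_support q s \<alpha> f. of_int n * polar_coeff f (s powi n * \<alpha> \<omega>) k)"

end

(*
  An elliptic function f is determined up to an additive constant by its principal parts, through its
  expansion in the functions Z_k(z / beta), where Z_k has principal part 1 / (1 - z)^k at 1 and
  Z_k(q z) = Z_k(z) + 1; the second property forces the coefficients of the expansion to sum to 0.
  This reduces everything to the coefficients c(n) of f along each orbit n -> s^n alpha: f = tau(g) - g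
  means c(n) = d(n + 1) - d(n) for the coefficients d of g.  A finitely supported d exists iff
  sum c(n) = 0 (the orbital residues), and the Z_k with coefficients d combine to an elliptic function
  iff their total sum, which is - sum n c(n) (the first panorbital residue), is 0.

  The expansion only uses a Liouville theorem: a function without poles satisfying g(q z) = g(z) + d
  is constant.  Over the complex numbers z g'(z) is invariant, hence constant by the maximum principle.
  In the non-Archimedean case the key point is that every nonzero Laurent series v on an annulus divides
  a Laurent polynomial on a slightly smaller one.  After moving the radii so that v has a unique dominant
  term at each of them, division with remainder by v is a contraction; dividing a monomial outside the
  window of remainders exhibits the multiple of v.  Hence meromorphic functions are quotients h / p with
  p a polynomial, poles are removed by dividing out roots, and a Laurent series with g(q z) = g(z) + d
  has coefficients a_n q^n = a_n for n different from 0.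
*)
theory Submission
  imports Defs
begin

section \<open>Absolute values and summation\<close>

text \<open>The two kinds of base field share little more than an absolute value, so the argument is
  cut at an interface: functions with polar expansions, locally finite poles and a Liouville
  theorem, closed under linear combinations and containing the zeta functions. Liouville must allow
  an additive constant d, because the coefficients of a zeta expansion are not known to sum to 0
  beforehand. In positive characteristic z g'(z) loses information, so the complex proof of
  Liouville has no analogue there and Laurent coefficients are compared instead. That needs a
  genuine Laurent series on an annulus containing both z and q z, whereas the definition only
  supplies fractions whose denominators vanish at unknown places; a polynomial denominator has
  finitely many roots, which algebraic closedness allows to treat one at a time. Laurent series are
  carried as two-sided sequences bounded at two real radii. Such bounds are stable under products
  and division, and real radii can be moved off the countable set where two terms of v tie. Each use
  may cost a slightly smaller annulus, which is harmless since the annuli exhaust the punctured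
  line.\<close>

lemma dist_eq_absval: "dist x y = absval (x - y)" for x :: "'a::valued_field"
  unfolding absval_def by (rule dist_diff)

lemma absval_nonneg [simp]: "0 \<le> absval x" for x :: "'a::valued_field"
  by (simp add: absval_def)

lemma absval_eq_0_iff [simp]: "absval x = 0 \<longleftrightarrow> x = 0" for x :: "'a::valued_field"
  by (simp add: absval_def)

lemma absval_pos_iff [simp]: "0 < absval x \<longleftrightarrow> x \<noteq> 0" for x :: "'a::valued_field"
  by (simp add: absval_def)

lemma absval_0 [simp]: "absval (0 :: 'a::valued_field) = 0"
  by simp

lemma absval_mult: "absval (x * y) = absval x * absval y" for x :: "'a::valued_field"
  unfolding absval_def by (rule dist_mult_0)

lemma absval_1 [simp]: "absval (1 :: 'a::valued_field) = 1"
  using absval_mult[of 1 "1::'a"] by simp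

lemma absval_minus [simp]: "absval (- x) = absval x" for x :: "'a::valued_field"
  using dist_eq_absval[of 0 x] dist_eq_absval[of x 0] by (simp add: dist_commute)

lemma absval_minus_commute: "absval (x - y) = absval (y - x)" for x :: "'a::valued_field"
  by (metis absval_minus minus_diff_eq)

lemma absval_triangle: "absval (x + y) \<le> absval x + absval y" for x :: "'a::valued_field"
  using dist_triangle[of x "- y" 0] by (simp add: dist_eq_absval)

lemma absval_reverse_triangle: "absval x - absval y \<le> absval (x - y)" for x :: "'a::valued_field"
  using absval_triangle[of "x - y" y] by simp

lemma absval_inverse: "absval (inverse x) = inverse (absval x)" for x :: "'a::valued_field"
proof (cases "x = 0")
  case False
  then have "absval (inverse x) * absval x = 1"
    by (simp flip: absval_mult)
  with False show ?thesis by (simp add: field_simps)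
qed simp

lemma absval_divide: "absval (x / y) = absval x / absval y" for x :: "'a::valued_field"
  by (simp add: divide_inverse absval_mult absval_inverse)

lemma absval_power: "absval (x ^ n) = absval x ^ n" for x :: "'a::valued_field"
  by (induction n) (simp_all add: absval_mult)

lemma absval_powi: "absval (x powi n) = absval x powi n" for x :: "'a::valued_field"
  by (simp add: power_int_def absval_power absval_inverse)

lemma absval_sum_le: "absval (sum f A) \<le> (\<Sum>x\<in>A. absval (f x))" for f :: "'b \<Rightarrow> 'a::valued_field"
proof (induction A rule: infinite_finite_induct)
  case (insert x A)
  then show ?case using absval_triangle[of "f x" "sum f A"] by simp
qed auto

section \<open>Continuity of the field operations\<close>

lemma dist_add_add_le:
  "dist (a + c) (b + d) \<le> dist a b + dist c d" for a b c d :: "'a::valued_field"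
  using absval_triangle[of "a - b" "c - d"] by (simp add: dist_eq_absval algebra_simps)

text \<open>Opens the library's unordered sums (\<open>has_sum\<close>, \<open>infsum\<close>) to
  these fields: in the non-Archimedean case only a metric and an absolute value are available,
  without the real normed structure that usually supplies these instances.\<close>

instance valued_field \<subseteq> uniform_topological_group_add
proof
  fix a b :: 'a
  show "((\<lambda>x. fst x + snd x) \<longlongrightarrow> a + b) (nhds a \<times>\<^sub>F nhds b)"
  proof (rule metric_tendsto_imp_tendsto)
    show "((\<lambda>x. dist (fst x) a + dist (snd x) b) \<longlongrightarrow> 0) (nhds a \<times>\<^sub>F nhds b)"
      unfolding nhds_prod[symmetric]
      by (rule tendsto_eq_intros tendsto_fst tendsto_snd filterlim_ident refl | simp)+
  qed (auto simp: dist_add_add_le intro!: always_eventually order.trans[OF dist_add_add_le])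
next
  fix a :: 'a
  have "dist (- x) (- a) = dist x a" for x
    using absval_minus_commute[of x a] by (simp add: dist_eq_absval)
  then show "(uminus \<longlongrightarrow> - a) (nhds a)"
    using tendsto_dist_iff[of "\<lambda>x. x" a "nhds a"] tendsto_dist_iff[of uminus "- a" "nhds a"]
    by (simp add: filterlim_ident)
next
  show "filterlim (\<lambda>((a::'a,b), (c,d)). (a + c, b + d)) uniformity (uniformity \<times>\<^sub>F uniformity)"
    unfolding filterlim_def le_filter_def eventually_filtermap case_prod_unfold
  proof safe
    fix P :: "'a \<times> 'a \<Rightarrow> bool"
    assume "eventually P uniformity"
    then obtain e where e: "e > 0" "\<And>x y. dist x y < e \<Longrightarrow> P (x, y)"
      by (auto simp: eventually_uniformity_metric)
    define Q where "Q = (\<lambda>(x::'a,y). dist x y < e / 2)"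
    have Q: "eventually Q uniformity"
      unfolding eventually_uniformity_metric Q_def using \<open>e > 0\<close>
      by (meson case_prodI divide_pos_pos zero_less_numeral)
    have "P (a + c, b + d)" if "Q (a, b)" "Q (c, d)" for a b c d
      using that dist_add_add_le[of a c b d] by (intro e) (auto simp: Q_def)
    then show "\<forall>\<^sub>F x in uniformity \<times>\<^sub>F uniformity. P (fst (fst x) + fst (snd x), snd (fst x) + snd (snd x))"
      unfolding eventually_prod_filter by (intro exI[of _ Q] conjI Q) auto
  qed
next
  have "dist (- x) (- y) = dist x y" for x y :: 'a
    using absval_minus_commute[of x y] by (simp add: dist_eq_absval)
  then show "filterlim (\<lambda>(a::'a, b). (- a, - b)) uniformity uniformity"
    by (auto simp: filterlim_def le_filter_def eventually_filtermap eventually_uniformity_metric)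
qed

instance valued_field \<subseteq> topological_ab_group_add ..

instance valued_field \<subseteq> topological_semigroup_mult
proof
  fix a b :: 'a
  have le: "dist (x * y) (a * b) \<le> dist x a * dist y b + absval a * dist y b + absval b * dist x a"
    for x y :: 'a
  proof -
    have "x * y - a * b = (x - a) * (y - b) + a * (y - b) + b * (x - a)"
      by (simp add: algebra_simps)
    then show ?thesis
      using absval_triangle[of "(x - a) * (y - b) + a * (y - b)" "b * (x - a)"]
        absval_triangle[of "(x - a) * (y - b)" "a * (y - b)"]
      by (simp add: dist_eq_absval absval_mult)
  qed
  show "((\<lambda>x. fst x * snd x) \<longlongrightarrow> a * b) (nhds a \<times>\<^sub>F nhds b)"
  proof (rule metric_tendsto_imp_tendsto)
    show "((\<lambda>x. dist (fst x) a * dist (snd x) b + absval a * dist (snd x) b + absval b * dist (fst x) a)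
       \<longlongrightarrow> 0) (nhds a \<times>\<^sub>F nhds b)"
      unfolding nhds_prod[symmetric]
      by (rule tendsto_eq_intros tendsto_fst tendsto_snd filterlim_ident refl | simp)+
  qed (auto intro!: always_eventually order.trans[OF le])
qed

instance valued_field \<subseteq> topological_comm_monoid_mult ..

lemma tendsto_absval [tendsto_intros]:
  fixes f :: "'b \<Rightarrow> 'a::valued_field"
  shows "(f \<longlongrightarrow> a) F \<Longrightarrow> ((\<lambda>x. absval (f x)) \<longlongrightarrow> absval a) F"
  unfolding absval_def by (intro tendsto_intros)

lemma tendsto_absval_zero_iff:
  fixes f :: "'b \<Rightarrow> 'a::valued_field"
  shows "(f \<longlongrightarrow> 0) F \<longleftrightarrow> ((\<lambda>x. absval (f x)) \<longlongrightarrow> 0) F"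
  unfolding absval_def by (rule tendsto_dist_iff)

text \<open>Completeness turns domination into convergence: the partial sums form a Cauchy filter
  because the difference of two nested ones is at most that of the sums of absolute values.
  Arbitrary finite sets are compared through their union with \<open>F'\<close>.\<close>

lemma absval_summable_imp_summable_on:
  fixes f :: "'b \<Rightarrow> 'a::{valued_field,complete_space}"
  assumes "(\<lambda>x. absval (f x)) summable_on A"
  shows "f summable_on A"
proof -
  let ?g = "\<lambda>x. absval (f x)"
  from assms obtain L where lim: "(sum ?g \<longlongrightarrow> L) (finite_subsets_at_top A)"
    unfolding has_sum_def summable_on_def by blast
  have "\<exists>P. eventually P (finite_subsets_at_top A) \<and>
              (\<forall>F F'. P F \<and> P F' \<longrightarrow> dist (sum f F) (sum f F') < e)" if "e > 0" for e
  proof -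
    define P where "P F \<longleftrightarrow> finite F \<and> F \<subseteq> A \<and> dist (sum ?g F) L < e / 4" for F
    have ev_P: "eventually P (finite_subsets_at_top A)"
      unfolding P_def[abs_def] eventually_conj_iff
      using tendstoD[OF lim, of "e / 4"] that
      by (auto intro: eventually_finite_subsets_at_top_weakI)
    then obtain F' where F': "finite F'" "F' \<subseteq> A" "\<And>F. finite F \<and> F \<supseteq> F' \<and> F \<subseteq> A \<Longrightarrow> P F"
      unfolding eventually_finite_subsets_at_top by auto
    have close: "dist (sum f F) (sum f G) < e / 2" if "P F" "P G" "G \<subseteq> F" for F G
    proof -
      have fin: "finite F" using that by (simp add: P_def)
      have "dist (sum f F) (sum f G) = absval (sum f (F - G))"
        using fin that(3) by (simp add: dist_eq_absval sum_diff)
      also have "\<dots> \<le> sum ?g (F - G)" by (rule absval_sum_le)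
      also have "\<dots> = sum ?g F - sum ?g G"
        using fin that(3) by (simp add: sum_diff)
      also have "\<dots> < e / 2"
        using that(1,2) unfolding P_def dist_real_def by linarith
      finally show ?thesis .
    qed
    have "dist (sum f F1) (sum f F2) < e" if "P F1" "P F2" for F1 F2
    proof -
      let ?F = "F' \<union> F1 \<union> F2"
      have "P ?F" using that F' by (intro F'(3)) (auto simp: P_def)
      then have "dist (sum f ?F) (sum f F1) < e / 2" "dist (sum f ?F) (sum f F2) < e / 2"
        using close[OF _ that(1)] close[OF _ that(2)] by blast+
      then show ?thesis
        using dist_triangle3[of "sum f F1" "sum f F2" "sum f ?F"] by linarith
    qed
    then show ?thesis using ev_P by blast
  qed
  then have "cauchy_filter (filtermap (sum f) (finite_subsets_at_top A))"
    by (simp add: cauchy_filter_metric_filtermap)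
  moreover have "complete (UNIV::'a set)"
    by (meson Cauchy_convergent UNIV_I complete_def convergent_def)
  ultimately obtain L' where "(sum f \<longlongrightarrow> L') (finite_subsets_at_top A)"
    using complete_uniform[where S=UNIV] by (force simp add: filterlim_def)
  then show ?thesis
    using summable_on_def has_sum_def by blast
qed

lemma absval_summable_on_comparison:
  fixes f :: "'b \<Rightarrow> 'a::{valued_field,complete_space}"
  assumes "g summable_on A" "\<And>x. x \<in> A \<Longrightarrow> absval (f x) \<le> g x"
  shows "f summable_on A"
  by (rule absval_summable_imp_summable_on, rule summable_on_comparison_test[OF assms(1)])
     (use assms(2) in auto)

lemma absval_has_sum_le:
  fixes f :: "'b \<Rightarrow> 'a::valued_field"
  assumes f: "(f has_sum s) A" and g: "(g has_sum t) A" and le: "\<And>x. x \<in> A \<Longrightarrow> absval (f x) \<le> g x"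
  shows "absval s \<le> t"
proof (rule tendsto_le)
  show "((\<lambda>F. absval (sum f F)) \<longlongrightarrow> absval s) (finite_subsets_at_top A)"
    using f unfolding has_sum_def by (rule tendsto_absval)
  show "(sum g \<longlongrightarrow> t) (finite_subsets_at_top A)"
    using g unfolding has_sum_def .
  show "\<forall>\<^sub>F F in finite_subsets_at_top A. absval (sum f F) \<le> sum g F"
    by (rule eventually_finite_subsets_at_top_weakI)
       (auto intro!: order.trans[OF absval_sum_le] sum_mono le)
qed simp

lemma has_sum_nat_geometric: "((\<lambda>n. \<theta> ^ n) has_sum (1 / (1 - \<theta>))) UNIV" 
  if "0 \<le> \<theta>" "\<theta> < 1" for \<theta> :: real
  using that by (intro sums_nonneg_imp_has_sum geometric_sums) auto

lemma has_sum_int_split: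
  fixes f :: "int \<Rightarrow> 'a::topological_comm_monoid_add"
  assumes "((\<lambda>n::nat. f (int n)) has_sum a) UNIV"
    and "((\<lambda>n::nat. f (- int (Suc n))) has_sum b) UNIV"
  shows "(f has_sum (a + b)) UNIV"
proof -
  have "(f has_sum a) {0..}"
    using has_sum_reindex_bij_betw[OF bij_betwI[of int UNIV "{0..}" nat], of f a] assms(1) by auto
  moreover have "bij_betw (\<lambda>n::nat. - int (Suc n)) UNIV {..<0}"
    by (rule bij_betwI[of _ _ _ "\<lambda>m. nat (- m - 1)"]) auto
  then have "(f has_sum b) {..<0}"
    using has_sum_reindex_bij_betw[of "\<lambda>n::nat. - int (Suc n)" UNIV "{..<0}" f b] assms(2) by metis
  ultimately have "(f has_sum (a + b)) ({0..} \<union> {..<0})"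
    by (intro has_sum_Un_disjoint) auto
  moreover have "{0..} \<union> {..<0} = (UNIV :: int set)" by auto
  ultimately show ?thesis by simp
qed

lemma summable_on_int_geometric: "(\<lambda>n::int. C * \<theta> ^ nat \<bar>n\<bar>) summable_on UNIV"
  if "0 \<le> \<theta>" "\<theta> < 1" for \<theta> C :: real
proof -
  have "((\<lambda>n::nat. \<theta> ^ nat \<bar>int n\<bar>) has_sum (1 / (1 - \<theta>))) UNIV"
    using has_sum_nat_geometric[OF that] by simp
  moreover have "nat \<bar>- int (Suc n)\<bar> = Suc n" for n by linarith
  then have "((\<lambda>n::nat. \<theta> ^ nat \<bar>- int (Suc n)\<bar>) has_sum (\<theta> * (1 / (1 - \<theta>)))) UNIV"
    using has_sum_cmult_right[OF has_sum_nat_geometric[OF that], of \<theta>] by simp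
  ultimately have "((\<lambda>n::int. \<theta> ^ nat \<bar>n\<bar>) has_sum (1 / (1 - \<theta>) + \<theta> * (1 / (1 - \<theta>)))) UNIV"
    by (rule has_sum_int_split)
  then show ?thesis
    by (intro summable_on_cmult_right) (rule has_sum_imp_summable)
qed

lemma tendsto_inverse_valued:
  fixes f :: "'b \<Rightarrow> 'a::valued_field"
  assumes f: "(f \<longlongrightarrow> a) F" and a: "a \<noteq> 0"
  shows "((\<lambda>x. inverse (f x)) \<longlongrightarrow> inverse a) F"
proof (rule metric_tendsto_imp_tendsto)
  have "((\<lambda>x. dist (f x) a) \<longlongrightarrow> 0) F"
    using f tendsto_dist_iff by blast
  then show "((\<lambda>x. 2 / absval a ^ 2 * dist (f x) a) \<longlongrightarrow> 0) F"
    using tendsto_mult_right_zero by blast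
  have "\<forall>\<^sub>F x in F. dist (f x) a < absval a / 2"
    using f a by (intro tendstoD) auto
  then show "\<forall>\<^sub>F x in F. dist (inverse (f x)) (inverse a) \<le> dist (2 / absval a ^ 2 * dist (f x) a) 0"
  proof eventually_elim
    case (elim x)
    have big: "absval a / 2 \<le> absval (f x)"
      using elim absval_reverse_triangle[of a "f x"] by (simp add: dist_eq_absval absval_minus_commute)
    then have [simp]: "f x \<noteq> 0"
      using absval_pos_iff[of a] absval_eq_0_iff[of "f x"] a by linarith
    have "inverse (f x) - inverse a = (a - f x) / (f x * a)"
      using a by (simp add: field_simps)
    then have "dist (inverse (f x)) (inverse a) = dist (f x) a / (absval (f x) * absval a)"
      by (simp add: dist_eq_absval absval_divide absval_mult absval_minus_commute)
    also have "\<dots> \<le> dist (f x) a / (absval a / 2 * absval a)"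
      using a big by (intro divide_left_mono mult_right_mono) auto
    finally show ?case by (simp add: power2_eq_square mult.commute)
  qed
qed

lemma tendsto_divide_valued:
  fixes f g :: "'b \<Rightarrow> 'a::valued_field"
  assumes "(f \<longlongrightarrow> a) F" "(g \<longlongrightarrow> b) F" "b \<noteq> 0"
  shows "((\<lambda>x. f x / g x) \<longlongrightarrow> a / b) F"
  unfolding divide_inverse by (intro tendsto_mult tendsto_inverse_valued assms)

lemma tendsto_power_valued:
  fixes f :: "'b \<Rightarrow> 'a::valued_field"
  shows "(f \<longlongrightarrow> a) F \<Longrightarrow> ((\<lambda>x. f x ^ n) \<longlongrightarrow> a ^ n) F"
  by (induction n) (auto intro: tendsto_mult)

lemma sums_imp_tendsto_0:
  fixes f :: "nat \<Rightarrow> 'a::topological_ab_group_add"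
  assumes "f sums s"
  shows "f \<longlonglongrightarrow> 0"
proof -
  have "(\<lambda>n. sum f {..<Suc n} - sum f {..<n}) \<longlonglongrightarrow> s - s"
    using assms unfolding sums_def by (intro tendsto_diff LIMSEQ_Suc)
  then show ?thesis by simp
qed

section \<open>Functions bounded near a point\<close>

text \<open>Stands for the absence of a pole. The filter \<open>at \<alpha>\<close> ignores the
  value at \<alpha>, which is arbitrary for a total function representing a meromorphic one.\<close>

definition bdd_near :: "('a::valued_field \<Rightarrow> 'a) \<Rightarrow> 'a \<Rightarrow> bool" where
  "bdd_near F \<alpha> \<longleftrightarrow> (\<exists>C. \<forall>\<^sub>F z in at \<alpha>. absval (F z) \<le> C)"

lemma bdd_nearI: "\<forall>\<^sub>F z in at \<alpha>. absval (F z) \<le> C \<Longrightarrow> bdd_near F \<alpha>"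
  unfolding bdd_near_def by blast

lemma bdd_near_cong:
  assumes "\<forall>\<^sub>F z in at \<alpha>. F z = G z"
  shows "bdd_near F \<alpha> \<longleftrightarrow> bdd_near G \<alpha>"
  unfolding bdd_near_def
  by (intro ex_cong1 eventually_cong[OF assms] refl) auto

lemma bdd_near_eventually_eq:
  "\<forall>\<^sub>F z in at \<alpha>. F z = G z \<Longrightarrow> bdd_near G \<alpha> \<Longrightarrow> bdd_near F \<alpha>"
  by (simp add: bdd_near_cong)

lemma bdd_near_tendsto: "(F \<longlongrightarrow> l) (at \<alpha>) \<Longrightarrow> bdd_near F \<alpha>"
proof (rule bdd_nearI)
  assume "(F \<longlongrightarrow> l) (at \<alpha>)"
  then have "\<forall>\<^sub>F z in at \<alpha>. absval (F z) < absval l + 1"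
    by (intro order_tendstoD(2)[OF tendsto_absval]) auto
  then show "\<forall>\<^sub>F z in at \<alpha>. absval (F z) \<le> absval l + 1"
    by eventually_elim simp
qed

lemma bdd_near_const [simp]: "bdd_near (\<lambda>_. c) \<alpha>"
  by (rule bdd_near_tendsto[OF tendsto_const])

lemma bdd_near_add:
  assumes "bdd_near F \<alpha>" "bdd_near G \<alpha>"
  shows "bdd_near (\<lambda>z. F z + G z) \<alpha>"
proof -
  from assms obtain C D where "\<forall>\<^sub>F z in at \<alpha>. absval (F z) \<le> C" "\<forall>\<^sub>F z in at \<alpha>. absval (G z) \<le> D"
    unfolding bdd_near_def by blast
  then have "\<forall>\<^sub>F z in at \<alpha>. absval (F z + G z) \<le> C + D"
    by eventually_elim (meson absval_triangle add_mono order.trans)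
  then show ?thesis by (rule bdd_nearI)
qed

lemma bdd_near_mult:
  assumes "bdd_near F \<alpha>" "bdd_near G \<alpha>"
  shows "bdd_near (\<lambda>z. F z * G z) \<alpha>"
proof -
  from assms obtain C D where "\<forall>\<^sub>F z in at \<alpha>. absval (F z) \<le> C" "\<forall>\<^sub>F z in at \<alpha>. absval (G z) \<le> D"
    unfolding bdd_near_def by blast
  then have "\<forall>\<^sub>F z in at \<alpha>. absval (F z * G z) \<le> C * D"
    by eventually_elim (auto simp: absval_mult intro!: mult_mono order.trans[OF absval_nonneg])
  then show ?thesis by (rule bdd_nearI)
qed

lemma bdd_near_cmult: "bdd_near F \<alpha> \<Longrightarrow> bdd_near (\<lambda>z. c * F z) \<alpha>"
  using bdd_near_mult[of "\<lambda>_. c"] by simp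

lemma bdd_near_uminus: "bdd_near F \<alpha> \<Longrightarrow> bdd_near (\<lambda>z. - F z) \<alpha>"
  unfolding bdd_near_def by simp

lemma bdd_near_diff: "bdd_near F \<alpha> \<Longrightarrow> bdd_near G \<alpha> \<Longrightarrow> bdd_near (\<lambda>z. F z - G z) \<alpha>"
  using bdd_near_add[of F \<alpha> "\<lambda>z. - G z"] by (simp add: bdd_near_uminus)

lemma bdd_near_sum: "(\<And>x. x \<in> A \<Longrightarrow> bdd_near (F x) \<alpha>) \<Longrightarrow> bdd_near (\<lambda>z. \<Sum>x\<in>A. F x z) \<alpha>"
  by (induction A rule: infinite_finite_induct) (auto intro: bdd_near_add)

lemma filtermap_mult_at:
  fixes c :: "'a::valued_field"
  assumes "c \<noteq> 0"
  shows "filtermap (\<lambda>z. c * z) (at \<alpha>) = at (c * \<alpha>)"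
proof (rule filtermap_fun_inverse)
  have "((\<lambda>z. inverse c * z) \<longlongrightarrow> inverse c * (c * \<alpha>)) (at (c * \<alpha>))"
    by (intro tendsto_mult tendsto_const tendsto_ident_at)
  then show "filterlim (\<lambda>z. inverse c * z) (at \<alpha>) (at (c * \<alpha>))"
    using assms by (auto simp: filterlim_at eventually_at_filter field_simps)
  show "filterlim (\<lambda>z. c * z) (at (c * \<alpha>)) (at \<alpha>)"
    using assms by (auto simp: filterlim_at eventually_at_filter intro!: tendsto_eq_intros)
qed (use assms in \<open>auto simp: field_simps\<close>)

lemma eventually_at_mult_iff:
  fixes c :: "'a::valued_field"
  assumes "c \<noteq> 0"
  shows "(\<forall>\<^sub>F z in at (c * \<alpha>). P z) \<longleftrightarrow> (\<forall>\<^sub>F z in at \<alpha>. P (c * z))"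
  unfolding filtermap_mult_at[OF assms, symmetric] eventually_filtermap ..

lemma bdd_near_mult_iff: "c \<noteq> 0 \<Longrightarrow> bdd_near F (c * \<alpha>) \<longleftrightarrow> bdd_near (\<lambda>z. F (c * z)) \<alpha>"
  unfolding bdd_near_def by (subst eventually_at_mult_iff) auto

text \<open>The points \<alpha> + q^n accumulate at \<alpha>. Here q witnesses that the absolute
  value is nontrivial; with a discrete metric every limit at \<alpha> would be vacuous.\<close>

lemma at_nontrivial:
  fixes q \<alpha> :: "'a::valued_field"
  assumes "q \<noteq> 0" "absval q < 1"
  shows "at \<alpha> \<noteq> bot"
proof -
  have "(\<lambda>n. q ^ n) \<longlonglongrightarrow> 0"
    using assms by (subst tendsto_absval_zero_iff) (auto simp: absval_power intro: LIMSEQ_realpow_zero)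
  then have "(\<lambda>n. \<alpha> + q ^ n) \<longlonglongrightarrow> \<alpha> + 0" by (intro tendsto_intros)
  then have "filterlim (\<lambda>n. \<alpha> + q ^ n) (at \<alpha>) sequentially"
    using assms by (auto simp: filterlim_at)
  then show ?thesis
    unfolding filterlim_def using le_bot filtermap_bot_iff sequentially_bot by metis
qed

lemma eventually_at_not_in_finite: "finite S \<Longrightarrow> \<forall>\<^sub>F z in at \<alpha>. z \<notin> S" for \<alpha> :: "'a::t1_space"
proof -
  assume "finite S"
  then have "open (- (S - {\<alpha>}))" 
    by (intro open_Compl finite_imp_closed finite_Diff)
  then have "\<forall>\<^sub>F z in nhds \<alpha>. z \<in> - (S - {\<alpha>})" by (intro eventually_nhds_in_open) auto
  then show ?thesis unfolding eventually_at_filter by eventually_elim auto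
qed

section \<open>Equality of meromorphic functions\<close>

lemma mero_eq_refl [simp]: "mero_eq f f"
  by (simp add: mero_eq_def)

lemma mero_eq_sym: "mero_eq f g \<Longrightarrow> mero_eq g f"
  by (simp add: mero_eq_def eq_commute)

lemma mero_eq_trans: "mero_eq f g \<Longrightarrow> mero_eq g h \<Longrightarrow> mero_eq f h"
  unfolding mero_eq_def
proof (intro allI impI)
  fix a b :: real
  assume "0 < a" and
    "\<forall>a b. 0 < a \<longrightarrow> finite {z. a \<le> absval z \<and> absval z \<le> b \<and> f z \<noteq> g z}"
    "\<forall>a b. 0 < a \<longrightarrow> finite {z. a \<le> absval z \<and> absval z \<le> b \<and> g z \<noteq> h z}"
  then have "finite ({z. a \<le> absval z \<and> absval z \<le> b \<and> f z \<noteq> g z} \<union> {z. a \<le> absval z \<and> absval z \<le> b \<and> g z \<noteq> h z})"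
    by blast
  then show "finite {z. a \<le> absval z \<and> absval z \<le> b \<and> f z \<noteq> h z}"
    by (rule rev_finite_subset) auto
qed

lemma mero_eq_comp2:
  assumes "mero_eq f f'" "mero_eq g g'"
  shows "mero_eq (\<lambda>z. h (f z) (g z)) (\<lambda>z. h (f' z) (g' z))"
  unfolding mero_eq_def
proof (intro allI impI)
  fix a b :: real
  assume "0 < a"
  then have "finite ({z. a \<le> absval z \<and> absval z \<le> b \<and> f z \<noteq> f' z} \<union> {z. a \<le> absval z \<and> absval z \<le> b \<and> g z \<noteq> g' z})"
    using assms unfolding mero_eq_def by blast
  then show "finite {z. a \<le> absval z \<and> absval z \<le> b \<and> h (f z) (g z) \<noteq> h (f' z) (g' z)}"
    by (rule rev_finite_subset) auto
qed

lemmas mero_eq_add = mero_eq_comp2[where h = "(+)"]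
lemmas mero_eq_diff = mero_eq_comp2[where h = "(-)"]

lemma mero_eq_sum:
  "(\<And>x. x \<in> A \<Longrightarrow> mero_eq (F x) (G x)) \<Longrightarrow> mero_eq (\<lambda>z. \<Sum>x\<in>A. F x z) (\<lambda>z. \<Sum>x\<in>A. G x z)"
  by (induction A rule: infinite_finite_induct) (auto intro: mero_eq_add)

lemma mero_eq_mult_arg:
  assumes "mero_eq f g" "c \<noteq> 0"
  shows "mero_eq (\<lambda>z. f (c * z)) (\<lambda>z. g (c * z))"
  unfolding mero_eq_def
proof (intro allI impI)
  fix a b :: real
  assume "0 < a"
  let ?S = "{z. absval c * a \<le> absval z \<and> absval z \<le> absval c * b \<and> f z \<noteq> g z}"
  have "finite ?S"
    using assms \<open>0 < a\<close> unfolding mero_eq_def by simp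
  then have "finite ((\<lambda>z. c * z) -` ?S)"
    using assms by (intro finite_vimageI) (auto simp: inj_def)
  then show "finite {z. a \<le> absval z \<and> absval z \<le> b \<and> f (c * z) \<noteq> g (c * z)}"
    by (rule rev_finite_subset) (auto simp: absval_mult intro: mult_left_mono)
qed

text \<open>A neighbourhood of \<alpha> lies in the annulus between |\<alpha>|/2 and 2|\<alpha>|,
  where only finitely many points are exceptional. This converts equality of meromorphic functions
  into the local form that principal parts need.\<close>

lemma mero_eq_eventually:
  assumes "mero_eq f g" "\<alpha> \<noteq> 0"
  shows "\<forall>\<^sub>F z in at \<alpha>. f z = g z"
proof -
  have lim: "((\<lambda>z. absval z) \<longlongrightarrow> absval \<alpha>) (at \<alpha>)"
    by (intro tendsto_absval) simp
  have "0 < absval \<alpha> / 2" using assms(2) by simp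
  then have "finite {z. absval \<alpha> / 2 \<le> absval z \<and> absval z \<le> 2 * absval \<alpha> \<and> f z \<noteq> g z}"
    using assms(1) unfolding mero_eq_def by blast
  from eventually_at_not_in_finite[OF this]
  have "\<forall>\<^sub>F z in at \<alpha>. \<not> (absval \<alpha> / 2 \<le> absval z \<and> absval z \<le> 2 * absval \<alpha> \<and> f z \<noteq> g z)"
    by (rule eventually_mono) auto
  moreover have "\<forall>\<^sub>F z in at \<alpha>. absval \<alpha> / 2 < absval z" "\<forall>\<^sub>F z in at \<alpha>. absval z < 2 * absval \<alpha>"
    using absval_pos_iff[of \<alpha>] assms(2) by (intro order_tendstoD[OF lim]; linarith)+
  ultimately show ?thesis by eventually_elim auto
qed

section \<open>Principal parts\<close>

text \<open>
  Polar coefficients are characterised by boundedness of the difference to the principal part.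
  Unlike \<^const>\<open>polar_expansion\<close>, this is visibly compatible with all operations used below.
\<close>

definition principal_part :: "('a::valued_field \<Rightarrow> 'a) \<Rightarrow> 'a \<Rightarrow> (nat \<Rightarrow> 'a) \<Rightarrow> bool" where
  "principal_part f \<alpha> c \<longleftrightarrow> c 0 = 0 \<and> finite {k. c k \<noteq> 0} \<and>
     bdd_near (\<lambda>z. f z - (\<Sum>k | c k \<noteq> 0. c k / (1 - z / \<alpha>) ^ k)) \<alpha>"

lemma principal_partI:
  assumes "c 0 = 0" "finite K" "\<And>k. c k \<noteq> 0 \<Longrightarrow> k \<in> K"
    and "bdd_near (\<lambda>z. f z - (\<Sum>k\<in>K. c k / (1 - z / \<alpha>) ^ k)) \<alpha>"
  shows "principal_part f \<alpha> c"
proof -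
  have "(\<Sum>k\<in>K. c k / (1 - z / \<alpha>) ^ k) = (\<Sum>k | c k \<noteq> 0. c k / (1 - z / \<alpha>) ^ k)" for z
    using assms(2,3) by (intro sum.mono_neutral_right) auto
  moreover have "finite {k. c k \<noteq> 0}"
    using assms(2,3) by (auto intro: finite_subset)
  ultimately show ?thesis
    using assms unfolding principal_part_def by simp
qed

text \<open>Two principal parts are subtracted after their supports have been enlarged to a common
  finite index set.\<close>

lemma principal_part_superset:
  assumes "principal_part f \<alpha> c" "finite K" "\<And>k. c k \<noteq> 0 \<Longrightarrow> k \<in> K"
  shows "bdd_near (\<lambda>z. f z - (\<Sum>k\<in>K. c k / (1 - z / \<alpha>) ^ k)) \<alpha>"
proof -
  have "(\<Sum>k\<in>K. c k / (1 - z / \<alpha>) ^ k) = (\<Sum>k | c k \<noteq> 0. c k / (1 - z / \<alpha>) ^ k)" for z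
    using assms(2,3) by (intro sum.mono_neutral_right) auto
  then show ?thesis
    using assms unfolding principal_part_def by simp
qed

lemma bdd_near_imp_principal_part_0: "bdd_near f \<alpha> \<Longrightarrow> principal_part f \<alpha> (\<lambda>_. 0)"
  by (simp add: principal_part_def)

lemma principal_part_0_imp_bdd_near: "principal_part f \<alpha> (\<lambda>_. 0) \<Longrightarrow> bdd_near f \<alpha>"
  by (simp add: principal_part_def)

lemma principal_part_cong:
  assumes "\<forall>\<^sub>F z in at \<alpha>. f z = g z" "principal_part f \<alpha> c"
  shows "principal_part g \<alpha> c"
proof -
  have "\<forall>\<^sub>F z in at \<alpha>. f z - (\<Sum>k | c k \<noteq> 0. c k / (1 - z / \<alpha>) ^ k) = g z - (\<Sum>k | c k \<noteq> 0. c k / (1 - z / \<alpha>) ^ k)"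
    using assms(1) by eventually_elim simp
  from bdd_near_cong[OF this] assms(2) show ?thesis
    unfolding principal_part_def by simp
qed

lemma principal_part_diff:
  assumes c: "principal_part f \<alpha> c" and d: "principal_part g \<alpha> d"
  shows "principal_part (\<lambda>z. f z - g z) \<alpha> (\<lambda>k. c k - d k)"
proof -
  let ?K = "{k. c k \<noteq> 0} \<union> {k. d k \<noteq> 0}"
  have fin: "finite ?K" using c d by (simp add: principal_part_def)
  have "bdd_near (\<lambda>z. (f z - (\<Sum>k\<in>?K. c k / (1 - z / \<alpha>) ^ k)) - (g z - (\<Sum>k\<in>?K. d k / (1 - z / \<alpha>) ^ k))) \<alpha>"
    by (rule bdd_near_diff[OF principal_part_superset[OF c fin] principal_part_superset[OF d fin]]) auto
  also have "(\<lambda>z. (f z - (\<Sum>k\<in>?K. c k / (1 - z / \<alpha>) ^ k)) - (g z - (\<Sum>k\<in>?K. d k / (1 - z / \<alpha>) ^ k))) =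
    (\<lambda>z. f z - g z - (\<Sum>k\<in>?K. (c k - d k) / (1 - z / \<alpha>) ^ k))"
    by (simp add: diff_divide_distrib sum_subtractf fun_eq_iff)
  finally have bdd: "bdd_near (\<lambda>z. f z - g z - (\<Sum>k\<in>?K. (c k - d k) / (1 - z / \<alpha>) ^ k)) \<alpha>" .
  show ?thesis
  proof (rule principal_partI[OF _ fin _ bdd])
    show "c 0 - d 0 = 0" using c d by (simp add: principal_part_def)
    show "k \<in> ?K" if "c k - d k \<noteq> 0" for k using that by (cases "c k = 0") auto
  qed
qed

lemma principal_part_mult_arg:
  assumes "principal_part f (s * \<alpha>) c" "s \<noteq> 0"
  shows "principal_part (\<lambda>z. f (s * z)) \<alpha> c"
  using assms by (auto simp: principal_part_def bdd_near_mult_iff)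

text \<open>Let N be the largest index with a nonzero coefficient. Multiplied by (1 - z/\<alpha>)^N,
  the sum tends to \<open>d N\<close>; being bounded before the multiplication, it also tends to
  0.\<close>

lemma bdd_near_principal_zero:
  fixes q \<alpha> :: "'a::valued_field"
  assumes q: "q \<noteq> 0" "absval q < 1" and \<alpha>: "\<alpha> \<noteq> 0"
    and K: "finite K" "0 \<notin> K"
    and bdd: "bdd_near (\<lambda>z. \<Sum>k\<in>K. d k / (1 - z / \<alpha>) ^ k) \<alpha>"
    and k: "k \<in> K"
  shows "d k = 0"
proof (rule ccontr)
  assume "d k \<noteq> 0"
  define L where "L = {k\<in>K. d k \<noteq> 0}"
  have L: "finite L" "L \<noteq> {}" using K k \<open>d k \<noteq> 0\<close> by (auto simp: L_def)
  define N where "N = Max L"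
  have N: "N \<in> L" "\<And>k. k \<in> L \<Longrightarrow> k \<le> N" using L by (auto simp: N_def)
  have w0: "((\<lambda>z. 1 - z / \<alpha>) \<longlongrightarrow> 0) (at \<alpha>)"
    using tendsto_diff[OF tendsto_const tendsto_divide_valued[OF tendsto_ident_at tendsto_const \<alpha>], of 1 \<alpha> UNIV] \<alpha>
    by simp
  have "N > 0" using N(1) K by (cases N) (auto simp: L_def)
  have "((\<lambda>z. \<Sum>k\<in>L. d k * (1 - z / \<alpha>) ^ (N - k)) \<longlongrightarrow> (\<Sum>k\<in>L. d k * 0 ^ (N - k))) (at \<alpha>)"
    by (intro tendsto_sum tendsto_mult tendsto_const tendsto_power_valued w0)
  moreover have "(\<Sum>k\<in>L. d k * 0 ^ (N - k)) = d N"
  proof -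
    have "(\<Sum>k\<in>L. d k * 0 ^ (N - k)) = (\<Sum>k\<in>L. if k = N then d N else 0)"
    proof (rule sum.cong)
      fix k assume "k \<in> L"
      then show "d k * 0 ^ (N - k) = (if k = N then d N else 0)"
        using N(2)[of k] by (auto simp: power_0_left)
    qed simp
    then show ?thesis using L N(1) by simp
  qed
  ultimately have lim1: "((\<lambda>z. \<Sum>k\<in>L. d k * (1 - z / \<alpha>) ^ (N - k)) \<longlongrightarrow> d N) (at \<alpha>)" by simp
  obtain C where C: "\<forall>\<^sub>F z in at \<alpha>. absval (\<Sum>k\<in>K. d k / (1 - z / \<alpha>) ^ k) \<le> C"
    using bdd unfolding bdd_near_def by blast
  have ne: "\<forall>\<^sub>F z in at \<alpha>. z \<noteq> \<alpha>" by (simp add: eventually_at_filter)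
  have "((\<lambda>z. \<Sum>k\<in>L. d k * (1 - z / \<alpha>) ^ (N - k)) \<longlongrightarrow> 0) (at \<alpha>)"
  proof (rule metric_tendsto_imp_tendsto)
    show "((\<lambda>z. C * absval ((1 - z / \<alpha>) ^ N)) \<longlongrightarrow> 0) (at \<alpha>)"
      using tendsto_mult[OF tendsto_const tendsto_absval[OF tendsto_power_valued[OF w0]], of C N] \<open>N > 0\<close>
      by (simp add: power_0_left)
    show "\<forall>\<^sub>F z in at \<alpha>. dist (\<Sum>k\<in>L. d k * (1 - z / \<alpha>) ^ (N - k)) 0 \<le> dist (C * absval ((1 - z / \<alpha>) ^ N)) 0"
      using C ne
    proof eventually_elim
      case (elim z)
      let ?w = "1 - z / \<alpha>"
      have w: "?w \<noteq> 0" using \<alpha> elim by simp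
      have "(\<Sum>k\<in>L. d k * ?w ^ (N - k)) = ?w ^ N * (\<Sum>k\<in>L. d k / ?w ^ k)"
        unfolding sum_distrib_left using w N(2)
        by (intro sum.cong refl) (auto simp: power_diff)
      also have "(\<Sum>k\<in>L. d k / ?w ^ k) = (\<Sum>k\<in>K. d k / ?w ^ k)"
        using K by (intro sum.mono_neutral_left) (auto simp: L_def)
      finally have "absval (\<Sum>k\<in>L. d k * ?w ^ (N - k)) \<le> absval (?w ^ N) * C"
        using elim by (simp add: absval_mult mult_left_mono)
      then show ?case by (simp add: absval_def[symmetric] mult.commute)
    qed
  qed
  with lim1 have "d N = 0"
    using tendsto_unique at_nontrivial[OF q] by blast
  with N show False by (simp add: L_def)
qed

lemma principal_part_unique:
  fixes q \<alpha> :: "'a::valued_field"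
  assumes q: "q \<noteq> 0" "absval q < 1" and \<alpha>: "\<alpha> \<noteq> 0"
    and c: "principal_part f \<alpha> c" and d: "principal_part f \<alpha> d"
  shows "c = d"
proof
  fix k
  let ?e = "\<lambda>k. c k - d k"
  have e: "principal_part (\<lambda>z. 0) \<alpha> ?e"
    using principal_part_diff[OF c d] by simp
  let ?K = "{k. ?e k \<noteq> 0}"
  have K: "finite ?K" "0 \<notin> ?K" using e by (auto simp: principal_part_def)
  have "bdd_near (\<lambda>z. - (0 - (\<Sum>k\<in>?K. ?e k / (1 - z / \<alpha>) ^ k))) \<alpha>"
    using e unfolding principal_part_def by (intro bdd_near_uminus) simp
  then have "?e k = 0" if "k \<in> ?K"
    using bdd_near_principal_zero[OF q \<alpha> K _ that, of ?e] by simp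
  then show "c k = d k" by fastforce
qed

text \<open>Abel's argument: convergence at one nearby point bounds the terms by some B there, and
  where 1 - z/\<alpha> is less than half as large the series is dominated by B times a geometric
  series with sum at most 2.\<close>

lemma polar_expansion_imp_principal_part:
  fixes q \<alpha> :: "'a::valued_field"
  assumes q: "q \<noteq> 0" "absval q < 1" and \<alpha>: "\<alpha> \<noteq> 0" and c: "polar_expansion f \<alpha> c"
  shows "principal_part f \<alpha> c"
proof -
  let ?g = "\<lambda>z. f z - (\<Sum>k | c k \<noteq> 0. c k / (1 - z / \<alpha>) ^ k)"
  from c obtain h r where r: "r > 0" and
    sums: "\<And>z. 0 < absval (1 - z / \<alpha>) \<and> absval (1 - z / \<alpha>) < r \<Longrightarrow> (\<lambda>j. h j * (1 - z / \<alpha>) ^ j) sums ?g z"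
    unfolding polar_expansion_def by blast
  have "(\<lambda>n. absval q ^ n) \<longlonglongrightarrow> 0"
    using q by (intro LIMSEQ_realpow_zero) auto
  then have "\<forall>\<^sub>F n in sequentially. absval q ^ n < r"
    using r by (intro order_tendstoD) auto
  then obtain n where n: "absval q ^ n < r"
    by (auto simp: eventually_sequentially)
  \<comment> \<open>The value group need not contain every small real, so the comparison point is
    taken at a power of q.\<close>
  define w where "w = q ^ n"
  have w: "w \<noteq> 0" "absval w < r" using q n by (auto simp: w_def absval_power)
  define z0 where "z0 = \<alpha> * (1 - w)"
  have "1 - z0 / \<alpha> = w" using \<alpha> by (simp add: z0_def)
  then have "(\<lambda>j. h j * w ^ j) \<longlonglongrightarrow> 0"
    using sums[of z0] w by (metis absval_pos_iff sums_imp_tendsto_0)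
  then have "Bseq (\<lambda>j. absval (h j * w ^ j))"
    by (intro convergent_imp_Bseq convergentI[OF tendsto_absval])
  then obtain B where "\<forall>j. norm (absval (h j * w ^ j)) \<le> B"
    by (rule BseqE)
  then have B: "absval (h j * w ^ j) \<le> B" for j
    using abs_ge_self order.trans unfolding real_norm_def by blast
  have "B \<ge> 0" using order.trans[OF absval_nonneg B] .
  have bound: "absval (?g z) \<le> 2 * B"
    if "z \<noteq> \<alpha>" "absval (1 - z / \<alpha>) < absval w / 2" for z
  proof (rule Lim_bounded)
    let ?w = "1 - z / \<alpha>"
    have "absval ?w < r" using that w absval_nonneg[of w] by linarith
    then have "(\<lambda>j. h j * ?w ^ j) sums ?g z" using that \<alpha> by (intro sums) auto
    then show "(\<lambda>n. absval (\<Sum>j<n. h j * ?w ^ j)) \<longlonglongrightarrow> absval (?g z)"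
      unfolding sums_def by (rule tendsto_absval)
    show "\<forall>n\<ge>0. absval (\<Sum>j<n. h j * ?w ^ j) \<le> 2 * B"
    proof (intro allI impI)
      fix n :: nat
      have "absval (\<Sum>j<n. h j * ?w ^ j) \<le> (\<Sum>j<n. absval (h j * ?w ^ j))"
        by (rule absval_sum_le)
      also have "\<dots> \<le> (\<Sum>j<n. B * (1 / 2) ^ j)"
      proof (rule sum_mono)
        fix j
        have "absval (h j * ?w ^ j) \<le> absval (h j) * (absval w * (1/2)) ^ j"
          using that by (auto simp: absval_mult absval_power intro!: mult_left_mono power_mono)
        also have "\<dots> = absval (h j * w ^ j) * (1 / 2) ^ j"
          by (simp only: absval_mult absval_power power_mult_distrib mult_ac)
        also have "\<dots> \<le> B * (1 / 2) ^ j" by (intro mult_right_mono B) auto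
        finally show "absval (h j * ?w ^ j) \<le> B * (1 / 2) ^ j" .
      qed
      also have "\<dots> = B * (\<Sum>j<n. (1 / 2) ^ j)" by (simp add: sum_distrib_left)
      also have "(\<Sum>j<n. (1 / 2 :: real) ^ j) \<le> 2"
        by (simp add: sum_gp_strict)
      then have "B * (\<Sum>j<n. (1 / 2) ^ j) \<le> B * 2"
        using \<open>B \<ge> 0\<close> by (rule mult_left_mono)
      finally show "absval (\<Sum>j<n. h j * ?w ^ j) \<le> 2 * B" by simp
    qed
  qed
  have w0: "((\<lambda>z. absval (1 - z / \<alpha>)) \<longlongrightarrow> 0) (at \<alpha>)"
    using tendsto_absval[OF tendsto_diff[OF tendsto_const tendsto_divide_valued[OF tendsto_ident_at tendsto_const \<alpha>]], of 1 \<alpha> UNIV] \<alpha>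
    by simp
  have "\<forall>\<^sub>F z in at \<alpha>. absval (1 - z / \<alpha>) < absval w / 2"
    using w by (intro order_tendstoD(2)[OF w0]) auto
  moreover have "\<forall>\<^sub>F z in at \<alpha>. z \<noteq> \<alpha>" by (simp add: eventually_at_filter)
  ultimately have "\<forall>\<^sub>F z in at \<alpha>. absval (?g z) \<le> 2 * B"
    by eventually_elim (rule bound)
  then have "bdd_near ?g \<alpha>" by (rule bdd_nearI)
  with c show ?thesis by (simp add: principal_part_def polar_expansion_def)
qed

text \<open>Resolves the definite description behind \<open>polar_coeff\<close> once and for all:
  uniqueness comes from principal parts, so coefficients found by a boundedness argument are the
  polar coefficients.\<close>

lemma polar_coeff_eqI:
  fixes q \<alpha> :: "'a::valued_field"
  assumes q: "q \<noteq> 0" "absval q < 1" and \<alpha>: "\<alpha> \<noteq> 0"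
    and ex: "\<exists>c. polar_expansion f \<alpha> c" and c: "principal_part f \<alpha> c"
  shows "polar_coeff f \<alpha> = c"
proof -
  from ex obtain d where d: "polar_expansion f \<alpha> d" ..
  have "d' = c" if "polar_expansion f \<alpha> d'" for d'
    using principal_part_unique[OF q \<alpha> polar_expansion_imp_principal_part[OF q \<alpha> that] c] .
  with d show ?thesis unfolding polar_coeff_def by (intro the_equality) auto
qed

section \<open>The zeta functions\<close>

lemma has_sum_Suc:
  fixes f :: "nat \<Rightarrow> 'a::topological_comm_monoid_add"
  assumes "((\<lambda>n. f (Suc n)) has_sum s) UNIV"
  shows "(f has_sum (f 0 + s)) UNIV"
proof -
  have "(f has_sum s) (range Suc)"
    using assms by (subst has_sum_reindex) (auto simp: o_def)
  then have "(f has_sum (f 0 + s)) (insert 0 (range Suc))"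
    by (rule has_sum_insert[rotated]) auto
  then show ?thesis by (simp add: UNIV_nat_eq[symmetric])
qed

text \<open>With j = k this is the general term of the k-th zeta series at x = q^m z. The exponent j
  is separate because the tails for k = 0 need x/(1 - x), that is j = 1, in order to
  converge.\<close>

definition psi :: "nat \<Rightarrow> nat \<Rightarrow> 'a::field \<Rightarrow> 'a" where
  "psi j k x = x ^ j / (1 - x) ^ (k + 1)"

text \<open>Maps the terms with negative index, where q^m z is large, to terms that are small
  multiples of 1/z. At x = 1 both sides are 0 by the convention for division by 0.\<close>

lemma psi_inverse: "x \<noteq> 0 \<Longrightarrow> psi k k (inverse x) = (-1) ^ (k + 1) * psi 1 k x"
proof (cases "x = 1")
  case False
  assume x: "x \<noteq> 0"
  have "1 - inverse x = - ((1 - x) / x)" using x by (simp add: field_simps)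
  then have "psi k k (inverse x) = inverse (x ^ k) * x ^ (k + 1) / (- (1 - x)) ^ (k + 1)"
    unfolding psi_def by (simp only: power_inverse power_divide minus_divide_left) (simp add: field_simps)
  also have "\<dots> = x / (- (1 - x)) ^ (k + 1)" using x by simp
  also have "\<dots> = (-1) ^ (k + 1) * (x / (1 - x) ^ (k + 1))"
    unfolding power_minus[of "1 - x"] by (cases "even k") simp_all
  finally show ?thesis by (simp add: psi_def)
qed (simp add: psi_def)

lemma tendsto_psi:
  fixes f :: "'b \<Rightarrow> 'a::valued_field"
  assumes "(f \<longlongrightarrow> x) F" "x \<noteq> 1"
  shows "((\<lambda>z. psi j k (f z)) \<longlongrightarrow> psi j k x) F"
  unfolding psi_def using assms
  by (intro tendsto_divide_valued tendsto_power_valued tendsto_diff tendsto_const) auto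

lemma absval_psi_le:
  fixes y :: "'a::valued_field"
  assumes "absval y \<le> 1 / 2" "1 \<le> j"
  shows "absval (psi j k y) \<le> 2 ^ (k + 1) * absval y"
proof -
  have "1 / 2 \<le> absval (1 - y)"
    using absval_reverse_triangle[of 1 y] assms(1) by simp
  then have "(1 / 2) ^ (k + 1) \<le> absval (1 - y) ^ (k + 1)"
    by (intro power_mono) auto
  moreover have "absval y ^ j \<le> absval y ^ 1"
    using assms by (intro power_decreasing) auto
  ultimately have "absval y ^ j / absval (1 - y) ^ (k + 1) \<le> absval y ^ 1 / (1 / 2) ^ (k + 1)"
    by (intro frac_le) auto
  also have "absval y ^ 1 / (1 / 2) ^ (k + 1) = 2 ^ (k + 1) * absval y"
    by (simp add: power_one_over)
  finally show ?thesis
    unfolding psi_def absval_divide absval_power .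
qed

section \<open>The two one-sided halves of the zeta series\<close>

locale multiplier =
  fixes q :: "'a::{valued_field,complete_space}"
  assumes q_nz [simp]: "q \<noteq> 0" and q_lt: "absval q < 1"
begin

lemma q_power_neq_1: "0 < n \<Longrightarrow> q ^ n \<noteq> 1"
proof
  assume "0 < n" "q ^ n = 1"
  moreover have "absval q ^ n < 1"
    using \<open>0 < n\<close> q_lt by (simp add: power_less_one_iff)
  ultimately show False by (simp flip: absval_power)
qed

lemma ex_small_power:
  assumes "0 < e" shows "\<exists>J. absval (q ^ J * x) < e"
proof -
  have "(\<lambda>n. absval q ^ n * absval x) \<longlonglongrightarrow> 0 * absval x"
    using q_lt by (intro tendsto_mult LIMSEQ_realpow_zero tendsto_const) auto
  then have "\<forall>\<^sub>F n in sequentially. absval q ^ n * absval x < e"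
    using assms by (intro order_tendstoD) auto
  then show ?thesis by (auto simp: eventually_sequentially absval_mult absval_power)
qed

text \<open>The part of a zeta series over positive powers of q. Both halves of the series have this
  form, one in z and one in 1/z.\<close>

definition W :: "nat \<Rightarrow> nat \<Rightarrow> 'a \<Rightarrow> 'a" where
  "W j k x = infsum (\<lambda>m. psi j k (q ^ Suc m * x)) UNIV"

lemma geometric_psi_le:
  assumes "1 \<le> j" "absval x \<le> 1 / 2"
  shows "absval (psi j k (q ^ m * x)) \<le> 2 ^ (k + 1) * absval x * absval q ^ m"
proof -
  have "absval (q ^ m * x) \<le> 1 * absval x"
    unfolding absval_mult absval_power using q_lt by (intro mult_right_mono power_le_one) auto
  then have "absval (psi j k (q ^ m * x)) \<le> 2 ^ (k + 1) * absval (q ^ m * x)"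
    using assms by (intro absval_psi_le) auto
  then show ?thesis by (simp add: absval_mult absval_power mult_ac)
qed

text \<open>The geometric bound applies only once |q^J x| is small; the skipped terms are then put
  back one at a time, by descending induction from J to 0.\<close>

lemma psi_summable_on:
  assumes "1 \<le> j"
  shows "(\<lambda>m. psi j k (q ^ m * x)) summable_on UNIV"
proof -
  obtain J where J: "absval (q ^ J * x) < 1 / 2"
    using ex_small_power[of "1/2" x] by auto
  have small: "(\<lambda>m. psi j k (q ^ m * (q ^ J * x))) summable_on UNIV"
  proof (rule absval_summable_on_comparison)
    show "(\<lambda>m. 2 ^ (k + 1) * absval (q ^ J * x) * absval q ^ m) summable_on UNIV"
      using has_sum_nat_geometric[of "absval q"] q_lt
      by (intro summable_on_cmult_right) (auto simp: summable_on_def)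
  qed (use geometric_psi_le[OF assms] J in auto)
  have "(\<lambda>m. psi j k (q ^ m * (q ^ i * x))) summable_on UNIV" if "i \<le> J" for i
    using that
  proof (induction rule: inc_induct)
    case (step i)
    then have "(\<lambda>m. psi j k (q ^ Suc m * (q ^ i * x))) summable_on UNIV"
      by (simp add: mult_ac)
    then show ?case
      using has_sum_Suc[of "\<lambda>m. psi j k (q ^ m * (q ^ i * x))"] unfolding summable_on_def by blast
  qed (rule small)
  from this[of 0] show ?thesis by simp
qed

lemma W_has_sum: "1 \<le> j \<Longrightarrow> ((\<lambda>m. psi j k (q ^ Suc m * x)) has_sum W j k x) UNIV"
  using psi_summable_on[of j k "q * x"] unfolding W_def by (simp add: mult_ac)

lemma W_rec:
  assumes "1 \<le> j"
  shows "W j k x = psi j k (q * x) + W j k (q * x)"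
proof -
  have "((\<lambda>m. psi j k (q ^ Suc m * x)) has_sum (psi j k (q ^ Suc 0 * x) + W j k (q * x))) UNIV"
    by (rule has_sum_Suc) (use W_has_sum[OF assms, of k "q * x"] in \<open>simp add: mult_ac\<close>)
  then show ?thesis using W_has_sum[OF assms, of k x] has_sum_unique by fastforce
qed

text \<open>Splits W into finitely many rational terms, which carry the poles of a given region, and
  a value near 0, where W is under control. Boundedness, complex meromorphy and rigid meromorphy of
  the zeta functions are all read off from this.\<close>

lemma W_rec_sum:
  assumes "1 \<le> j"
  shows "W j k x = (\<Sum>m<J. psi j k (q ^ Suc m * x)) + W j k (q ^ J * x)"
proof (induction J)
  case (Suc J)
  then show ?case using W_rec[OF assms, of k "q ^ J * x"] by (simp add: mult_ac)
qed simp

lemma absval_W_le: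
  assumes "1 \<le> j" "absval x \<le> 1 / 2"
  shows "absval (W j k x) \<le> 2 ^ k / (1 - absval q)"
proof -
  have "absval (W j k x) \<le> 2 ^ k * (1 / (1 - absval q))"
  proof (rule absval_has_sum_le[OF W_has_sum[OF assms(1)]])
    show "((\<lambda>m. 2 ^ k * absval q ^ m) has_sum 2 ^ k * (1 / (1 - absval q))) UNIV"
      using q_lt by (intro has_sum_cmult_right has_sum_nat_geometric) auto
    fix m
    have "absval (psi j k (q ^ Suc m * x)) \<le> 2 ^ (k + 1) * absval x * absval q ^ Suc m"
      by (rule geometric_psi_le[OF assms])
    also have "\<dots> \<le> 2 ^ (k + 1) * (1 / 2) * absval q ^ m"
      using q_lt assms(2) by (intro mult_mono[OF mult_left_mono power_decreasing]) auto
    finally show "absval (psi j k (q ^ Suc m * x)) \<le> 2 ^ k * absval q ^ m" by simp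
  qed
  then show ?thesis by simp
qed

text \<open>For z near x the point q^J z stays in the disc of radius 1/2, and the J split terms are
  continuous at x because none of them has its pole there.\<close>

lemma W_bdd_near:
  assumes j: "1 \<le> j" and x: "\<And>m. q ^ Suc m * x \<noteq> 1"
  shows "bdd_near (W j k) x"
proof -
  obtain J where J: "absval (q ^ J * x) < 1 / 2"
    using ex_small_power[of "1/2" x] by auto
  have "((\<lambda>z. q ^ J * z) \<longlongrightarrow> q ^ J * x) (at x)" by (intro tendsto_intros)
  from order_tendstoD(2)[OF tendsto_absval[OF this] J]
  have "\<forall>\<^sub>F z in at x. absval (W j k (q ^ J * z)) \<le> 2 ^ k / (1 - absval q)"
    by eventually_elim (auto intro!: absval_W_le j)
  then have "bdd_near (\<lambda>z. W j k (q ^ J * z)) x" by (rule bdd_nearI)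
  moreover have "bdd_near (\<lambda>z. psi j k (q ^ Suc m * z)) x" for m
    by (rule bdd_near_tendsto, rule tendsto_psi) (use x[of m] in \<open>auto intro!: tendsto_intros\<close>)
  ultimately have "bdd_near (\<lambda>z. (\<Sum>m<J. psi j k (q ^ Suc m * z)) + W j k (q ^ J * z)) x"
    by (intro bdd_near_add bdd_near_sum)
  then show ?thesis by (subst W_rec_sum[OF j, abs_def])
qed

lemma W_inverse_bdd_near:
  assumes j: "1 \<le> j" and x: "x \<noteq> 0" "\<And>m. q ^ Suc m \<noteq> x"
  shows "bdd_near (\<lambda>z. W j k (inverse z)) x"
proof -
  have "bdd_near (W j k) (inverse x)"
    using x by (intro W_bdd_near j) (simp add: divide_inverse[symmetric] del: power_Suc)
  then obtain C where C: "\<forall>\<^sub>F z in at (inverse x). absval (W j k z) \<le> C"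
    unfolding bdd_near_def by blast
  have "filterlim inverse (at (inverse x)) (at x)"
    using x by (auto simp: filterlim_at eventually_at_filter intro!: tendsto_inverse_valued)
  from eventually_compose_filterlim[OF C this] show ?thesis by (rule bdd_nearI)
qed

text \<open>The exponent \<open>max 1 k\<close> and the sign merge the two defining formulas: for k
  = 0 the tails have numerator exponent 1 and enter with opposite signs; for k \<ge> 1 the terms of
  negative index are inverted by \<open>psi_inverse\<close>.\<close>

lemma zeta_q_eq:
  assumes z: "z \<noteq> 0"
  shows "zeta_q q k z = psi k k z + W (max 1 k) k z + (-1) ^ (k + 1) * W 1 k (inverse z)"
proof (cases "k = 0")
  case True
  have "((\<lambda>m. psi 1 0 (q ^ Suc m * z)) has_sum W 1 0 z) UNIV"
    by (rule W_has_sum) simp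
  moreover have "((\<lambda>m. psi 1 0 (q ^ Suc m * inverse z)) has_sum W 1 0 (inverse z)) UNIV"
    by (rule W_has_sum) simp
  ultimately have "(\<lambda>m. psi 1 0 (q ^ Suc m * z) - psi 1 0 (q ^ Suc m * inverse z)) sums (W 1 0 z - W 1 0 (inverse z))"
    unfolding sums_def sum_subtractf by (intro tendsto_diff; simp add: has_sum_imp_sums flip: sums_def)
  from sums_unique[OF this] show ?thesis
    unfolding True by (simp add: zeta_q_def psi_def)
next
  case False
  then have k: "1 \<le> k" "max 1 k = k" by auto
  define f where "f m = q powi (int k * m) * z ^ k / (1 - q powi m * z) ^ (k + 1)" for m
  have f: "f m = psi k k (q powi m * z)" for m
    by (simp add: f_def psi_def power_mult_distrib power_int_mult mult.commute[of "int k"] power_int_of_nat)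
  have "((\<lambda>n::nat. f (int n)) has_sum (psi k k (q ^ 0 * z) + W k k z)) UNIV"
    unfolding f power_int_of_nat by (rule has_sum_Suc) (rule W_has_sum[OF k(1)])
  moreover have neg: "f (- int (Suc n)) = (-1) ^ (k + 1) * psi 1 k (q ^ Suc n * inverse z)" for n
    using psi_inverse[of "q ^ Suc n * inverse z" k] z unfolding f power_int_minus power_int_of_nat
    by (simp add: mult_ac)
  have "((\<lambda>n::nat. f (- int (Suc n))) has_sum ((-1) ^ (k + 1) * W 1 k (inverse z))) UNIV"
    unfolding neg by (intro has_sum_cmult_right W_has_sum) simp
  ultimately have "(f has_sum (psi k k z + W k k z + (-1) ^ (k + 1) * W 1 k (inverse z))) UNIV"
    using has_sum_int_split by fastforce
  then show ?thesis
    using False k by (simp add: zeta_q_def f_def[abs_def] infsumI)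
qed

text \<open>The shift moves one term of the half in z to the centre and the central term into the
  half in 1/z, so everything telescopes. Only for k = 0 does a 1 remain, from 1/(1 - q z) - q z/(1 -
  q z), because there centre and tails have different numerators; at q z = 1 this identity fails
  under total division.\<close>

lemma zeta_q_shift:
  assumes z: "z \<noteq> 0" "q * z \<noteq> 1"
  shows "zeta_q q k (q * z) = zeta_q q k z + (if k = 0 then 1 else 0)"
proof -
  have W1: "W 1 k (inverse (q * z)) = psi 1 k (inverse z) + W 1 k (inverse z)"
    using W_rec[of 1 k "inverse (q * z)"] z by (simp add: mult.assoc[symmetric])
  have W2: "W (max 1 k) k z = psi (max 1 k) k (q * z) + W (max 1 k) k (q * z)"
    by (rule W_rec) simp
  have p: "psi k k z = (-1) ^ (k + 1) * psi 1 k (inverse z)"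
    using psi_inverse[of "inverse z" k] z by simp
  have "psi k k (q * z) - psi (max 1 k) k (q * z) = (if k = 0 then 1 else 0)"
  proof (cases "k = 0")
    case True
    have "1 / (1 - q * z) - q * z / (1 - q * z) = 1"
      using z by (simp flip: diff_divide_distrib)
    then show ?thesis using True by (simp add: psi_def)
  qed (simp add: max_def)
  moreover have "q * z \<noteq> 0" using z by simp
  ultimately show ?thesis
    unfolding zeta_q_eq[OF z(1)] zeta_q_eq[OF \<open>q * z \<noteq> 0\<close>] W1 W2 p by (simp add: algebra_simps)
qed

lemma zeta_q_bdd_near:
  assumes "\<alpha> \<noteq> 0" "\<And>m::int. q powi m \<noteq> \<alpha>"
  shows "bdd_near (zeta_q q k) \<alpha>"
proof -
  have 1: "\<alpha> \<noteq> 1" using assms(2)[of 0] by simp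
  have 2: "q ^ Suc m \<noteq> \<alpha>" for m using assms(2)[of "int (Suc m)"] unfolding power_int_of_nat .
  have "q ^ Suc m * \<alpha> \<noteq> 1" for m
  proof
    assume "q ^ Suc m * \<alpha> = 1"
    then have "\<alpha> = inverse (q ^ Suc m)" by (metis inverse_unique)
    then show False using assms(2)[of "- int (Suc m)"] unfolding power_int_minus power_int_of_nat by simp
  qed
  then have "bdd_near (\<lambda>z. psi k k z + W (max 1 k) k z + (-1) ^ (k + 1) * W 1 k (inverse z)) \<alpha>"
    using 1 2 assms(1)
    by (intro bdd_near_add bdd_near_cmult W_bdd_near W_inverse_bdd_near bdd_near_tendsto[OF tendsto_psi[OF tendsto_ident_at]]) auto
  moreover have "\<forall>\<^sub>F z in at \<alpha>. z \<noteq> 0"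
    using eventually_at_not_in_finite[of "{0}" \<alpha>] by simp
  then have "\<forall>\<^sub>F z in at \<alpha>. zeta_q q k z = psi k k z + W (max 1 k) k z + (-1) ^ (k + 1) * W 1 k (inverse z)"
    by eventually_elim (rule zeta_q_eq)
  ultimately show ?thesis by (rule bdd_near_eventually_eq[rotated])
qed

lemma zeta_q_minus_psi_bdd_near: "bdd_near (\<lambda>z. zeta_q q k z - psi k k z) 1"
proof -
  have "bdd_near (\<lambda>z. W (max 1 k) k z + (-1) ^ (k + 1) * W 1 k (inverse z)) 1"
    using q_power_neq_1[of "Suc m" for m]
    by (intro bdd_near_add bdd_near_cmult W_bdd_near W_inverse_bdd_near) auto
  moreover have "\<forall>\<^sub>F z in at 1. z \<noteq> (0::'a)"
    using eventually_at_not_in_finite[of "{0::'a}" 1] by simp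
  then have "\<forall>\<^sub>F z in at 1. zeta_q q k z - psi k k z = W (max 1 k) k z + (-1) ^ (k + 1) * W 1 k (inverse z)"
    by eventually_elim (simp add: zeta_q_eq)
  ultimately show ?thesis by (rule bdd_near_eventually_eq[rotated])
qed

text \<open>The combination of zeta functions whose principal part at \<open>1\<close> is exactly \<open>1 / (1 - z) ^ k\<close>.\<close>

definition Z :: "nat \<Rightarrow> 'a \<Rightarrow> 'a" where
  "Z k z = (\<Sum>i = 1..k. of_nat ((k - 1) choose (i - 1)) * zeta_q q (i - 1) z)"

text \<open>Binomial theorem for the power k - 1 of z/(1 - z) + 1, whose value is 1/(1 - z).\<close>

lemma sum_choose_psi:
  assumes "1 \<le> k" "z \<noteq> (1::'a)"
  shows "(\<Sum>i = 1..k. of_nat ((k - 1) choose (i - 1)) * psi (i - 1) (i - 1) z) = 1 / (1 - z) ^ k"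
proof -
  have "(\<Sum>i = 1..k. of_nat ((k - 1) choose (i - 1)) * psi (i - 1) (i - 1) z) =
    (\<Sum>j\<le>k - 1. of_nat ((k - 1) choose j) * psi j j z)"
    using assms(1) by (intro sum.reindex_bij_witness[of _ Suc "\<lambda>i. i - 1"]) auto
  also have "\<dots> = (\<Sum>j\<le>k - 1. of_nat ((k - 1) choose j) * (z / (1 - z)) ^ j * 1 ^ (k - 1 - j)) / (1 - z)"
    by (simp add: psi_def sum_divide_distrib power_divide mult.commute[of "1 - z"])
  also have "\<dots> = (z / (1 - z) + 1) ^ (k - 1) / (1 - z)"
    by (simp only: binomial_ring)
  also have "z / (1 - z) + 1 = 1 / (1 - z)"
    using assms(2) by (simp add: field_simps)
  also have "(1 / (1 - z)) ^ (k - 1) / (1 - z) = 1 / (1 - z) ^ Suc (k - 1)"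
    by (simp add: power_one_over)
  finally show ?thesis using assms(1) by simp
qed

text \<open>Only the summand i = 1 contributes to the shift, with binomial coefficient 1. All
  \<open>Z k\<close> thus have the same quasi-period, which makes the total coefficient of an
  expansion the obstruction to ellipticity.\<close>

lemma Z_shift:
  assumes "1 \<le> k" "z \<noteq> 0" "q * z \<noteq> 1"
  shows "Z k (q * z) = Z k z + 1"
proof -
  have "Z k (q * z) = (\<Sum>i = 1..k. of_nat ((k - 1) choose (i - 1)) * zeta_q q (i - 1) z + (if i = 1 then 1 else 0))"
    unfolding Z_def using assms(2,3) by (intro sum.cong) (auto simp: zeta_q_shift distrib_left)
  then show ?thesis
    using assms(1) by (simp add: sum.distrib Z_def)
qed

lemma Z_bdd_near:
  assumes "\<alpha> \<noteq> 0" "\<And>m::int. q powi m \<noteq> \<alpha>"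
  shows "bdd_near (Z k) \<alpha>"
  unfolding Z_def[abs_def] by (intro bdd_near_sum bdd_near_cmult zeta_q_bdd_near assms)

lemma Z_minus_principal_bdd_near:
  assumes "1 \<le> k"
  shows "bdd_near (\<lambda>z. Z k z - 1 / (1 - z) ^ k) 1"
proof -
  have "bdd_near (\<lambda>z. \<Sum>i = 1..k. of_nat ((k - 1) choose (i - 1)) * (zeta_q q (i - 1) z - psi (i - 1) (i - 1) z)) 1"
    by (intro bdd_near_sum bdd_near_cmult zeta_q_minus_psi_bdd_near)
  moreover have "\<forall>\<^sub>F z in at 1. z \<noteq> (1::'a)"
    by (simp add: eventually_at_filter)
  then have "\<forall>\<^sub>F z in at 1. Z k z - 1 / (1 - z) ^ k =
      (\<Sum>i = 1..k. of_nat ((k - 1) choose (i - 1)) * (zeta_q q (i - 1) z - psi (i - 1) (i - 1) z))"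
    by eventually_elim (simp add: right_diff_distrib sum_subtractf sum_choose_psi[OF assms, symmetric] Z_def)
  ultimately show ?thesis by (rule bdd_near_eventually_eq[rotated])
qed

lemma Z_principal_part:
  assumes "1 \<le> k" "\<beta> \<noteq> 0"
  shows "principal_part (\<lambda>z. Z k (inverse \<beta> * z)) \<beta> (\<lambda>i. if i = k then 1 else 0)"
proof -
  have "principal_part (Z k) 1 (\<lambda>i. if i = k then 1 else 0)"
    using Z_minus_principal_bdd_near[OF assms(1)] assms(1)
    by (intro principal_partI[of _ "{k}"]) (auto split: if_splits)
  then show ?thesis
    using assms(2) by (intro principal_part_mult_arg) auto
qed

lemma Z_arg_bdd_near:
  assumes "\<alpha> \<noteq> 0" "\<beta> \<noteq> 0" "\<And>m::int. \<beta> * q powi m \<noteq> \<alpha>"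
  shows "bdd_near (\<lambda>z. Z k (inverse \<beta> * z)) \<alpha>"
proof -
  have "bdd_near (Z k) (inverse \<beta> * \<alpha>)"
    using assms by (intro Z_bdd_near) (auto simp: field_simps)
  then show ?thesis using assms(2) by (subst (asm) bdd_near_mult_iff) auto
qed

text \<open>Among nonzero points, total division can spoil the shift only at \<beta>/q, and
  \<open>mero_eq\<close> tolerates one point.\<close>

lemma Z_arg_shift:
  assumes "1 \<le> k" "\<beta> \<noteq> 0"
  shows "mero_eq (\<lambda>z. Z k (inverse \<beta> * (q * z))) (\<lambda>z. Z k (inverse \<beta> * z) + 1)"
  unfolding mero_eq_def
proof (intro allI impI)
  fix a b :: real assume a: "0 < a"
  show "finite {z. a \<le> absval z \<and> absval z \<le> b \<and> Z k (inverse \<beta> * (q * z)) \<noteq> Z k (inverse \<beta> * z) + 1}"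
  proof (rule finite_subset)
    show "{z. a \<le> absval z \<and> absval z \<le> b \<and> Z k (inverse \<beta> * (q * z)) \<noteq> Z k (inverse \<beta> * z) + 1} \<subseteq> {\<beta> / q}"
    proof safe
      fix z assume z: "a \<le> absval z" "Z k (inverse \<beta> * (q * z)) \<noteq> Z k (inverse \<beta> * z) + 1"
      then have "z \<noteq> 0" using a by auto
      with z(2) have "q * (inverse \<beta> * z) = 1"
        using Z_shift[OF assms(1), of "inverse \<beta> * z"] assms(2) by (auto simp: mult_ac)
      then show "z = \<beta> / q" using assms(2) by (simp add: field_simps)
    qed
  qed simp
qed

end

section \<open>Linearity of principal parts; integer exponents and integer-indexed sums\<close>

lemma principal_part_add:
  assumes "principal_part f \<alpha> c" "principal_part g \<alpha> d"
  shows "principal_part (\<lambda>z. f z + g z) \<alpha> (\<lambda>k. c k + d k)"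
  using principal_part_diff[OF assms(1) principal_part_diff[OF bdd_near_imp_principal_part_0[OF bdd_near_const] assms(2)], of 0]
  by simp

lemma principal_part_cmult:
  assumes "principal_part f \<alpha> c"
  shows "principal_part (\<lambda>z. a * f z) \<alpha> (\<lambda>k. a * c k)"
proof (rule principal_partI)
  show "finite {k. c k \<noteq> 0}" "a * c 0 = 0" using assms by (simp_all add: principal_part_def)
  show "bdd_near (\<lambda>z. a * f z - (\<Sum>k | c k \<noteq> 0. a * c k / (1 - z / \<alpha>) ^ k)) \<alpha>"
    using bdd_near_cmult[of "\<lambda>z. f z - (\<Sum>k | c k \<noteq> 0. c k / (1 - z / \<alpha>) ^ k)" \<alpha> a] assms
    by (simp add: principal_part_def right_diff_distrib sum_distrib_left)
qed auto

lemma principal_part_sum: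
  "(\<And>x. x \<in> A \<Longrightarrow> principal_part (F x) \<alpha> (c x)) \<Longrightarrow>
   principal_part (\<lambda>z. \<Sum>x\<in>A. F x z) \<alpha> (\<lambda>k. \<Sum>x\<in>A. c x k)"
  by (induction A rule: infinite_finite_induct)
     (auto intro: principal_part_add bdd_near_imp_principal_part_0)

text \<open>Provides the fundamental annulus of multiplication by q: after taking logarithms, m is
  the ceiling that places ln x + m ln r between ln r and 0.\<close>

lemma ex_powi_between:
  fixes r x :: real
  assumes "0 < r" "r < 1" "0 < x"
  shows "\<exists>m::int. r \<le> x * r powi m \<and> x * r powi m \<le> 1"
proof -
  define m where "m = \<lceil>ln x / (- ln r)\<rceil>"
  have neg: "ln r < 0" using assms by simp
  have "ln x / (- ln r) \<le> m" "m < ln x / (- ln r) + 1"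
    unfolding m_def by linarith+
  then have m: "ln x + m * ln r \<le> 0" "ln r \<le> ln x + m * ln r"
    using neg by (simp_all add: field_simps)
  have "r powi m = exp (m * ln r)"
    using assms by (simp add: powr_real_of_int'[symmetric] powr_def)
  then have "x * r powi m = exp (ln x + m * ln r)"
    using assms by (simp add: exp_add)
  moreover have "r = exp (ln r)" using assms by simp
  ultimately show ?thesis using m by (metis exp_le_cancel_iff exp_zero)
qed

lemma int_shift_invariant:
  fixes P :: "int \<Rightarrow> bool"
  assumes "P 0" "\<And>m. P m \<longleftrightarrow> P (m + 1)"
  shows "P m"
proof (induction m rule: int_induct[where k = 0])
  case (step2 i)
  then show ?case using assms(2)[of "i - 1"] by simp
qed (use assms in auto)

lemma telescoping_sum_int:
  fixes d :: "int \<Rightarrow> 'a::ab_group_add"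
  assumes "finite {n. d n \<noteq> 0}"
  shows "(\<Sum>n | d (n + 1) - d n \<noteq> 0. d (n + 1) - d n) = 0"
proof -
  let ?D = "{n. d n \<noteq> 0}"
  let ?T = "?D \<union> (\<lambda>n. n - 1) ` ?D"
  have fin: "finite ?T" using assms by simp
  have "(\<Sum>n | d (n + 1) - d n \<noteq> 0. d (n + 1) - d n) = (\<Sum>n\<in>?T. d (n + 1) - d n)"
  proof (rule sum.mono_neutral_left[OF fin])
    show "{n. d (n + 1) - d n \<noteq> 0} \<subseteq> ?T"
    proof
      fix n assume n: "n \<in> {n. d (n + 1) - d n \<noteq> 0}"
      show "n \<in> ?T"
      proof (cases "d n = 0")
        case True
        then have "n + 1 \<in> ?D" using n by simp
        then show ?thesis by force
      qed simp
    qed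
  qed auto
  also have "\<dots> = (\<Sum>n\<in>?T. d (n + 1)) - (\<Sum>n\<in>?T. d n)"
    by (rule sum_subtractf)
  also have "(\<Sum>n\<in>?T. d (n + 1)) = (\<Sum>n\<in>(\<lambda>n. n - 1) ` ?D. d (n + 1))"
    by (rule sum.mono_neutral_right[OF fin]) force+
  also have "\<dots> = (\<Sum>n\<in>?D. d n)"
    by (subst sum.reindex) (auto simp: inj_on_def)
  also have "(\<Sum>n\<in>?T. d n) = (\<Sum>n\<in>?D. d n)"
    by (rule sum.mono_neutral_right[OF fin]) auto
  finally show ?thesis by simp
qed

section \<open>Summability of elliptic functions\<close>

locale mero_setting = multiplier q
  for q :: "'a::{valued_field,complete_space}" +
  fixes M :: "('a \<Rightarrow> 'a) set"
  assumes polar_expansion_exists: "f \<in> M \<Longrightarrow> \<alpha> \<noteq> 0 \<Longrightarrow> \<exists>c. polar_expansion f \<alpha> c"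
    and finite_poles: "f \<in> M \<Longrightarrow> 0 < a \<Longrightarrow> finite {\<alpha>. a \<le> absval \<alpha> \<and> absval \<alpha> \<le> b \<and> \<not> bdd_near f \<alpha>}"
    and liouville: "f \<in> M \<Longrightarrow> (\<And>\<alpha>. \<alpha> \<noteq> 0 \<Longrightarrow> bdd_near f \<alpha>) \<Longrightarrow>
      mero_eq (\<lambda>z. f (q * z)) (\<lambda>z. f z + d) \<Longrightarrow> d = 0 \<and> (\<exists>c. mero_eq f (\<lambda>_. c))"
    and M_add: "f \<in> M \<Longrightarrow> g \<in> M \<Longrightarrow> (\<lambda>z. f z + g z) \<in> M"
    and M_cmult: "f \<in> M \<Longrightarrow> (\<lambda>z. c * f z) \<in> M"
    and M_zeta: "c \<noteq> 0 \<Longrightarrow> (\<lambda>z. zeta_q q k (c * z)) \<in> M"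
begin

lemma M_sum: "finite A \<Longrightarrow> (\<And>x. x \<in> A \<Longrightarrow> F x \<in> M) \<Longrightarrow> (\<lambda>z. \<Sum>x\<in>A. F x z) \<in> M"
proof (induction A rule: finite_induct)
  case empty
  then show ?case using M_cmult[OF M_zeta[of 1 0], of 0] by simp
qed (auto intro: M_add)

lemma M_Z: "c \<noteq> 0 \<Longrightarrow> (\<lambda>z. Z k (c * z)) \<in> M"
  unfolding Z_def by (intro M_sum M_cmult M_zeta) auto

lemma polar_coeff_eq:
  assumes "f \<in> M" "\<alpha> \<noteq> 0" "principal_part f \<alpha> c"
  shows "polar_coeff f \<alpha> = c"
  using polar_coeff_eqI[OF q_nz q_lt assms(2) polar_expansion_exists[OF assms(1,2)] assms(3)] .

lemma principal_part_polar_coeff: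
  assumes "f \<in> M" "\<alpha> \<noteq> 0"
  shows "principal_part f \<alpha> (polar_coeff f \<alpha>)"
proof -
  obtain c where "polar_expansion f \<alpha> c"
    using polar_expansion_exists[OF assms] by blast
  then have "principal_part f \<alpha> c"
    using polar_expansion_imp_principal_part[OF q_nz q_lt] assms by blast
  then show ?thesis using polar_coeff_eq[OF assms] by simp
qed

lemma mero_eq_const_imp_eq:
  assumes "mero_eq (\<lambda>_. c) (\<lambda>_. d :: 'a)" shows "c = d"
proof -
  have "\<forall>\<^sub>F z in at (1::'a). c = d"
    using mero_eq_eventually[OF assms, of 1] by simp
  then show ?thesis using at_nontrivial[OF q_nz q_lt, of 1] by (simp add: eventually_const_iff)
qed

lemma elliptic_in_M: "f \<in> elliptic_functions M q \<Longrightarrow> f \<in> M"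
  by (simp add: elliptic_functions_def)

lemma polar_coeff_q_mult:
  assumes f: "f \<in> elliptic_functions M q" and \<alpha>: "\<alpha> \<noteq> 0"
  shows "polar_coeff f (q * \<alpha>) = polar_coeff f \<alpha>"
proof -
  have "principal_part f (q * \<alpha>) (polar_coeff f (q * \<alpha>))"
    using f \<alpha> by (intro principal_part_polar_coeff elliptic_in_M) auto
  then have "principal_part (\<lambda>z. f (q * z)) \<alpha> (polar_coeff f (q * \<alpha>))"
    by (rule principal_part_mult_arg) simp
  moreover have "\<forall>\<^sub>F z in at \<alpha>. f (q * z) = f z"
    using f \<alpha> by (intro mero_eq_eventually) (auto simp: elliptic_functions_def)
  ultimately have "principal_part f \<alpha> (polar_coeff f (q * \<alpha>))"
    by (rule principal_part_cong[rotated])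
  then show ?thesis
    using polar_coeff_eq[OF elliptic_in_M[OF f] \<alpha>] by simp
qed

lemma polar_coeff_q_powi:
  assumes f: "f \<in> elliptic_functions M q" and \<alpha>: "\<alpha> \<noteq> 0"
  shows "polar_coeff f (\<alpha> * q powi m) = polar_coeff f \<alpha>"
proof (induction m rule: int_shift_invariant)
  case (2 m)
  then show ?case
    using polar_coeff_q_mult[OF f, of "\<alpha> * q powi m"] \<alpha> by (simp add: power_int_add mult_ac)
qed simp

lemma class_polar_coeff_eq:
  assumes f: "f \<in> elliptic_functions M q" and \<alpha>: "\<alpha> \<noteq> 0"
  shows "class_polar_coeff f (q_class q \<alpha>) k = polar_coeff f \<alpha> k"
  unfolding class_polar_coeff_def
proof (rule the_equality)
  show "\<forall>\<beta>\<in>q_class q \<alpha>. polar_coeff f \<beta> k = polar_coeff f \<alpha> k"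
    by (auto simp: q_class_def polar_coeff_q_powi[OF f \<alpha>])
  have "\<alpha> * q powi 0 \<in> q_class q \<alpha>" unfolding q_class_def by (rule rangeI)
  then show "c = polar_coeff f \<alpha> k" if "\<forall>\<beta>\<in>q_class q \<alpha>. polar_coeff f \<beta> k = c" for c
    using that by auto
qed

end

section \<open>Points of the Tate curve indexed by orbit and exponent\<close>

locale pinned_mero_setting = mero_setting +
  fixes s :: 'a and \<alpha> :: "'a set set \<Rightarrow> 'a"
  assumes s_nz [simp]: "s \<noteq> 0" and indep: "mult_independent s q" and pinning: "tau_pinning q s \<alpha>"
begin

definition rep :: "'a set set \<Rightarrow> int \<Rightarrow> 'a" where
  "rep \<omega> n = s powi n * \<alpha> \<omega>"

lemma rep_nz [simp]: "\<omega> \<in> tau_orbits q s \<Longrightarrow> rep \<omega> n \<noteq> 0"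
  using pinning by (auto simp: rep_def tau_pinning_def)

lemma s_rep: "s * rep \<omega> n = rep \<omega> (n + 1)"
  by (simp add: rep_def power_int_add mult_ac)

lemma q_class_mult_powi: "q_class q (t * q powi m) = q_class q t"
  unfolding q_class_def
proof (intro set_eqI iffI)
  fix x assume "x \<in> range (\<lambda>n. t * q powi n)"
  then obtain n where "x = t * q powi n" by auto
  then have "x = t * q powi m * q powi (n - m)" by (simp add: power_int_diff)
  then show "x \<in> range (\<lambda>n. t * q powi m * q powi n)" by blast
next
  fix x assume "x \<in> range (\<lambda>n. t * q powi m * q powi n)"
  then obtain n where "x = t * q powi m * q powi n" by auto
  then have "x = t * q powi (m + n)" by (simp add: power_int_add)
  then show "x \<in> range (\<lambda>n. t * q powi n)" by blast
qed

lemma q_class_eqD: "q_class q t = q_class q u \<Longrightarrow> \<exists>m. t = u * q powi m"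
proof -
  assume "q_class q t = q_class q u"
  moreover have "t * q powi 0 \<in> q_class q t" unfolding q_class_def by (rule rangeI)
  ultimately show ?thesis by (auto simp: q_class_def)
qed

lemma tau_orbit_shift: "tau_orbit q s (s powi j * t * q powi m) = tau_orbit q s t"
proof -
  have *: "q_class q (s powi n * (s powi j * t * q powi m)) = q_class q (s powi (n + j) * t)" for n
    using q_class_mult_powi[of "s powi (n + j) * t" m] by (simp add: power_int_add mult_ac)
  show ?thesis
    unfolding tau_orbit_def *
  proof (intro set_eqI iffI)
    fix x assume "x \<in> range (\<lambda>n. q_class q (s powi n * t))"
    then obtain n where "x = q_class q (s powi n * t)" by auto
    then have "x = q_class q (s powi ((n - j) + j) * t)" by simp
    then show "x \<in> range (\<lambda>n. q_class q (s powi (n + j) * t))" by blast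
  qed blast
qed

lemma tau_orbit_pinning:
  assumes "\<omega> \<in> tau_orbits q s" shows "tau_orbit q s (\<alpha> \<omega>) = \<omega>"
proof -
  from assms obtain t where t: "t \<noteq> 0" "\<omega> = tau_orbit q s t"
    by (auto simp: tau_orbits_def)
  have "q_class q (\<alpha> \<omega>) \<in> \<omega>" using assms pinning by (simp add: tau_pinning_def)
  then obtain j where "q_class q (\<alpha> \<omega>) = q_class q (s powi j * t)"
    unfolding t(2) by (auto simp: tau_orbit_def)
  then obtain m where "\<alpha> \<omega> = s powi j * t * q powi m"
    using q_class_eqD by blast
  then show ?thesis using t(2) tau_orbit_shift by simp
qed

lemma orbit_eq: "\<omega> \<in> tau_orbits q s \<Longrightarrow> \<omega> = range (\<lambda>n. q_class q (rep \<omega> n))"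
  using tau_orbit_pinning by (simp add: tau_orbit_def rep_def)

lemma rep_cover:
  assumes "\<beta> \<noteq> 0"
  obtains \<omega> n m where "\<omega> \<in> tau_orbits q s" "\<beta> = rep \<omega> n * q powi m"
proof -
  let ?\<omega> = "tau_orbit q s \<beta>"
  have \<omega>: "?\<omega> \<in> tau_orbits q s" using assms by (auto simp: tau_orbits_def)
  have "q_class q (s powi 0 * \<beta>) \<in> ?\<omega>" unfolding tau_orbit_def by (rule rangeI)
  then obtain n where "q_class q \<beta> = q_class q (rep ?\<omega> n)"
    using orbit_eq[OF \<omega>] by auto
  with that[OF \<omega>] q_class_eqD show ?thesis by blast
qed

text \<open>Here multiplicative independence enters: once the orbits agree, the equation reduces to
  s^(n-n') q^m = 1. With \<open>rep_cover\<close>, every class of the Tate curve is that of exactly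
  one \<open>rep \<omega> n\<close>.\<close>

lemma rep_inj:
  assumes "\<omega> \<in> tau_orbits q s" "\<omega>' \<in> tau_orbits q s" "rep \<omega> n * q powi m = rep \<omega>' n'"
  shows "\<omega> = \<omega>' \<and> n = n'"
proof -
  have "s powi n' * \<alpha> \<omega>' = s powi n * \<alpha> \<omega> * q powi m"
    using assms(3) by (simp add: rep_def)
  then have *: "\<alpha> \<omega>' = s powi (n - n') * \<alpha> \<omega> * q powi m"
    by (simp add: power_int_diff field_simps)
  then have "tau_orbit q s (\<alpha> \<omega>') = tau_orbit q s (\<alpha> \<omega>)"
    by (simp add: tau_orbit_shift)
  then have \<omega>: "\<omega>' = \<omega>"
    using assms(1,2) by (simp add: tau_orbit_pinning)
  moreover have "\<alpha> \<omega> \<noteq> 0" using assms(1) pinning by (simp add: tau_pinning_def)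
  ultimately have "s powi (n - n') * q powi m = 1"
    using * by simp
  then show ?thesis using indep \<omega> unfolding mult_independent_def by fastforce
qed

section \<open>Finite combinations of zeta functions with prescribed coefficients\<close>

definition E :: "('a set set \<times> int \<times> nat \<Rightarrow> 'a) \<Rightarrow> ('a set set \<times> int \<times> nat) set \<Rightarrow> 'a \<Rightarrow> 'a" where
  "E c S z = (\<Sum>(\<omega>, n, k)\<in>S. c (\<omega>, n, k) * Z k (inverse (rep \<omega> n) * z))"

lemma E_eq: "E c S = (\<lambda>z. \<Sum>x\<in>S. c x * Z (snd (snd x)) (inverse (rep (fst x) (fst (snd x))) * z))"
  by (simp add: E_def case_prod_unfold fun_eq_iff)

definition V :: "('a set set \<times> int \<times> nat) set" where
  "V = {(\<omega>, n, k). \<omega> \<in> tau_orbits q s \<and> 1 \<le> k}"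

definition coeffs :: "('a \<Rightarrow> 'a) \<Rightarrow> 'a set set \<times> int \<times> nat \<Rightarrow> 'a" where
  "coeffs f = (\<lambda>(\<omega>, n, k). polar_coeff f (rep \<omega> n) k)"

lemma polar_support_eq: "polar_support q s \<alpha> f = {x \<in> V. coeffs f x \<noteq> 0}"
  by (auto simp: polar_support_def V_def coeffs_def rep_def)

lemma zeta_expansion_eq: "zeta_expansion q s \<alpha> f = E (coeffs f) (polar_support q s \<alpha> f)"
  by (simp add: zeta_expansion_def E_def coeffs_def rep_def Z_def fun_eq_iff power_int_minus)

lemma E_in_M:
  assumes "finite S" "S \<subseteq> V" shows "E c S \<in> M"
  unfolding E_def case_prod_unfold using assms
  by (intro M_sum M_cmult M_Z) (auto simp: V_def)

text \<open>Every summand has quasi-period 1 before scaling, so the combination is elliptic once its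
  coefficients sum to 0.\<close>

lemma E_shift:
  assumes "finite S" "S \<subseteq> V"
  shows "mero_eq (\<lambda>z. E c S (q * z)) (\<lambda>z. E c S z + (\<Sum>x\<in>S. c x))"
proof -
  let ?t = "\<lambda>x z. c x * Z (snd (snd x)) (inverse (rep (fst x) (fst (snd x))) * z)"
  have "mero_eq (\<lambda>z. \<Sum>x\<in>S. ?t x (q * z)) (\<lambda>z. \<Sum>x\<in>S. ?t x z + c x)"
  proof (rule mero_eq_sum)
    fix x assume "x \<in> S"
    then have "mero_eq (\<lambda>z. Z (snd (snd x)) (inverse (rep (fst x) (fst (snd x))) * (q * z)))
        (\<lambda>z. Z (snd (snd x)) (inverse (rep (fst x) (fst (snd x))) * z) + 1)"
      using assms(2) by (intro Z_arg_shift) (auto simp: V_def)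
    from mero_eq_comp2[OF this mero_eq_refl[of "\<lambda>_. c x"], of "\<lambda>a b. b * a"]
    show "mero_eq (\<lambda>z. ?t x (q * z)) (\<lambda>z. ?t x z + c x)"
      by (simp add: distrib_left)
  qed
  then show ?thesis by (simp add: E_eq sum.distrib)
qed

text \<open>The summands at other positions are bounded near \<open>rep \<omega> n\<close>, because
  their poles form other q-classes by \<open>rep_inj\<close>. Coefficients can therefore be read off
  position by position.\<close>

lemma E_principal_part:
  assumes "finite S" "S \<subseteq> V" "\<omega> \<in> tau_orbits q s"
  shows "principal_part (E c S) (rep \<omega> n) (\<lambda>k. if (\<omega>, n, k) \<in> S then c (\<omega>, n, k) else 0)"
proof -
  let ?t = "\<lambda>x z. c x * Z (snd (snd x)) (inverse (rep (fst x) (fst (snd x))) * z)"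
  have "principal_part (\<lambda>z. \<Sum>x\<in>S. ?t x z) (rep \<omega> n) (\<lambda>k. \<Sum>x\<in>S. c x * (if x = (\<omega>, n, k) then 1 else 0))"
  proof (intro principal_part_sum principal_part_cmult)
    fix x assume "x \<in> S"
    obtain \<omega>' n' k' where x: "x = (\<omega>', n', k')" by (cases x) auto
    have \<omega>': "\<omega>' \<in> tau_orbits q s" "1 \<le> k'"
      using \<open>x \<in> S\<close> assms(2) by (auto simp: V_def x)
    show "principal_part (\<lambda>z. Z (snd (snd x)) (inverse (rep (fst x) (fst (snd x))) * z)) (rep \<omega> n)
      (\<lambda>k. if x = (\<omega>, n, k) then 1 else 0)"
    proof (cases "\<omega>' = \<omega> \<and> n' = n")
      case True
      then have "(\<lambda>k. if x = (\<omega>, n, k) then 1 else 0) = (\<lambda>k. if k = k' then 1 else (0::'a))"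
        by (auto simp: x)
      then show ?thesis
        using Z_principal_part[of k' "rep \<omega> n"] assms(3) \<omega>'(2) True by (simp add: x)
    next
      case False
      then have "rep \<omega>' n' * q powi m \<noteq> rep \<omega> n" for m
        using rep_inj[OF \<omega>'(1) assms(3)] by blast
      then have "bdd_near (\<lambda>z. Z k' (inverse (rep \<omega>' n') * z)) (rep \<omega> n)"
        using assms(3) \<omega>' by (intro Z_arg_bdd_near) auto
      then have "principal_part (\<lambda>z. Z k' (inverse (rep \<omega>' n') * z)) (rep \<omega> n) (\<lambda>_. 0)"
        by (rule bdd_near_imp_principal_part_0)
      moreover have "(\<lambda>k. if x = (\<omega>, n, k) then 1 else 0) = (\<lambda>_. 0::'a)"
        using False by (auto simp: x)
      ultimately show ?thesis by (simp add: x)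
    qed
  qed
  moreover have eq: "(\<Sum>x\<in>S. c x * (if x = (\<omega>, n, k) then 1 else 0)) = (if (\<omega>, n, k) \<in> S then c (\<omega>, n, k) else 0)" for k
    using assms(1) by (simp add: if_distrib[of "(*) _"] cong: if_cong)
  ultimately show ?thesis unfolding E_eq eq by blast
qed

text \<open>Coefficients are constant along q-classes, so each singular position has a
  representative in the fundamental annulus, which contains finitely many poles. Distinct positions
  give distinct representatives by \<open>rep_inj\<close>, and each pole has finite order.\<close>

lemma finite_polar_support:
  assumes f: "f \<in> elliptic_functions M q"
  shows "finite (polar_support q s \<alpha> f)"
proof -
  define P where "P = {\<beta>. absval q \<le> absval \<beta> \<and> absval \<beta> \<le> 1 \<and> \<not> bdd_near f \<beta>}"
  have P: "finite P"
    unfolding P_def by (rule finite_poles[OF elliptic_in_M[OF f]]) simp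
  define A where "A = {(\<omega>, n). \<omega> \<in> tau_orbits q s \<and> (\<exists>k. polar_coeff f (rep \<omega> n) k \<noteq> 0)}"
  have "\<exists>m. rep \<omega> n * q powi m \<in> P" if "(\<omega>, n) \<in> A" for \<omega> n
  proof -
    from that have \<omega>: "\<omega> \<in> tau_orbits q s" by (simp add: A_def)
    obtain m where m: "absval q \<le> absval (rep \<omega> n * q powi m)" "absval (rep \<omega> n * q powi m) \<le> 1"
      using ex_powi_between[of "absval q" "absval (rep \<omega> n)"] q_lt \<omega>
      by (auto simp: absval_mult absval_powi)
    have "\<not> bdd_near f (rep \<omega> n * q powi m)"
    proof
      assume "bdd_near f (rep \<omega> n * q powi m)"
      then have "polar_coeff f (rep \<omega> n * q powi m) = (\<lambda>_. 0)"
        using \<omega> by (intro polar_coeff_eq elliptic_in_M[OF f] bdd_near_imp_principal_part_0) auto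
      then show False
        using that polar_coeff_q_powi[OF f, of "rep \<omega> n" m] \<omega> by (simp add: A_def)
    qed
    then show ?thesis using m by (auto simp: P_def)
  qed
  then obtain \<mu> where \<mu>: "\<And>\<omega> n. (\<omega>, n) \<in> A \<Longrightarrow> rep \<omega> n * q powi \<mu> \<omega> n \<in> P" by metis
  have "inj_on (\<lambda>(\<omega>, n). rep \<omega> n * q powi \<mu> \<omega> n) A"
  proof (rule inj_onI, clarify)
    fix \<omega> n \<omega>' n'
    assume A: "(\<omega>, n) \<in> A" "(\<omega>', n') \<in> A" "rep \<omega> n * q powi \<mu> \<omega> n = rep \<omega>' n' * q powi \<mu> \<omega>' n'"
    then have "rep \<omega> n * q powi (\<mu> \<omega> n - \<mu> \<omega>' n') = rep \<omega>' n'"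
      by (simp add: power_int_diff)
    then show "\<omega> = \<omega>' \<and> n = n'"
      using A(1,2) rep_inj[of \<omega> \<omega>' n _ n'] unfolding A_def by blast
  qed
  moreover have "(\<lambda>(\<omega>, n). rep \<omega> n * q powi \<mu> \<omega> n) ` A \<subseteq> P" using \<mu> by auto
  ultimately have "finite A" using P by (meson finite_imageD finite_subset)
  moreover have "finite {k. polar_coeff f (rep \<omega> n) k \<noteq> 0}" if "(\<omega>, n) \<in> A" for \<omega> n
    using principal_part_polar_coeff[OF elliptic_in_M[OF f], of "rep \<omega> n"] that
    by (simp add: principal_part_def A_def)
  ultimately have "finite (SIGMA (\<omega>, n) : A. {k. polar_coeff f (rep \<omega> n) k \<noteq> 0})"
    by (intro finite_SigmaI) auto
  then have "finite ((\<lambda>((\<omega>, n), k). (\<omega>, n, k)) ` (SIGMA (\<omega>, n) : A. {k. polar_coeff f (rep \<omega> n) k \<noteq> 0}))"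
    by (rule finite_imageI)
  then show ?thesis
    by (rule rev_finite_subset) (force simp: polar_support_eq coeffs_def A_def V_def)
qed

lemma zeta_expansion_correct:
  assumes f: "f \<in> elliptic_functions M q"
  shows "(\<Sum>x\<in>polar_support q s \<alpha> f. coeffs f x) = 0"
    and "\<exists>c. mero_eq f (\<lambda>z. c + zeta_expansion q s \<alpha> f z)"
proof -
  let ?S = "polar_support q s \<alpha> f"
  define g where "g z = f z - E (coeffs f) ?S z" for z
  have S: "finite ?S" "?S \<subseteq> V"
    using finite_polar_support[OF f] by (auto simp: polar_support_eq)
  have "(\<lambda>z. f z + (-1) * E (coeffs f) ?S z) \<in> M"
    by (intro M_add M_cmult E_in_M S elliptic_in_M f)
  then have gM: "g \<in> M" by (simp add: g_def[abs_def])
  \<comment> \<open>At this stage g is only known to be quasi-invariant: its quasi-period is minus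
    the sum whose vanishing is to be shown.\<close>
  have shift: "mero_eq (\<lambda>z. g (q * z)) (\<lambda>z. g z + - (\<Sum>x\<in>?S. coeffs f x))"
    using mero_eq_diff[OF _ E_shift[OF S], of "\<lambda>z. f (q * z)" f "coeffs f"] f
    by (simp add: g_def elliptic_functions_def algebra_simps)
  have bdd_rep: "bdd_near g (rep \<omega> n)" if \<omega>: "\<omega> \<in> tau_orbits q s" for \<omega> n
  proof -
    have pf: "principal_part f (rep \<omega> n) (polar_coeff f (rep \<omega> n))"
      using \<omega> f by (intro principal_part_polar_coeff elliptic_in_M) auto
    then have "polar_coeff f (rep \<omega> n) k = (if (\<omega>, n, k) \<in> ?S then coeffs f (\<omega>, n, k) else 0)" for k
      using \<omega> by (cases k) (auto simp: polar_support_eq V_def coeffs_def principal_part_def)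
    then have "principal_part (E (coeffs f) ?S) (rep \<omega> n) (polar_coeff f (rep \<omega> n))"
      using E_principal_part[OF S \<omega>, of "coeffs f" n] by presburger
    from principal_part_diff[OF pf this] show ?thesis
      unfolding g_def by (intro principal_part_0_imp_bdd_near) simp
  qed
  \<comment> \<open>Principal parts were matched at the points \<open>rep \<omega> n\<close> only;
    quasi-invariance carries boundedness to the rest of each q-class.\<close>
  have bdd_shift: "bdd_near g (q * \<beta>) \<longleftrightarrow> bdd_near g \<beta>" if "\<beta> \<noteq> 0" for \<beta>
  proof -
    have "bdd_near g (q * \<beta>) \<longleftrightarrow> bdd_near (\<lambda>z. g z + - (\<Sum>x\<in>?S. coeffs f x)) \<beta>"
      by (simp only: bdd_near_mult_iff[OF q_nz] bdd_near_cong[OF mero_eq_eventually[OF shift that]])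
    also have "\<dots> \<longleftrightarrow> bdd_near g \<beta>"
      using bdd_near_add[of "\<lambda>z. g z + - (\<Sum>x\<in>?S. coeffs f x)" \<beta> "\<lambda>_. (\<Sum>x\<in>?S. coeffs f x)"]
        bdd_near_add[of g \<beta> "\<lambda>_. - (\<Sum>x\<in>?S. coeffs f x)"] by auto
    finally show ?thesis .
  qed
  have "bdd_near g \<beta>" if nz: "\<beta> \<noteq> 0" for \<beta>
  proof -
    obtain \<omega> n m where \<omega>: "\<omega> \<in> tau_orbits q s" "\<beta> = rep \<omega> n * q powi m"
      using rep_cover[OF nz] .
    have "bdd_near g (rep \<omega> n * q powi m)" for m
    proof (induction m rule: int_shift_invariant)
      case (2 m)
      then show ?case
        using bdd_shift[of "rep \<omega> n * q powi m"] \<omega>(1) by (simp add: power_int_add mult_ac)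
    qed (use bdd_rep[OF \<omega>(1)] in simp)
    then show ?thesis by (simp add: \<omega>)
  qed
  from liouville[OF gM this shift] obtain c
    where c: "(\<Sum>x\<in>?S. coeffs f x) = 0" "mero_eq g (\<lambda>_. c)" by auto
  from c(1) show "(\<Sum>x\<in>?S. coeffs f x) = 0" .
  have "mero_eq (\<lambda>z. g z + E (coeffs f) ?S z) (\<lambda>z. c + E (coeffs f) ?S z)"
    by (intro mero_eq_add c mero_eq_refl)
  then show "\<exists>c. mero_eq f (\<lambda>z. c + zeta_expansion q s \<alpha> f z)"
    by (auto simp: g_def zeta_expansion_eq)
qed

lemma panores_0_eqI:
  assumes "mero_eq f (\<lambda>z. c + zeta_expansion q s \<alpha> f z)"
  shows "panores_0 q s \<alpha> f = c"
  unfolding panores_0_def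
proof (rule the_equality)
  show "mero_eq f (\<lambda>z. c + zeta_expansion q s \<alpha> f z)" by (rule assms)
next
  fix d assume "mero_eq f (\<lambda>z. d + zeta_expansion q s \<alpha> f z)"
  then have "mero_eq (\<lambda>z. d + zeta_expansion q s \<alpha> f z) (\<lambda>z. c + zeta_expansion q s \<alpha> f z)"
    using assms mero_eq_sym mero_eq_trans by blast
  from mero_eq_diff[OF this mero_eq_refl[of "zeta_expansion q s \<alpha> f"]]
  show "d = c" by (intro mero_eq_const_imp_eq) simp
qed

text \<open>Distinct n give distinct classes, so the classes of an orbit can be indexed by integers.
  This turns orbital residues into sums along a sequence.\<close>

lemma ores_eq:
  assumes f: "f \<in> elliptic_functions M q" and \<omega>: "\<omega> \<in> tau_orbits q s"
  shows "ores f \<omega> k = (\<Sum>n | coeffs f (\<omega>, n, k) \<noteq> 0. coeffs f (\<omega>, n, k))"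
proof -
  have c: "class_polar_coeff f (q_class q (rep \<omega> n)) k = coeffs f (\<omega>, n, k)" for n
    using class_polar_coeff_eq[OF f, of "rep \<omega> n"] \<omega> by (simp add: coeffs_def)
  have inj: "inj (\<lambda>n. q_class q (rep \<omega> n))"
  proof (rule injI)
    fix n n' assume "q_class q (rep \<omega> n) = q_class q (rep \<omega> n')"
    then obtain m where "rep \<omega> n' * q powi m = rep \<omega> n"
      using q_class_eqD by metis
    then show "n = n'" using rep_inj[OF \<omega> \<omega>] by blast
  qed
  have "{e \<in> \<omega>. class_polar_coeff f e k \<noteq> 0} = (\<lambda>n. q_class q (rep \<omega> n)) ` {n. coeffs f (\<omega>, n, k) \<noteq> 0}"
    by (subst orbit_eq[OF \<omega>]) (auto simp: c)
  then show ?thesis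
    unfolding ores_def by (simp add: sum.reindex[OF inj_on_subset[OF inj]] c)
qed

section \<open>The coefficient equation and summation by parts\<close>

definition up :: "'a set set \<times> int \<times> nat \<Rightarrow> 'a set set \<times> int \<times> nat" where
  "up = (\<lambda>(\<omega>, n, k). (\<omega>, n + 1, k))"

definition down :: "'a set set \<times> int \<times> nat \<Rightarrow> 'a set set \<times> int \<times> nat" where
  "down = (\<lambda>(\<omega>, n, k). (\<omega>, n - 1, k))"

lemma up_down [simp]: "up (down x) = x" "down (up x) = x"
  by (auto simp: up_def down_def split: prod.split)

lemma up_V [simp]: "up x \<in> V \<longleftrightarrow> x \<in> V"
  by (auto simp: up_def V_def split: prod.split)

text \<open>Abel summation with a free weight w: zeta functions as weights give the difference of
  the expansion at s z and at z, and the weight n gives the first panorbital residue. All sums are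
  compared on D together with its image under \<open>down\<close>.\<close>

lemma sum_by_parts:
  assumes D: "finite D" "D \<subseteq> V" "\<And>x. x \<in> V \<Longrightarrow> x \<notin> D \<Longrightarrow> d x = 0"
    and c: "\<And>x. x \<in> V \<Longrightarrow> c x = d (up x) - d x"
  shows "(\<Sum>x | x \<in> V \<and> c x \<noteq> 0. c x * w x) = (\<Sum>x\<in>D. d x * w (down x)) - (\<Sum>x\<in>D. d x * (w x :: 'a))"
proof -
  let ?T = "D \<union> down ` D"
  have T: "finite ?T" "?T \<subseteq> V"
    using D up_V by (auto simp flip: up_V[of "down _"])
  have "(\<Sum>x | x \<in> V \<and> c x \<noteq> 0. c x * w x) = (\<Sum>x\<in>?T. c x * w x)"
  proof (rule sum.mono_neutral_left[OF T(1)])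
    show "{x. x \<in> V \<and> c x \<noteq> 0} \<subseteq> ?T"
    proof
      fix x assume x: "x \<in> {x. x \<in> V \<and> c x \<noteq> 0}"
      show "x \<in> ?T"
      proof (cases "d x = 0")
        case True
        then have "up x \<in> D" using x c[of x] D(3)[of "up x"] by (cases "up x \<in> D") auto
        then show ?thesis by (metis UnI2 imageI up_down(2))
      qed (use x D(3)[of x] in auto)
    qed
  qed (use T(2) in auto)
  also have "\<dots> = (\<Sum>x\<in>?T. d (up x) * w x) - (\<Sum>x\<in>?T. d x * w x)"
    unfolding sum_subtractf[symmetric]
  proof (rule sum.cong[OF refl])
    fix x assume "x \<in> ?T"
    then have "x \<in> V" using T(2) by blast
    then show "c x * w x = d (up x) * w x - d x * w x" by (simp add: c left_diff_distrib)
  qed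
  also have "(\<Sum>x\<in>?T. d x * w x) = (\<Sum>x\<in>D. d x * w x)"
  proof (rule sum.mono_neutral_right[OF T(1)])
    show "\<forall>x\<in>?T - D. d x * w x = 0"
    proof
      fix x assume "x \<in> ?T - D"
      then have "x \<in> V" "x \<notin> D" using T(2) by blast+
      then show "d x * w x = 0" by (simp add: D(3))
    qed
  qed auto
  also have "(\<Sum>x\<in>?T. d (up x) * w x) = (\<Sum>x\<in>down ` D. d (up x) * w x)"
  proof (rule sum.mono_neutral_right[OF T(1)])
    show "\<forall>x\<in>?T - down ` D. d (up x) * w x = 0"
    proof
      fix x assume x: "x \<in> ?T - down ` D"
      then have "up x \<notin> D" by (metis DiffD2 imageI up_down(2))
      then show "d (up x) * w x = 0" using x T(2) D(3)[of "up x"] by auto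
    qed
  qed auto
  also have "\<dots> = (\<Sum>x\<in>D. d x * w (down x))"
    by (subst sum.reindex) (auto simp: inj_on_def intro: up_down(1) dest: arg_cong[of _ _ up])
  finally show ?thesis .
qed

lemma E_difference:
  assumes "finite D" "D \<subseteq> V" "\<And>x. x \<in> V \<Longrightarrow> x \<notin> D \<Longrightarrow> d x = 0"
    and "\<And>x. x \<in> V \<Longrightarrow> c x = d (up x) - d x"
  shows "E c {x. x \<in> V \<and> c x \<noteq> 0} z = E d D (s * z) - E d D z"
proof -
  let ?w = "\<lambda>z x. Z (snd (snd x)) (inverse (rep (fst x) (fst (snd x))) * z)"
  \<comment> \<open>Lowering the exponent of s in the position amounts to replacing z by s z: this
    is where \<tau> becomes an index shift.\<close>
  have "?w z (down x) = ?w (s * z) x" for x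
    by (auto simp: down_def rep_def power_int_diff field_simps split: prod.split)
  moreover have "(\<Sum>x | x \<in> V \<and> c x \<noteq> 0. c x * ?w z x) = (\<Sum>x\<in>D. d x * ?w z (down x)) - (\<Sum>x\<in>D. d x * ?w z x)"
    by (rule sum_by_parts) (use assms in auto)
  ultimately show ?thesis
    unfolding E_eq by simp
qed

text \<open>With weight n in \<open>sum_by_parts\<close>, each coefficient is multiplied by (n - 1)
  - n = -1. The integers enter through \<open>of_int\<close>, so the identity is valid in every
  characteristic.\<close>

lemma panores_1_eq:
  assumes "finite D" "D \<subseteq> V" "\<And>x. x \<in> V \<Longrightarrow> x \<notin> D \<Longrightarrow> d x = 0"
    and "\<And>x. x \<in> V \<Longrightarrow> coeffs f x = d (up x) - d x"
  shows "panores_1 q s \<alpha> f = - (\<Sum>x\<in>D. d x)"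
proof -
  let ?w = "\<lambda>x :: 'a set set \<times> int \<times> nat. of_int (fst (snd x)) :: 'a"
  have "panores_1 q s \<alpha> f = (\<Sum>x | x \<in> V \<and> coeffs f x \<noteq> 0. coeffs f x * ?w x)"
    by (simp add: panores_1_def polar_support_eq case_prod_unfold coeffs_def rep_def mult.commute)
  also have "\<dots> = (\<Sum>x\<in>D. d x * ?w (down x)) - (\<Sum>x\<in>D. d x * ?w x)"
    by (rule sum_by_parts[where d = d and D = D, OF assms])
  also have "\<dots> = (\<Sum>x\<in>D. d x * (?w (down x) - ?w x))"
    by (simp add: right_diff_distrib sum_subtractf)
  also have "\<dots> = (\<Sum>x\<in>D. d x * (- 1))"
    by (intro sum.cong refl arg_cong2[of _ _ _ _ "(*)"]) (simp add: down_def split: prod.split)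
  finally show ?thesis by (simp add: sum_negf)
qed

section \<open>Necessity and sufficiency of the vanishing of all residues\<close>

lemma summable_imp_residues_zero:
  assumes f: "f \<in> elliptic_functions M q" and "elliptically_summable M q s f"
  shows "panores_0 q s \<alpha> f = 0" "panores_1 q s \<alpha> f = 0"
    and "\<And>\<omega> k. \<omega> \<in> tau_orbits q s \<Longrightarrow> 1 \<le> k \<Longrightarrow> ores f \<omega> k = 0"
proof -
  from assms obtain g where g: "g \<in> elliptic_functions M q" and
    fg: "mero_eq f (\<lambda>z. g (s * z) - g z)" by (auto simp: elliptically_summable_def)
  let ?D = "polar_support q s \<alpha> g"
  have D: "finite ?D" "?D \<subseteq> V" "\<And>x. x \<in> V \<Longrightarrow> x \<notin> ?D \<Longrightarrow> coeffs g x = 0"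
    using finite_polar_support[OF g] by (auto simp: polar_support_eq)
  \<comment> \<open>The principal part of g(s z) at \<open>rep \<omega> n\<close> is that of g at s
    times this point, which is \<open>rep \<omega> (n + 1)\<close>. The local parameter 1 -
    z/\<alpha> is invariant under scaling both z and \<alpha>, so no factor appears.\<close>
  have coeffs: "coeffs f x = coeffs g (up x) - coeffs g x" if "x \<in> V" for x
  proof -
    obtain \<omega> n k where x: "x = (\<omega>, n, k)" by (cases x) auto
    with that have \<omega>: "\<omega> \<in> tau_orbits q s" by (simp add: V_def)
    have "principal_part g (s * rep \<omega> n) (polar_coeff g (rep \<omega> (n + 1)))"
      unfolding s_rep using g \<omega> by (intro principal_part_polar_coeff elliptic_in_M) auto
    then have "principal_part (\<lambda>z. g (s * z)) (rep \<omega> n) (polar_coeff g (rep \<omega> (n + 1)))"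
      by (rule principal_part_mult_arg) simp
    moreover have "principal_part g (rep \<omega> n) (polar_coeff g (rep \<omega> n))"
      using g \<omega> by (intro principal_part_polar_coeff elliptic_in_M) auto
    ultimately have "principal_part (\<lambda>z. g (s * z) - g z) (rep \<omega> n)
        (\<lambda>k. polar_coeff g (rep \<omega> (n + 1)) k - polar_coeff g (rep \<omega> n) k)"
      by (rule principal_part_diff)
    moreover have "\<forall>\<^sub>F z in at (rep \<omega> n). g (s * z) - g z = f z"
      using \<omega> by (intro mero_eq_eventually mero_eq_sym[OF fg]) auto
    ultimately have "principal_part f (rep \<omega> n) (\<lambda>k. polar_coeff g (rep \<omega> (n + 1)) k - polar_coeff g (rep \<omega> n) k)"
      by (rule principal_part_cong[rotated])
    then show ?thesis
      using polar_coeff_eq[OF elliptic_in_M[OF f], of "rep \<omega> n"] \<omega> by (simp add: x coeffs_def up_def)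
  qed
  show "panores_1 q s \<alpha> f = 0"
    using panores_1_eq[where d = "coeffs g" and D = ?D, OF D coeffs] zeta_expansion_correct(1)[OF g] by simp
  obtain c where c: "mero_eq g (\<lambda>z. c + E (coeffs g) ?D z)"
    using zeta_expansion_correct(2)[OF g] by (auto simp: zeta_expansion_eq)
  \<comment> \<open>The additive constant of g cancels in the difference, leaving no constant for
    f.\<close>
  have "mero_eq f (\<lambda>z. (c + E (coeffs g) ?D (s * z)) - (c + E (coeffs g) ?D z))"
    by (rule mero_eq_trans[OF fg mero_eq_diff[OF mero_eq_mult_arg[OF c s_nz] c]])
  moreover have "zeta_expansion q s \<alpha> f z = E (coeffs g) ?D (s * z) - E (coeffs g) ?D z" for z
    unfolding zeta_expansion_eq polar_support_eq[of f] by (rule E_difference) (use D coeffs in auto)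
  ultimately have "mero_eq f (\<lambda>z. 0 + zeta_expansion q s \<alpha> f z)"
    by simp
  then show "panores_0 q s \<alpha> f = 0" by (rule panores_0_eqI)
  fix \<omega> and k :: nat assume \<omega>: "\<omega> \<in> tau_orbits q s" and k: "1 \<le> k"
  let ?d = "\<lambda>n. coeffs g (\<omega>, n, k)"
  have "(\<lambda>n. (\<omega>, n, k)) ` {n. ?d n \<noteq> 0} \<subseteq> ?D"
    using \<omega> k by (auto simp: polar_support_eq V_def)
  then have "finite {n. ?d n \<noteq> 0}"
    using D(1) by (meson finite_imageD finite_subset inj_onI prod.inject)
  from telescoping_sum_int[OF this] show "ores f \<omega> k = 0"
    unfolding ores_eq[OF f \<omega>] using coeffs[of "(\<omega>, _, k)"] \<omega> k by (simp add: V_def up_def)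
qed

lemma residues_zero_imp_summable:
  assumes f: "f \<in> elliptic_functions M q"
    and p0: "panores_0 q s \<alpha> f = 0" and p1: "panores_1 q s \<alpha> f = 0"
    and ores: "\<And>\<omega> k. \<omega> \<in> tau_orbits q s \<Longrightarrow> 1 \<le> k \<Longrightarrow> ores f \<omega> k = 0"
  shows "elliptically_summable M q s f"
proof -
  let ?S = "polar_support q s \<alpha> f"
  have S: "finite ?S" by (rule finite_polar_support[OF f])
  define N where "N \<omega> k = {j. coeffs f (\<omega>, j, k) \<noteq> 0}" for \<omega> k
  have finN: "finite (N \<omega> k)" if "\<omega> \<in> tau_orbits q s" "1 \<le> k" for \<omega> k
  proof -
    have "(\<lambda>n. (\<omega>, n, k)) ` N \<omega> k \<subseteq> ?S"
      using that by (auto simp: N_def polar_support_eq V_def)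
    then show ?thesis
      using S by (meson finite_imageD finite_subset inj_onI prod.inject)
  qed
  \<comment> \<open>The antidifference along each orbit, normalised to vanish far to the left; the
    strict inequality j < n makes d(n + 1) - d(n) the n-th coefficient.\<close>
  define d where "d = (\<lambda>(\<omega>, n, k). \<Sum>j | j \<in> N \<omega> k \<and> j < n. coeffs f (\<omega>, j, k))"
  define D where "D = {x \<in> V. d x \<noteq> 0}"
  have d: "coeffs f x = d (up x) - d x" if "x \<in> V" for x
  proof -
    obtain \<omega> n k where x: "x = (\<omega>, n, k)" by (cases x) auto
    with that have fin: "finite (N \<omega> k)" by (intro finN) (auto simp: V_def)
    have "{j. j \<in> N \<omega> k \<and> j < n + 1} = {j. j \<in> N \<omega> k \<and> j < n} \<union> (if coeffs f (\<omega>, n, k) = 0 then {} else {n})"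
      by (auto simp: N_def less_le)
    then show ?thesis
      using fin by (simp add: x d_def up_def sum.union_disjoint)
  qed
  \<comment> \<open>To the left of the support the defining sum is empty, and to the right it is the
    whole orbital residue, hence 0. A position n with nonzero value therefore lies between two
    support positions i < n \<le> j.\<close>
  have "finite D"
  proof (rule finite_subset)
    show "D \<subseteq> (\<Union>x\<in>?S. \<Union>y\<in>?S. (\<lambda>n. (fst x, n, snd (snd x))) ` {fst (snd x)..fst (snd y)})"
    proof
      fix x assume "x \<in> D"
      obtain \<omega> n k where x: "x = (\<omega>, n, k)" by (cases x) auto
      with \<open>x \<in> D\<close> have \<omega>: "\<omega> \<in> tau_orbits q s" "1 \<le> k" and dx: "d (\<omega>, n, k) \<noteq> 0"
        by (auto simp: D_def V_def)
      let ?A = "{j. j \<in> N \<omega> k \<and> j < n}" and ?B = "{j. j \<in> N \<omega> k \<and> n \<le> j}"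
      have "?A \<noteq> {}"
      proof
        assume "?A = {}"
        then show False using dx unfolding d_def prod.case by (metis sum.empty)
      qed
      then obtain i where i: "i \<in> N \<omega> k" "i < n" by blast
      have "?A \<union> ?B = N \<omega> k" by auto
      moreover have "(\<Sum>j\<in>?A \<union> ?B. coeffs f (\<omega>, j, k)) = (\<Sum>j\<in>?A. coeffs f (\<omega>, j, k)) + (\<Sum>j\<in>?B. coeffs f (\<omega>, j, k))"
        by (rule sum.union_disjoint) (use finN[OF \<omega>] in auto)
      moreover have "(\<Sum>j\<in>N \<omega> k. coeffs f (\<omega>, j, k)) = 0"
        using ores[OF \<omega>] by (simp add: ores_eq[OF f \<omega>(1)] N_def)
      ultimately have "(\<Sum>j\<in>?A. coeffs f (\<omega>, j, k)) + (\<Sum>j\<in>?B. coeffs f (\<omega>, j, k)) = 0"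
        by simp
      moreover have "(\<Sum>j\<in>?A. coeffs f (\<omega>, j, k)) \<noteq> 0"
        using dx by (simp add: d_def)
      ultimately have "(\<Sum>j\<in>?B. coeffs f (\<omega>, j, k)) \<noteq> 0"
        by auto
      then have "?B \<noteq> {}" by (rule contrapos_nn) (simp only: sum.empty)
      then obtain j where j: "j \<in> N \<omega> k" "n \<le> j" by blast
      have "(\<omega>, i, k) \<in> ?S" "(\<omega>, j, k) \<in> ?S"
        using i j \<omega> by (auto simp: N_def polar_support_eq V_def)
      then show "x \<in> (\<Union>x\<in>?S. \<Union>y\<in>?S. (\<lambda>n. (fst x, n, snd (snd x))) ` {fst (snd x)..fst (snd y)})"
        using i j by (intro UN_I[of "(\<omega>, i, k)"] UN_I[of "(\<omega>, j, k)"]) (auto simp: x)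
    qed
  qed (use S in auto)
  then have D: "finite D" "D \<subseteq> V" "\<And>x. x \<in> V \<Longrightarrow> x \<notin> D \<Longrightarrow> d x = 0"
    by (auto simp: D_def)
  let ?g = "E d D"
  \<comment> \<open>The total coefficient is minus the first panorbital residue; its vanishing makes
    the quasi-invariant combination elliptic.\<close>
  have "(\<Sum>x\<in>D. d x) = 0"
    using panores_1_eq[where d = d and D = D, OF D d] p1 by simp
  then have g: "?g \<in> elliptic_functions M q"
    using E_in_M[OF D(1,2)] E_shift[OF D(1,2), of d] by (simp add: elliptic_functions_def)
  obtain c where c: "mero_eq f (\<lambda>z. c + zeta_expansion q s \<alpha> f z)"
    using zeta_expansion_correct(2)[OF f] by blast
  then have "c = 0" using panores_0_eqI p0 by simp
  moreover have "zeta_expansion q s \<alpha> f z = ?g (s * z) - ?g z" for z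
    unfolding zeta_expansion_eq polar_support_eq[of f] by (rule E_difference) (use D d in auto)
  ultimately have "mero_eq f (\<lambda>z. ?g (s * z) - ?g z)"
    using c by simp
  with g show ?thesis unfolding elliptically_summable_def by blast
qed

theorem elliptically_summable_iff:
  assumes "f \<in> elliptic_functions M q"
  shows "elliptically_summable M q s f \<longleftrightarrow>
    panores_0 q s \<alpha> f = 0 \<and> panores_1 q s \<alpha> f = 0 \<and> (\<forall>\<omega>\<in>tau_orbits q s. \<forall>k\<ge>1. ores f \<omega> k = 0)"
  using summable_imp_residues_zero[OF assms] residues_zero_imp_summable[OF assms] by blast

end

section \<open>Polar expansions obtained from power series in z - \<alpha>\<close>

lemma sums_drop_initial:
  fixes f :: "nat \<Rightarrow> 'a::topological_ab_group_add"
  assumes "f sums s"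
  shows "(\<lambda>j. f (j + K)) sums (s - (\<Sum>j<K. f j))"
proof -
  have *: "(\<Sum>j<n. f (j + K)) = (\<Sum>j<n + K. f j) - (\<Sum>j<K. f j)" for n
    by (induction n) (simp_all add: algebra_simps)
  show ?thesis
    using assms unfolding sums_def * by (intro tendsto_diff tendsto_const LIMSEQ_ignore_initial_segment)
qed

text \<open>The first K coefficients of the power series become the principal part and the others
  the regular part. The powers of -\<alpha> come from z - \<alpha> = -\<alpha> (1 -
  z/\<alpha>).\<close>

lemma polar_expansion_of_sums:
  fixes f :: "'a::valued_field \<Rightarrow> 'a"
  assumes \<alpha>: "\<alpha> \<noteq> 0" and r: "r > 0"
    and sums: "\<And>z. z \<noteq> \<alpha> \<Longrightarrow> absval (z - \<alpha>) < r \<Longrightarrow> (\<lambda>j. t j * (z - \<alpha>) ^ j) sums (f z * (z - \<alpha>) ^ K)"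
  shows "\<exists>c. polar_expansion f \<alpha> c"
proof -
  define c where "c k = (if 1 \<le> k \<and> k \<le> K then t (K - k) / (- \<alpha>) ^ k else 0)" for k
  define h where "h j = t (j + K) * (- \<alpha>) ^ j" for j
  have fin: "finite {k. c k \<noteq> 0}"
    by (rule finite_subset[of _ "{..K}"]) (auto simp: c_def)
  have "(\<lambda>j. h j * (1 - z / \<alpha>) ^ j) sums (f z - (\<Sum>k | c k \<noteq> 0. c k / (1 - z / \<alpha>) ^ k))"
    if z: "0 < absval (1 - z / \<alpha>)" "absval (1 - z / \<alpha>) < r / absval \<alpha>" for z
  proof -
    define w where "w = 1 - z / \<alpha>"
    have w: "z - \<alpha> = - \<alpha> * w" "w \<noteq> 0" using \<alpha> z(1) by (auto simp: w_def field_simps)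
    have "absval (z - \<alpha>) < r"
      using z(2) \<alpha> by (simp add: w(1) absval_mult field_simps flip: w_def)
    then have "(\<lambda>j. t j * (z - \<alpha>) ^ j) sums (f z * (z - \<alpha>) ^ K)"
      using w \<alpha> by (intro sums) auto
    from sums_drop_initial[OF this, of K]
    have "(\<lambda>j. inverse ((z - \<alpha>) ^ K) * (t (j + K) * (z - \<alpha>) ^ (j + K))) sums
       (inverse ((z - \<alpha>) ^ K) * (f z * (z - \<alpha>) ^ K - (\<Sum>j<K. t j * (z - \<alpha>) ^ j)))"
      unfolding sums_def sum_distrib_left[symmetric] by (intro tendsto_mult tendsto_const)
    also have "(\<lambda>j. inverse ((z - \<alpha>) ^ K) * (t (j + K) * (z - \<alpha>) ^ (j + K))) = (\<lambda>j. h j * w ^ j)"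
    proof
      fix j
      have "h j * w ^ j = t (j + K) * (z - \<alpha>) ^ j"
        unfolding w(1) power_mult_distrib h_def by (rule mult.assoc)
      moreover have "(z - \<alpha>) ^ K \<noteq> 0" using w \<alpha> by simp
      ultimately show "inverse ((z - \<alpha>) ^ K) * (t (j + K) * (z - \<alpha>) ^ (j + K)) = h j * w ^ j"
        by (simp add: power_add)
    qed
    also have "inverse ((z - \<alpha>) ^ K) * (f z * (z - \<alpha>) ^ K - (\<Sum>j<K. t j * (z - \<alpha>) ^ j)) =
        f z - (\<Sum>j<K. t j * (z - \<alpha>) ^ j / (z - \<alpha>) ^ K)"
    proof -
      have "(z - \<alpha>) ^ K \<noteq> 0" using w \<alpha> by simp
      then show ?thesis by (simp add: right_diff_distrib sum_distrib_left divide_inverse mult_ac)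
    qed
    also have "(\<Sum>j<K. t j * (z - \<alpha>) ^ j / (z - \<alpha>) ^ K) = (\<Sum>k = 1..K. c k / w ^ k)"
    proof (rule sum.reindex_bij_witness[of _ "\<lambda>k. K - k" "\<lambda>j. K - j"])
      fix j assume j: "j \<in> {..<K}"
      have "(z - \<alpha>) ^ K = (z - \<alpha>) ^ j * (z - \<alpha>) ^ (K - j)"
        using j by (simp flip: power_add)
      then have "t j * (z - \<alpha>) ^ j / (z - \<alpha>) ^ K = t j / (z - \<alpha>) ^ (K - j)"
        using w \<alpha> by simp
      also have "(z - \<alpha>) ^ (K - j) = (- \<alpha>) ^ (K - j) * w ^ (K - j)"
        unfolding w(1) by (rule power_mult_distrib)
      finally show "c (K - j) / w ^ (K - j) = t j * (z - \<alpha>) ^ j / (z - \<alpha>) ^ K"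
        using j by (simp add: c_def)
    qed auto
    also have "\<dots> = (\<Sum>k | c k \<noteq> 0. c k / w ^ k)"
      by (rule sum.mono_neutral_right) (auto simp: c_def split: if_splits)
    finally show ?thesis by (simp add: w_def)
  qed
  then have "polar_expansion f \<alpha> c"
    unfolding polar_expansion_def using fin \<alpha> r
    by (intro conjI exI[of _ h] exI[of _ "r / absval \<alpha>"]) (auto simp: c_def)
  then show ?thesis by blast
qed

section \<open>The complex case\<close>

text \<open>With d the order of the Laurent expansion, \<open>nat d\<close> measures a zero and
  \<open>nat (- d)\<close> a pole, and one of them is 0. Padding the series by \<open>nat d\<close>
  zero coefficients and clearing a pole of order \<open>nat (- d)\<close> treats both cases at
  once.\<close>

lemma complex_polar_expansion_exists:
  assumes "f meromorphic_on {\<alpha>}" "\<alpha> \<noteq> 0"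
  shows "\<exists>c. polar_expansion f \<alpha> c"
proof -
  obtain F where F: "(\<lambda>w. f (\<alpha> + w)) has_laurent_expansion F"
    using assms(1) by (auto simp: meromorphic_on_def)
  define P where "P = fls_base_factor_to_fps F"
  define d where "d = fls_subdegree F"
  define t where "t j = (if j < nat d then 0 else fps_nth P (j - nat d))" for j
  have "fps_conv_radius P > 0"
    using has_fps_expansion_fls_base_factor_to_fps[OF F] by (simp add: P_def has_fps_expansion_def)
  then obtain r1 where r1: "r1 > 0" "ereal r1 < fps_conv_radius P"
    by (metis ereal_dense2 ereal_less(2) less_ereal.simps(1) zero_ereal_def)
  from F obtain r2 where r2: "r2 > 0" "\<And>w. w \<noteq> 0 \<Longrightarrow> norm w < r2 \<Longrightarrow> eval_fls F w = f (\<alpha> + w)"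
    unfolding has_laurent_expansion_def eventually_at by (auto simp: dist_norm)
  show ?thesis
  proof (rule polar_expansion_of_sums[where t = t and K = "nat (- d)" and r = "min r1 r2"])
    fix z assume z: "z \<noteq> \<alpha>" "absval (z - \<alpha>) < min r1 r2"
    define w where "w = z - \<alpha>"
    have w: "w \<noteq> 0" "norm w < r1" "norm w < r2" and z': "z = \<alpha> + w"
      using z by (simp_all add: w_def absval_eq_norm)
    have "ereal (norm w) < fps_conv_radius P"
      using w(2) r1(2) by (meson ereal_less_eq(3) less_imp_le order.strict_trans1)
    then have "(\<lambda>j. fps_nth P j * w ^ j) sums eval_fps P w" by (rule sums_eval_fps)
    from sums_mult[OF this, of "w ^ nat d"]
    have "(\<lambda>j. t (j + nat d) * w ^ (j + nat d)) sums (w ^ nat d * eval_fps P w)"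
      by (simp add: t_def power_add mult_ac)
    moreover have "(\<Sum>j<nat d. t j * w ^ j) = 0" by (simp add: t_def)
    ultimately have "(\<lambda>j. t j * w ^ j) sums (w ^ nat d * eval_fps P w)"
        using sums_iff_shift[of "\<lambda>j. t j * w ^ j" "nat d"] by simp
    also have "w ^ nat d = w powi d * w ^ nat (- d)"
      using w(1) by (cases "d \<ge> 0") (simp_all add: power_int_def power_inverse)
    also have "w powi d * w ^ nat (- d) * eval_fps P w = f z * w ^ nat (- d)"
      using r2(2)[OF w(1,3)] by (simp add: eval_fls_def P_def d_def z' mult_ac)
    finally show "(\<lambda>j. t j * (z - \<alpha>) ^ j) sums (f z * (z - \<alpha>) ^ nat (- d))"
      by (simp add: w_def)
  qed (use assms r1 r2 in auto)
qed

lemma compact_annulus: "compact {z::complex. a \<le> norm z \<and> norm z \<le> b}"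
proof -
  have "{z::complex. a \<le> norm z \<and> norm z \<le> b} = cball 0 b - ball 0 a"
    by (auto simp: dist_norm)
  then show ?thesis by (simp add: compact_diff)
qed

text \<open>An infinite exceptional set in a compact annulus would have a limit point there,
  contradicting equality near that point.\<close>

lemma complex_mero_eqI:
  assumes "\<And>\<alpha>. \<alpha> \<noteq> 0 \<Longrightarrow> \<forall>\<^sub>F z in at \<alpha>. f z = g z"
  shows "mero_eq f (g :: complex \<Rightarrow> complex)"
  unfolding mero_eq_def
proof (intro allI impI)
  fix a b :: real assume a: "0 < a"
  have "finite ({z. a \<le> norm z \<and> norm z \<le> b} \<inter> {z. f z \<noteq> g z})"
  proof (rule finite_not_islimpt_in_compact[OF compact_annulus])
    fix z assume "z \<in> {z::complex. a \<le> norm z \<and> norm z \<le> b}"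
    then have "z \<noteq> 0" using a by auto
    from assms[OF this] show "\<not> z islimpt {z. f z \<noteq> g z}"
      by (simp add: islimpt_iff_eventually)
  qed
  moreover have "{z. a \<le> norm z \<and> norm z \<le> b} \<inter> {z. f z \<noteq> g z} =
      {z. a \<le> absval z \<and> absval z \<le> b \<and> f z \<noteq> g z}"
    by (auto simp: absval_eq_norm)
  ultimately show "finite {z. a \<le> absval z \<and> absval z \<le> b \<and> f z \<noteq> g z}" by simp
qed

text \<open>Non-analytic points of a meromorphic function do not accumulate in the punctured plane,
  and at an analytic point continuity gives boundedness.\<close>

lemma complex_finite_poles:
  assumes f: "f meromorphic_on - {0}" and a: "0 < a"
  shows "finite {\<alpha>. a \<le> absval \<alpha> \<and> absval \<alpha> \<le> b \<and> \<not> bdd_near f \<alpha>}"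
proof -
  let ?K = "{z::complex. a \<le> norm z \<and> norm z \<le> b}"
  have "finite (?K \<inter> {w. \<not> f analytic_on {w}})"
    by (rule finite_not_islimpt_in_compact[OF compact_annulus])
       (use a in \<open>auto intro!: meromorphic_on_imp_not_islimpt_singularities[OF f]\<close>)
  then show ?thesis
  proof (rule rev_finite_subset)
    have "bdd_near f w" if "f analytic_on {w}" for w
      using analytic_at_imp_isCont[OF that] unfolding isCont_def by (rule bdd_near_tendsto)
    then show "{\<alpha>. a \<le> absval \<alpha> \<and> absval \<alpha> \<le> b \<and> \<not> bdd_near f \<alpha>} \<subseteq> ?K \<inter> {w. \<not> f analytic_on {w}}"
      by (auto simp: absval_eq_norm)
  qed
qed

section \<open>The Liouville theorem over the complex numbers\<close>

lemma bdd_near_imp_not_is_pole: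
  fixes f :: "complex \<Rightarrow> complex"
  assumes "bdd_near f z" shows "\<not> is_pole f z"
proof
  assume "is_pole f z"
  from assms obtain C where C: "\<forall>\<^sub>F w in at z. norm (f w) \<le> C"
    unfolding bdd_near_def absval_eq_norm by blast
  have "max 1 (C + 1) > 0" by simp
  then have "\<forall>\<^sub>F w in at z. norm (f w) \<ge> max 1 (C + 1)"
    using \<open>is_pole f z\<close> unfolding is_pole_def filterlim_at_infinity[OF order_refl] by blast
  with C have "\<forall>\<^sub>F w in at z. False" by eventually_elim auto
  then show False by simp
qed

text \<open>The maximum of |\<phi>| over the compact fundamental annulus is attained, and by
  invariance it is a maximum over the whole punctured plane, which is open and connected.\<close>

lemma holomorphic_scaling_invariant_constant:
  fixes q :: complex
  assumes \<phi>: "\<phi> holomorphic_on - {0}" and q: "q \<noteq> 0" "norm q < 1"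
    and inv: "\<And>z. z \<noteq> 0 \<Longrightarrow> \<phi> (q * z) = \<phi> z"
  shows "\<phi> constant_on - {0}"
proof -
  let ?K = "{z::complex. norm q \<le> norm z \<and> norm z \<le> 1}"
  have K: "?K \<subseteq> - {0}" using q by auto
  have "continuous_on ?K (\<lambda>z. norm (\<phi> z))"
    using holomorphic_on_imp_continuous_on[OF holomorphic_on_subset[OF \<phi> K]] by (intro continuous_intros)
  moreover have "1 \<in> ?K" using q by simp
  ultimately obtain \<xi> where \<xi>: "\<xi> \<in> ?K" "\<And>z. z \<in> ?K \<Longrightarrow> norm (\<phi> z) \<le> norm (\<phi> \<xi>)"
    using continuous_attains_sup[OF compact_annulus[of "norm q" 1], of "\<lambda>z. norm (\<phi> z)"] by blast
  have inv_powi: "\<phi> (z * q powi m) = \<phi> z" if "z \<noteq> 0" for z m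
  proof (induction m rule: int_shift_invariant)
    case (2 m)
    then show ?case using inv[of "z * q powi m"] that q by (simp add: power_int_add mult_ac)
  qed simp
  have "norm (\<phi> z) \<le> norm (\<phi> \<xi>)" if z: "z \<noteq> 0" for z
  proof -
    obtain m where "norm q \<le> norm z * norm q powi m" "norm z * norm q powi m \<le> 1"
      using ex_powi_between[of "norm q" "norm z"] q z by auto
    then have "z * q powi m \<in> ?K" by (simp add: norm_mult norm_power_int)
    from \<xi>(2)[OF this] show ?thesis by (simp add: inv_powi[OF z])
  qed
  moreover have "connected (- {0::complex})" by (rule connected_punctured_universe) simp
  ultimately show ?thesis
    using \<phi> \<xi>(1) K by (intro maximum_modulus_principle[of \<phi> "- {0}" "- {0}" \<xi>]) auto
qed

text \<open>
  The function \<open>z h'(z)\<close> is invariant under \<open>q\<close>, hence a constant \<open>c\<close>; since \<open>h' = c / z\<close> has a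
  primitive, \<open>c = 0\<close>.
\<close>

lemma holomorphic_quasi_invariant_constant:
  fixes q :: complex
  assumes h: "h holomorphic_on - {0}" and q: "q \<noteq> 0" "norm q < 1"
    and shift: "\<And>z. z \<noteq> 0 \<Longrightarrow> h (q * z) = h z + d"
  shows "h constant_on - {0}"
proof -
  have op: "open (- {0::complex})" by auto
  have der: "(h has_field_derivative deriv h z) (at z)" if "z \<noteq> 0" for z
    using h that op by (intro holomorphic_derivI) auto
  have "(\<lambda>z. z * deriv h z) constant_on - {0}"
  proof (rule holomorphic_scaling_invariant_constant[OF _ q])
    show "(\<lambda>z. z * deriv h z) holomorphic_on - {0}"
      using h op by (intro holomorphic_intros)
    fix z :: complex assume z: "z \<noteq> 0"
    have "((\<lambda>z. h (q * z)) has_field_derivative (deriv h (q * z) * q)) (at z)"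
      using der[of "q * z"] z q by (auto intro!: derivative_eq_intros DERIV_chain2[of h])
    moreover have "((\<lambda>z. h z + d) has_field_derivative deriv h z) (at z)"
      using der[OF z] by (auto intro!: derivative_eq_intros)
    moreover have "\<forall>\<^sub>F w in nhds z. h (q * w) = h w + d"
      using eventually_nhds_in_open[OF op, of z] z by (auto elim!: eventually_mono intro: shift)
    ultimately have "deriv h (q * z) * q = deriv h z"
      by (metis DERIV_unique DERIV_cong_ev)
    then show "q * z * deriv h (q * z) = z * deriv h z"
      by (simp add: mult_ac)
  qed
  then obtain c where c: "\<And>z. z \<noteq> 0 \<Longrightarrow> z * deriv h z = c"
    unfolding constant_on_def by blast
  have "(deriv h has_contour_integral 0) (circlepath 0 1)"
    by (rule Cauchy_theorem_primitive[of "- {0}" h])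
       (auto intro!: has_field_derivative_at_within der)
  moreover have "deriv h u = c / (u - 0) ^ Suc 0" if "u \<noteq> 0" for u
    using c[OF that] that by (simp add: field_simps)
  then have "deriv h u = c / (u - 0) ^ Suc 0" if "u \<in> path_image (circlepath 0 1)" for u
  proof -
    have "u \<noteq> 0" using that by auto
    then show ?thesis by fact
  qed
  ultimately have "((\<lambda>u. c / (u - 0) ^ Suc 0) has_contour_integral 0) (circlepath 0 1)"
    by (rule has_contour_integral_eq)
  then have "contour_integral (circlepath 0 1) (\<lambda>u. c / (u - 0) ^ Suc 0) = 0"
    by (rule contour_integral_unique)
  moreover have "contour_integral (circlepath 0 1) (\<lambda>u. c / (u - 0) ^ Suc 0) = 2 * pi * \<i> * c"
    using Cauchy_contour_integral_circlepath[of 0 1 "\<lambda>_. c" 0 0] by simp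
  ultimately have "c = 0" by simp
  then have "deriv h z = 0" if "z \<noteq> 0" for z using c[OF that] that by simp
  then have "(h has_field_derivative 0) (at z)" if "z \<in> - {0}" for z
    using der[of z] that by simp
  moreover have "connected (- {0::complex})" by (rule connected_punctured_universe) simp
  ultimately show ?thesis by (rule has_field_derivative_0_imp_constant_on[OF _ _ op])
qed

lemma complex_liouville:
  fixes q :: complex
  assumes g: "g meromorphic_on - {0}" and q: "q \<noteq> 0" "norm q < 1"
    and bdd: "\<And>\<alpha>. \<alpha> \<noteq> 0 \<Longrightarrow> bdd_near g \<alpha>"
    and shift: "mero_eq (\<lambda>z. g (q * z)) (\<lambda>z. g z + d)"
  shows "d = 0 \<and> (\<exists>c. mero_eq g (\<lambda>_. c))"
proof -
  define h where "h = remove_sings g"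
  have sing: "isolated_singularity_at g z" "not_essential g z" if "z \<noteq> 0" for z
    using g that by (auto simp: meromorphic_on_altdef)
  have "h analytic_on {z}" if "z \<noteq> 0" for z
    using sing[OF that] bdd_near_imp_not_is_pole[OF bdd[OF that]]
    unfolding h_def not_essential_def by (auto intro: remove_sings_analytic_at)
  then have an: "h analytic_on - {0}"
    by (subst analytic_on_analytic_at) auto
  have hol: "h holomorphic_on - {0}" by (rule analytic_imp_holomorphic[OF an])
  have cont: "h \<midarrow>z\<rightarrow> h z" if "z \<noteq> 0" for z
    using holomorphic_on_imp_continuous_on[OF hol] continuous_on_eq_continuous_at[of "- {0}" h] that
    by (simp add: isCont_def open_Compl)
  have hg: "\<forall>\<^sub>F w in at z. h w = g w" if "z \<noteq> 0" for z
    using eventually_remove_sings_eq_at[OF sing(1)[OF that]] by (simp add: h_def)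
  \<comment> \<open>The functional equation is given only off exceptional points; once the
    singularities are removed, continuity of h extends it to every nonzero z.\<close>
  have hq: "h (q * z) = h z + d" if z: "z \<noteq> 0" for z
  proof (rule tendsto_unique)
    show "((\<lambda>w. h (q * w)) \<longlongrightarrow> h (q * z)) (at z)"
      using cont[of "q * z"] z q unfolding filtermap_mult_at[OF q(1), symmetric] by (simp add: filterlim_filtermap)
    have "\<forall>\<^sub>F w in at z. h (q * w) = g (q * w)"
      using hg[of "q * z"] z q by (simp add: eventually_at_mult_iff[OF q(1)])
    then have "\<forall>\<^sub>F w in at z. h w + d = h (q * w)"
      using hg[OF z] mero_eq_eventually[OF shift z] by eventually_elim simp
    then show "((\<lambda>w. h (q * w)) \<longlongrightarrow> h z + d) (at z)"
      by (rule Lim_transform_eventually[rotated]) (intro tendsto_intros cont z)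
  qed simp
  obtain c where c: "\<And>z. z \<noteq> 0 \<Longrightarrow> h z = c"
    using holomorphic_quasi_invariant_constant[OF hol q hq] unfolding constant_on_def by blast
  have "d = 0" using hq[of 1] c[of 1] c[of q] q by simp
  moreover have "mero_eq g (\<lambda>_. c)"
  proof (rule complex_mero_eqI)
    fix z :: complex assume z: "z \<noteq> 0"
    have "\<forall>\<^sub>F w in at z. w \<noteq> 0" using eventually_at_not_in_finite[of "{0}" z] by simp
    with hg[OF z] show "\<forall>\<^sub>F w in at z. g w = c" by eventually_elim (simp add: c)
  qed
  ultimately show ?thesis by blast
qed

section \<open>Meromorphy of the zeta functions over the complex numbers\<close>

context
  fixes q :: complex
  assumes q: "q \<noteq> 0" "norm q < 1"
begin

interpretation multiplier q
  using q by unfold_locales (auto simp: absval_eq_norm)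

text \<open>Weierstrass M-test: on the disc of radius 1/2 the terms are holomorphic and dominated by
  a geometric sequence in m.\<close>

lemma W_holomorphic:
  assumes j: "1 \<le> j"
  shows "W j k holomorphic_on ball 0 (1 / 2)"
proof (rule holomorphic_uniform_sequence)
  show "(\<lambda>y. \<Sum>m<n. psi j k (q ^ Suc m * y)) holomorphic_on ball 0 (1 / 2)" for n
  proof (intro holomorphic_on_sum)
    fix m
    have "1 - q ^ Suc m * y \<noteq> 0" if "y \<in> ball 0 (1 / 2)" for y
    proof -
      have "norm (q ^ Suc m * y) \<le> 1 * norm y"
        unfolding norm_mult norm_power using q by (intro mult_right_mono power_le_one) auto
      then have "norm (q ^ Suc m * y) < 1" using that by simp
      then show ?thesis by auto
    qed
    then show "(\<lambda>y. psi j k (q ^ Suc m * y)) holomorphic_on ball 0 (1 / 2)"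
      unfolding psi_def by (intro holomorphic_intros) auto
  qed
  have lim: "uniform_limit (ball 0 (1 / 2)) (\<lambda>n y. \<Sum>m<n. psi j k (q ^ Suc m * y)) (W j k) sequentially"
  proof -
    have "uniform_limit (ball 0 (1 / 2)) (\<lambda>n y. \<Sum>m<n. psi j k (q ^ Suc m * y))
        (\<lambda>y. suminf (\<lambda>m. psi j k (q ^ Suc m * y))) sequentially"
    proof (rule Weierstrass_m_test)
      fix m and y :: complex assume y: "y \<in> ball 0 (1 / 2)"
      have "norm (psi j k (q ^ Suc m * y)) \<le> 2 ^ (k + 1) * norm y * norm q ^ Suc m"
        using geometric_psi_le[OF j, of y k "Suc m"] y by (simp add: absval_eq_norm)
      also have "\<dots> \<le> 2 ^ (k + 1) * 1 * norm q ^ Suc m"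
        using y by (intro mult_right_mono mult_left_mono) auto
      finally show "norm (psi j k (q ^ Suc m * y)) \<le> 2 ^ (k + 1) * norm q ^ Suc m" by simp
    next
      show "summable (\<lambda>m. 2 ^ (k + 1) * norm q ^ Suc m)"
        using q by (intro summable_mult) (simp add: summable_mult)
    qed
    moreover have "suminf (\<lambda>m. psi j k (q ^ Suc m * y)) = W j k y" for y
      using has_sum_imp_sums[OF W_has_sum[OF j]] sums_unique by metis
    ultimately show ?thesis by simp
  qed
  fix x assume "x \<in> ball (0::complex) (1 / 2)"
  then obtain d where d: "0 < d" "cball x d \<subseteq> ball 0 (1 / 2)"
    using open_contains_cball[of "ball (0::complex) (1 / 2)"] open_ball by blast
  with lim show "\<exists>d>0. cball x d \<subseteq> ball 0 (1 / 2) \<and>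
      uniform_limit (cball x d) (\<lambda>n y. \<Sum>m<n. psi j k (q ^ Suc m * y)) (W j k) sequentially"
    by (meson uniform_limit_on_subset)
qed simp

text \<open>After J terms are split off, q^J g(\<alpha>) lies in the disc where W is holomorphic;
  the split terms are rational functions of g.\<close>

lemma W_comp_meromorphic:
  assumes j: "1 \<le> j" and g: "g analytic_on {\<alpha>}"
  shows "(\<lambda>z. W j k (g z)) meromorphic_on {\<alpha>}"
proof -
  obtain J where J: "absval (q ^ J * g \<alpha>) < 1 / 2"
    using ex_small_power[of "1/2" "g \<alpha>"] by auto
  have "W j k analytic_on ball 0 (1 / 2)"
    using W_holomorphic[OF j] by (simp add: analytic_on_open)
  then have "(W j k \<circ> (\<lambda>z. q ^ J * g z)) analytic_on {\<alpha>}"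
    using J by (intro analytic_on_compose_gen[of _ _ _ "ball 0 (1 / 2)"] analytic_intros g) (auto simp: absval_eq_norm)
  then have "(\<lambda>z. W j k (q ^ J * g z)) meromorphic_on {\<alpha>}"
    by (intro analytic_on_imp_meromorphic_on) (simp add: o_def)
  then have "(\<lambda>z. (\<Sum>m<J. psi j k (q ^ Suc m * g z)) + W j k (q ^ J * g z)) meromorphic_on {\<alpha>}"
    unfolding psi_def using analytic_on_imp_meromorphic_on[OF g] by (intro meromorphic_intros)
  also have "(\<lambda>z. (\<Sum>m<J. psi j k (q ^ Suc m * g z)) + W j k (q ^ J * g z)) = (\<lambda>z. W j k (g z))"
    by (rule ext) (rule W_rec_sum[OF j, symmetric])
  finally show ?thesis .
qed

lemma zeta_q_meromorphic:
  assumes c: "c \<noteq> 0"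
  shows "(\<lambda>z. zeta_q q k (c * z)) meromorphic_on - {0}"
proof (subst meromorphic_on_meromorphic_at, intro ballI)
  fix \<alpha> :: complex assume "\<alpha> \<in> - {0}"
  then have \<alpha>: "\<alpha> \<noteq> 0" by simp
  have g: "(\<lambda>z. c * z) analytic_on {\<alpha>}" "(\<lambda>z. inverse (c * z)) analytic_on {\<alpha>}"
    using c \<alpha> by (auto intro!: analytic_intros)
  have "(\<lambda>z. psi k k (c * z) + W (max 1 k) k (c * z) + (-1) ^ (k + 1) * W 1 k (inverse (c * z))) meromorphic_on {\<alpha>}"
    by (intro meromorphic_on_add meromorphic_on_mult meromorphic_on_const W_comp_meromorphic g, unfold psi_def)
       (auto intro!: meromorphic_intros)
  moreover have "\<forall>\<^sub>F z in at \<alpha>. z \<noteq> 0" using eventually_at_not_in_finite[of "{0}" \<alpha>] by simp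
  then have "\<forall>\<^sub>F z in at \<alpha>. zeta_q q k (c * z) =
      psi k k (c * z) + W (max 1 k) k (c * z) + (-1) ^ (k + 1) * W 1 k (inverse (c * z))"
    by eventually_elim (rule zeta_q_eq, use c in auto)
  ultimately show "(\<lambda>z. zeta_q q k (c * z)) meromorphic_on {\<alpha>}"
    by (subst meromorphic_on_cong[of "{\<alpha>}", OF _ refl]) auto
qed

lemma complex_mero_setting: "mero_setting q complex_meromorphic"
proof
  fix f g :: "complex \<Rightarrow> complex" and \<alpha> c d :: complex and a b :: real and k :: nat
  show "f \<in> complex_meromorphic \<Longrightarrow> \<alpha> \<noteq> 0 \<Longrightarrow> \<exists>c. polar_expansion f \<alpha> c"
    unfolding complex_meromorphic_def
    by (auto intro!: complex_polar_expansion_exists intro: meromorphic_on_subset)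
  show "f \<in> complex_meromorphic \<Longrightarrow> 0 < a \<Longrightarrow> finite {\<alpha>. a \<le> absval \<alpha> \<and> absval \<alpha> \<le> b \<and> \<not> bdd_near f \<alpha>}"
    unfolding complex_meromorphic_def by (auto intro!: complex_finite_poles)
  show "f \<in> complex_meromorphic \<Longrightarrow> (\<And>\<alpha>. \<alpha> \<noteq> 0 \<Longrightarrow> bdd_near f \<alpha>) \<Longrightarrow>
      mero_eq (\<lambda>z. f (q * z)) (\<lambda>z. f z + d) \<Longrightarrow> d = 0 \<and> (\<exists>c. mero_eq f (\<lambda>_. c))"
    using complex_liouville[of f q d] q unfolding complex_meromorphic_def by auto
  show "f \<in> complex_meromorphic \<Longrightarrow> g \<in> complex_meromorphic \<Longrightarrow> (\<lambda>z. f z + g z) \<in> complex_meromorphic"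
    unfolding complex_meromorphic_def by (auto intro!: meromorphic_intros)
  show "f \<in> complex_meromorphic \<Longrightarrow> (\<lambda>z. c * f z) \<in> complex_meromorphic"
    unfolding complex_meromorphic_def by (auto intro!: meromorphic_intros)
  show "c \<noteq> 0 \<Longrightarrow> (\<lambda>z. zeta_q q k (c * z)) \<in> complex_meromorphic"
    unfolding complex_meromorphic_def by (simp add: zeta_q_meromorphic)
qed

end

section \<open>Laurent series over non-Archimedean fields\<close>

lemma absval_add_le:
  fixes x y :: "'a::nonarch_valued_field"
  shows "absval x \<le> C \<Longrightarrow> absval y \<le> C \<Longrightarrow> absval (x + y) \<le> C"
  using ultrametric[of x y] by (simp add: absval_def)

lemma absval_diff_le:
  fixes x y :: "'a::nonarch_valued_field"
  shows "absval x \<le> C \<Longrightarrow> absval y \<le> C \<Longrightarrow> absval (x - y) \<le> C"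
  using absval_add_le[of x C "- y"] by simp

lemma absval_sum_le_bound:
  fixes f :: "'b \<Rightarrow> 'a::nonarch_valued_field"
  assumes "0 \<le> C" "\<And>x. x \<in> A \<Longrightarrow> absval (f x) \<le> C"
  shows "absval (sum f A) \<le> C"
  using assms by (induction A rule: infinite_finite_induct) (auto intro: absval_add_le)

text \<open>The ultrametric bound passes from finite sums to their limit; a sum that does not exist
  is 0 by convention, and 0 \<le> C.\<close>

lemma absval_infsum_le_bound:
  fixes f :: "'b \<Rightarrow> 'a::nonarch_valued_field"
  assumes "0 \<le> C" "\<And>x. x \<in> A \<Longrightarrow> absval (f x) \<le> C"
  shows "absval (infsum f A) \<le> C"
proof (cases "f summable_on A")
  case True
  then have "((\<lambda>F. absval (sum f F)) \<longlongrightarrow> absval (infsum f A)) (finite_subsets_at_top A)"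
    using has_sum_infsum unfolding has_sum_def by (intro tendsto_absval)
  then show ?thesis
    by (rule tendsto_upperbound)
       (auto intro!: eventually_finite_subsets_at_top_weakI absval_sum_le_bound assms)
qed (simp add: infsum_not_exists assms(1))

text \<open>The Gauss norm of u at radius r is at most C. Keeping the bound as a parameter avoids
  suprema, and r may be any positive real, not only the absolute value of a point.\<close>

definition gauss_le :: "real \<Rightarrow> real \<Rightarrow> (int \<Rightarrow> 'a::valued_field) \<Rightarrow> bool" where
  "gauss_le r C u \<longleftrightarrow> (\<forall>n. absval (u n) * r powi n \<le> C)"

text \<open>
  Boundedness at both radii gives geometric decay, and hence convergence, strictly in between.
\<close>

definition laurent_bounded :: "real \<Rightarrow> real \<Rightarrow> (int \<Rightarrow> 'a::valued_field) \<Rightarrow> bool" where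
  "laurent_bounded a b u \<longleftrightarrow> (\<exists>C. gauss_le a C u \<and> gauss_le b C u)"

lemma gauss_leD: "gauss_le r C u \<Longrightarrow> absval (u n) * r powi n \<le> C"
  by (simp add: gauss_le_def)

lemma gauss_le_mono: "gauss_le r C u \<Longrightarrow> C \<le> D \<Longrightarrow> gauss_le r D u"
  unfolding gauss_le_def using order.trans by blast

lemma gauss_le_nonneg: "gauss_le r C u \<Longrightarrow> 0 < r \<Longrightarrow> 0 \<le> C"
  using gauss_leD[of r C u 0] by (metis absval_nonneg mult.right_neutral order.trans power_int_0_right)

text \<open>The maximum principle for Gauss norms: r^n is at most b^n for n \<ge> 0 and at most a^n
  for n < 0.\<close>

lemma gauss_le_between:
  assumes "gauss_le a C u" "gauss_le b C u" "0 < a" "a \<le> r" "r \<le> b"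
  shows "gauss_le r C u"
  unfolding gauss_le_def
proof
  fix n
  show "absval (u n) * r powi n \<le> C"
  proof (cases "n \<ge> 0")
    case True
    then have "r powi n \<le> b powi n" using assms by (intro power_int_mono) auto
    then show ?thesis
      using gauss_leD[OF assms(2), of n] by (meson absval_nonneg mult_left_mono order.trans)
  next
    case False
    then have "r powi n \<le> a powi n" using assms by (intro power_int_antimono) auto
    then show ?thesis
      using gauss_leD[OF assms(1), of n] by (meson absval_nonneg mult_left_mono order.trans)
  qed
qed

lemma laurent_boundedE:
  assumes "laurent_bounded a b u" "0 < a"
  obtains C where "0 \<le> C" "gauss_le a C u" "gauss_le b C u"
  using assms gauss_le_nonneg unfolding laurent_bounded_def by blast

lemma laurent_boundedI:
  assumes "gauss_le a C u" "gauss_le b D u"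
  shows "laurent_bounded a b u"
  unfolding laurent_bounded_def
  using gauss_le_mono[OF assms(1), of "max C D"] gauss_le_mono[OF assms(2), of "max C D"] by auto

lemma laurent_bounded_subset:
  assumes "laurent_bounded a b u" "0 < a" "a \<le> a'" "a' \<le> b" "a \<le> b'" "b' \<le> b"
  shows "laurent_bounded a' b' u"
proof -
  obtain C where "gauss_le a C u" "gauss_le b C u" using assms(1,2) by (rule laurent_boundedE)
  then show ?thesis
    using gauss_le_between[of a C u b a'] gauss_le_between[of a C u b b'] assms
    by (intro laurent_boundedI[of _ C _ _ C]) auto
qed

text \<open>The ratios r/b and a/r govern the decay of the terms of positive and of negative
  degree.\<close>

lemma gauss_le_decay:
  assumes "gauss_le a C u" "gauss_le b C u" "0 < a" "a < r" "r < b"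
  obtains \<theta> where "0 \<le> \<theta>" "\<theta> < 1" "\<And>n. absval (u n) * r powi n \<le> C * \<theta> ^ nat \<bar>n\<bar>"
proof (rule that[of "max (a / r) (r / b)"])
  show "0 \<le> max (a / r) (r / b)" "max (a / r) (r / b) < 1"
    using assms by (auto simp: le_max_iff_disj)
  have C: "0 \<le> C" using assms gauss_le_nonneg by blast
  fix n
  let ?m = "nat \<bar>n\<bar>"
  show "absval (u n) * r powi n \<le> C * max (a / r) (r / b) ^ ?m"
  proof (cases "n \<ge> 0")
    case True
    then have "r powi n = b powi n * (r / b) ^ ?m"
      using assms by (simp add: power_int_def power_divide)
    then have "absval (u n) * r powi n \<le> C * (r / b) ^ ?m"
      using gauss_leD[OF assms(2), of n] assms by (simp add: mult.assoc[symmetric] mult_right_mono)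
    also have "\<dots> \<le> C * max (a / r) (r / b) ^ ?m"
      using C assms by (intro mult_left_mono power_mono) auto
    finally show ?thesis .
  next
    case False
    then have "r powi n = a powi n * (a / r) ^ ?m"
      using assms by (simp add: power_int_def power_divide field_simps)
    then have "absval (u n) * r powi n \<le> C * (a / r) ^ ?m"
      using gauss_leD[OF assms(1), of n] assms by (simp add: mult.assoc[symmetric] mult_right_mono)
    also have "\<dots> \<le> C * max (a / r) (r / b) ^ ?m"
      using C assms by (intro mult_left_mono power_mono) auto
    finally show ?thesis .
  qed
qed

lemma laurent_has_sum:
  fixes u :: "int \<Rightarrow> 'a::{valued_field,complete_space}"
  assumes "laurent_bounded a b u" "0 < a" "a < absval z" "absval z < b"
  shows "((\<lambda>n. u n * z powi n) has_sum laurent_sum u z) UNIV"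
proof -
  obtain C where C: "gauss_le a C u" "gauss_le b C u" using assms(1,2) by (rule laurent_boundedE)
  obtain \<theta> where \<theta>: "0 \<le> \<theta>" "\<theta> < 1" "\<And>n. absval (u n) * absval z powi n \<le> C * \<theta> ^ nat \<bar>n\<bar>"
    using gauss_le_decay[OF C assms(2-4)] by blast
  have "(\<lambda>n. u n * z powi n) summable_on UNIV"
    by (rule absval_summable_on_comparison[OF summable_on_int_geometric[OF \<theta>(1,2)]])
       (use \<theta>(3) in \<open>simp add: absval_mult absval_powi\<close>)
  then show ?thesis unfolding laurent_sum_def by (rule has_sum_infsum)
qed

lemma absval_laurent_sum_le:
  fixes u :: "int \<Rightarrow> 'a::{nonarch_valued_field,complete_space}"
  assumes "gauss_le a C u" "gauss_le b C u" "0 < a" "a \<le> absval z" "absval z \<le> b"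
  shows "absval (laurent_sum u z) \<le> C"
  unfolding laurent_sum_def
  by (rule absval_infsum_le_bound)
     (use assms gauss_le_nonneg gauss_leD[OF gauss_le_between[OF assms]] in \<open>auto simp: absval_mult absval_powi\<close>)

lemma gauss_le_add:
  fixes u v :: "int \<Rightarrow> 'a::nonarch_valued_field"
  assumes "gauss_le r C u" "gauss_le r C v" "0 < r"
  shows "gauss_le r C (\<lambda>n. u n + v n)"
  unfolding gauss_le_def
proof
  fix n
  have "absval (u n + v n) \<le> C / r powi n"
    using gauss_leD[OF assms(1), of n] gauss_leD[OF assms(2), of n] assms(3)
    by (intro absval_add_le) (simp_all add: pos_le_divide_eq)
  then show "absval (u n + v n) * r powi n \<le> C"
    using assms(3) by (simp add: pos_le_divide_eq)
qed

lemma gauss_le_cmult: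
  assumes "gauss_le r C u"
  shows "gauss_le r (absval c * C) (\<lambda>n. c * u n)"
  using assms unfolding gauss_le_def by (auto simp: absval_mult mult.assoc intro!: mult_left_mono)

lemma gauss_le_uminus [simp]: "gauss_le r C (\<lambda>n. - u n) \<longleftrightarrow> gauss_le r C u"
  by (simp add: gauss_le_def)

lemma gauss_le_diff:
  fixes u v :: "int \<Rightarrow> 'a::nonarch_valued_field"
  assumes "gauss_le r C u" "gauss_le r C v" "0 < r"
  shows "gauss_le r C (\<lambda>n. u n - v n)"
  using gauss_le_add[of r C u "\<lambda>n. - v n"] assms by simp

lemma laurent_bounded_add:
  fixes u v :: "int \<Rightarrow> 'a::nonarch_valued_field"
  assumes "laurent_bounded a b u" "laurent_bounded a b v" "0 < a" "0 < b"
  shows "laurent_bounded a b (\<lambda>n. u n + v n)"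
proof -
  obtain C D where "gauss_le a C u" "gauss_le b C u" "gauss_le a D v" "gauss_le b D v"
    using assms unfolding laurent_bounded_def by blast
  then have "gauss_le r (max C D) (\<lambda>n. u n + v n)" if "r \<in> {a, b}" for r
    using that assms by (intro gauss_le_add; blast intro: gauss_le_mono max.cobounded1 max.cobounded2)
  then show ?thesis by (intro laurent_boundedI) auto
qed

lemma laurent_bounded_cmult:
  assumes "laurent_bounded a b u"
  shows "laurent_bounded a b (\<lambda>n. c * u n)"
  using assms gauss_le_cmult unfolding laurent_bounded_def by blast

lemma laurent_bounded_diff:
  fixes u v :: "int \<Rightarrow> 'a::nonarch_valued_field"
  assumes "laurent_bounded a b u" "laurent_bounded a b v" "0 < a" "0 < b"
  shows "laurent_bounded a b (\<lambda>n. u n - v n)"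
  using laurent_bounded_add[OF assms(1) laurent_bounded_cmult[OF assms(2), of "-1"] assms(3,4)] by simp

lemma laurent_sum_eqI:
  fixes u :: "int \<Rightarrow> 'a::{valued_field,complete_space}"
  shows "((\<lambda>n. u n * z powi n) has_sum s) UNIV \<Longrightarrow> laurent_sum u z = s"
  unfolding laurent_sum_def by (rule infsumI)

lemma laurent_sum_add:
  fixes u v :: "int \<Rightarrow> 'a::{valued_field,complete_space}"
  assumes "laurent_bounded a b u" "laurent_bounded a b v" "0 < a" "a < absval z" "absval z < b"
  shows "laurent_sum (\<lambda>n. u n + v n) z = laurent_sum u z + laurent_sum v z"
  using has_sum_add[OF laurent_has_sum[OF assms(1,3-5)] laurent_has_sum[OF assms(2,3-5)]]
  by (intro laurent_sum_eqI) (simp add: distrib_right)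

lemma laurent_sum_cmult:
  fixes u :: "int \<Rightarrow> 'a::{valued_field,complete_space}"
  assumes "laurent_bounded a b u" "0 < a" "a < absval z" "absval z < b"
  shows "laurent_sum (\<lambda>n. c * u n) z = c * laurent_sum u z"
  using has_sum_cmult_right[OF laurent_has_sum[OF assms], of c]
  by (intro laurent_sum_eqI) (simp add: mult.assoc)

lemma laurent_sum_diff:
  fixes u v :: "int \<Rightarrow> 'a::{valued_field,complete_space}"
  assumes "laurent_bounded a b u" "laurent_bounded a b v" "0 < a" "a < absval z" "absval z < b"
  shows "laurent_sum (\<lambda>n. u n - v n) z = laurent_sum u z - laurent_sum v z"
  using laurent_sum_add[OF assms(1) laurent_bounded_cmult[OF assms(2), of "-1"] assms(3-5)]
    laurent_sum_cmult[OF assms(2-5), of "-1"] by simp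

subsection \<open>Finite Laurent series\<close>

lemma laurent_bounded_finite:
  assumes "finite {n. u n \<noteq> 0}"
  shows "laurent_bounded a b u"
proof -
  have "gauss_le r (Max (insert 0 ((\<lambda>n. absval (u n) * r powi n) ` {n. u n \<noteq> 0}))) u" for r
    unfolding gauss_le_def
  proof
    fix n
    show "absval (u n) * r powi n \<le> Max (insert 0 ((\<lambda>n. absval (u n) * r powi n) ` {n. u n \<noteq> 0}))"
      using assms by (cases "u n = 0") (auto intro!: Max_ge)
  qed
  then show ?thesis by (blast intro: laurent_boundedI)
qed

lemma laurent_sum_finite:
  fixes u :: "int \<Rightarrow> 'a::{valued_field,complete_space}"
  assumes "finite A" "\<And>n. n \<notin> A \<Longrightarrow> u n = 0"
  shows "laurent_sum u z = (\<Sum>n\<in>A. u n * z powi n)"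
proof (rule laurent_sum_eqI)
  have "((\<lambda>n. u n * z powi n) has_sum (\<Sum>n\<in>A. u n * z powi n)) A"
    using assms(1) by (rule has_sum_finite)
  then show "((\<lambda>n. u n * z powi n) has_sum (\<Sum>n\<in>A. u n * z powi n)) UNIV"
    by (rule has_sum_cong_neutral[THEN iffD1, rotated -1]) (use assms(2) in auto)
qed

definition laurent_monom :: "'a::zero \<Rightarrow> int \<Rightarrow> int \<Rightarrow> 'a" where
  "laurent_monom c m = (\<lambda>n. if n = m then c else 0)"

lemma laurent_bounded_monom [simp]: "laurent_bounded a b (laurent_monom c m)"
  by (rule laurent_bounded_finite) (rule finite_subset[of _ "{m}"], auto simp: laurent_monom_def)

lemma laurent_sum_monom [simp]:
  "laurent_sum (laurent_monom c m) z = c * z powi m" for z :: "'a::{valued_field,complete_space}"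
  by (subst laurent_sum_finite[of "{m}"]) (auto simp: laurent_monom_def)

subsection \<open>Products\<close>

definition conv :: "(int \<Rightarrow> 'a::valued_field) \<Rightarrow> (int \<Rightarrow> 'a) \<Rightarrow> int \<Rightarrow> 'a" where
  "conv u v n = (\<Sum>\<^sub>\<infinity>m. u m * v (n - m))"

text \<open>At a radius r strictly between a and b the terms of u decay geometrically while those of
  v stay bounded, and r^m r^(n-m) does not depend on m. The midpoint serves as r.\<close>

lemma conv_has_sum:
  fixes u v :: "int \<Rightarrow> 'a::{valued_field,complete_space}"
  assumes u: "laurent_bounded a b u" and v: "laurent_bounded a b v" and ab: "0 < a" "a < b"
  shows "((\<lambda>m. u m * v (n - m)) has_sum conv u v n) UNIV"
proof -
  obtain C where C: "0 \<le> C" "gauss_le a C u" "gauss_le b C u" using u ab(1) by (rule laurent_boundedE)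
  obtain D where D: "0 \<le> D" "gauss_le a D v" "gauss_le b D v" using v ab(1) by (rule laurent_boundedE)
  define r where "r = (a + b) / 2"
  have r: "a < r" "r < b" "0 < r" using ab by (auto simp: r_def)
  obtain \<theta> where \<theta>: "0 \<le> \<theta>" "\<theta> < 1" "\<And>n. absval (u n) * r powi n \<le> C * \<theta> ^ nat \<bar>n\<bar>"
    using gauss_le_decay[OF C(2,3) ab(1) r(1,2)] by blast
  have "(\<lambda>m. u m * v (n - m)) summable_on UNIV"
  proof (rule absval_summable_on_comparison[OF summable_on_int_geometric[OF \<theta>(1,2)]])
    fix m
    have "absval (v (n - m)) * r powi (n - m) \<le> D"
      using gauss_leD[OF gauss_le_between[OF D(2,3) ab(1)]] r by simp
    then have "(absval (u m) * r powi m) * (absval (v (n - m)) * r powi (n - m)) \<le> (C * \<theta> ^ nat \<bar>m\<bar>) * D"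
      using \<theta>(1) C(1) r by (intro mult_mono[OF \<theta>(3)]) auto
    also have "(absval (u m) * r powi m) * (absval (v (n - m)) * r powi (n - m)) = absval (u m * v (n - m)) * r powi n"
      using r by (simp add: absval_mult power_int_diff)
    finally show "absval (u m * v (n - m)) \<le> C * D / r powi n * \<theta> ^ nat \<bar>m\<bar>"
      using r by (simp add: pos_le_divide_eq mult_ac)
  qed
  then show ?thesis unfolding conv_def by (rule has_sum_infsum)
qed

text \<open>Submultiplicativity of the Gauss norm. By the ultrametric inequality infinitely many
  terms cost no factor, so the bound is available at the boundary radii as well.\<close>

lemma gauss_le_conv:
  fixes u v :: "int \<Rightarrow> 'a::nonarch_valued_field"
  assumes "gauss_le r C u" "gauss_le r D v" "0 < r"
  shows "gauss_le r (C * D) (conv u v)"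
  unfolding gauss_le_def
proof
  fix n
  have C: "0 \<le> C" "0 \<le> D" using assms gauss_le_nonneg by blast+
  have "absval (conv u v n) \<le> C * D / r powi n"
    unfolding conv_def
  proof (rule absval_infsum_le_bound)
    fix m
    have "(absval (u m) * r powi m) * (absval (v (n - m)) * r powi (n - m)) \<le> C * D"
      using gauss_leD[OF assms(1)] gauss_leD[OF assms(2)] C assms(3) by (intro mult_mono) auto
    also have "(absval (u m) * r powi m) * (absval (v (n - m)) * r powi (n - m)) = absval (u m * v (n - m)) * r powi n"
      using assms(3) by (simp add: absval_mult power_int_diff)
    finally show "absval (u m * v (n - m)) \<le> C * D / r powi n"
      using assms(3) by (simp add: pos_le_divide_eq)
  qed (use C assms(3) in auto)
  then show "absval (conv u v n) * r powi n \<le> C * D"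
    using assms(3) by (simp add: pos_le_divide_eq)
qed

lemma laurent_bounded_conv:
  fixes u v :: "int \<Rightarrow> 'a::nonarch_valued_field"
  assumes "laurent_bounded a b u" "laurent_bounded a b v" "0 < a" "0 < b"
  shows "laurent_bounded a b (conv u v)"
  using assms gauss_le_conv unfolding laurent_bounded_def by blast

text \<open>The double family of products of terms is dominated by a product of two geometric
  families. It may thus be summed by rows, which gives the product of the sums, or along m + k = n,
  which gives the convolution.\<close>

lemma laurent_sum_conv:
  fixes u v :: "int \<Rightarrow> 'a::{nonarch_valued_field,complete_space}"
  assumes u: "laurent_bounded a b u" and v: "laurent_bounded a b v"
    and z: "0 < a" "a < absval z" "absval z < b"
  shows "laurent_sum (conv u v) z = laurent_sum u z * laurent_sum v z"
proof -
  have z0: "z \<noteq> 0" using z by auto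
  obtain C where C: "0 \<le> C" "gauss_le a C u" "gauss_le b C u" using u z(1) by (rule laurent_boundedE)
  obtain D where D: "0 \<le> D" "gauss_le a D v" "gauss_le b D v" using v z(1) by (rule laurent_boundedE)
  obtain \<theta> where \<theta>: "0 \<le> \<theta>" "\<theta> < 1" "\<And>n. absval (u n) * absval z powi n \<le> C * \<theta> ^ nat \<bar>n\<bar>"
    using gauss_le_decay[OF C(2,3) z] by blast
  obtain \<eta> where \<eta>: "0 \<le> \<eta>" "\<eta> < 1" "\<And>n. absval (v n) * absval z powi n \<le> D * \<eta> ^ nat \<bar>n\<bar>"
    using gauss_le_decay[OF D(2,3) z] by blast
  define F where "F = (\<lambda>(m, k). (u m * z powi m) * (v k * z powi k))"
  define S where "S = infsum F UNIV"
  have "F summable_on UNIV"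
  proof (rule absval_summable_on_comparison)
    show "(\<lambda>(m, k). (C * \<theta> ^ nat \<bar>m\<bar>) * (D * \<eta> ^ nat \<bar>k\<bar>)) summable_on (UNIV :: (int \<times> int) set)"
      unfolding UNIV_Times_UNIV[symmetric]
    proof (rule summable_on_SigmaI)
      fix m :: int
      show "((\<lambda>k. case (m, k) of (m, k) \<Rightarrow> (C * \<theta> ^ nat \<bar>m\<bar>) * (D * \<eta> ^ nat \<bar>k\<bar>)) has_sum
          (C * \<theta> ^ nat \<bar>m\<bar>) * (\<Sum>\<^sub>\<infinity>k::int. D * \<eta> ^ nat \<bar>k\<bar>)) UNIV"
        using summable_on_int_geometric[OF \<eta>(1,2), of D] by (auto intro!: has_sum_cmult_right)
    next
      show "(\<lambda>m::int. (C * \<theta> ^ nat \<bar>m\<bar>) * (\<Sum>\<^sub>\<infinity>k::int. D * \<eta> ^ nat \<bar>k\<bar>)) summable_on UNIV"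
        using summable_on_int_geometric[OF \<theta>(1,2), of C] by (rule summable_on_cmult_left)
    qed (use C D \<theta> \<eta> in auto)
    fix x :: "int \<times> int"
    obtain m k where x: "x = (m, k)" by (cases x) auto
    have "absval (F x) = (absval (u m) * absval z powi m) * (absval (v k) * absval z powi k)"
      by (simp add: x F_def absval_mult absval_powi)
    also have "\<dots> \<le> (C * \<theta> ^ nat \<bar>m\<bar>) * (D * \<eta> ^ nat \<bar>k\<bar>)"
      using \<theta>(1) C by (intro mult_mono[OF \<theta>(3) \<eta>(3)]) auto
    finally show "absval (F x) \<le> (case x of (m, k) \<Rightarrow> (C * \<theta> ^ nat \<bar>m\<bar>) * (D * \<eta> ^ nat \<bar>k\<bar>))"
      by (simp add: x)
  qed
  then have FS: "(F has_sum S) (UNIV \<times> UNIV)"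
    unfolding S_def UNIV_Times_UNIV by (rule has_sum_infsum)
  have "((\<lambda>m. (u m * z powi m) * laurent_sum v z) has_sum S) UNIV"
    by (rule has_sum_Sigma'[OF FS]) (auto simp: F_def intro!: has_sum_cmult_right laurent_has_sum[OF v z])
  then have S: "S = laurent_sum u z * laurent_sum v z"
    using has_sum_cmult_left[OF laurent_has_sum[OF u z], of "laurent_sum v z"] has_sum_unique by blast
  have bij: "bij_betw (\<lambda>(n, m). (m, n - m)) (UNIV \<times> UNIV) (UNIV \<times> (UNIV :: int set))"
    by (rule bij_betwI[of _ _ _ "\<lambda>(m, k). (m + k, m)"]) auto
  have FS': "((\<lambda>x. F ((\<lambda>(n, m). (m, n - m)) x)) has_sum S) (UNIV \<times> UNIV)"
    using has_sum_reindex_bij_betw[OF bij, of F S] FS by blast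
  have "((\<lambda>m. F ((\<lambda>(n, m). (m, n - m)) (n, m))) has_sum conv u v n * z powi n) UNIV" for n
  proof -
    have "((\<lambda>m. u m * v (n - m) * z powi n) has_sum conv u v n * z powi n) UNIV"
      using z by (intro has_sum_cmult_left conv_has_sum[OF u v]) auto
    also have "(\<lambda>m. u m * v (n - m) * z powi n) = (\<lambda>m. F ((\<lambda>(n, m). (m, n - m)) (n, m)))"
      using z0 by (simp add: F_def fun_eq_iff power_int_diff)
    finally show ?thesis .
  qed
  then have "((\<lambda>n. conv u v n * z powi n) has_sum S) UNIV"
    by (intro has_sum_Sigma'[OF FS'])
  then show ?thesis unfolding S by (rule laurent_sum_eqI)
qed

lemma conv_add_left:
  fixes u v w :: "int \<Rightarrow> 'a::{valued_field,complete_space}"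
  assumes "laurent_bounded a b u" "laurent_bounded a b v" "laurent_bounded a b w" "0 < a" "a < b"
  shows "conv (\<lambda>n. u n + v n) w n = conv u w n + conv v w n"
proof -
  have "((\<lambda>m. u m * w (n - m) + v m * w (n - m)) has_sum (conv u w n + conv v w n)) UNIV"
    using assms by (intro has_sum_add conv_has_sum[of a b])
  then show ?thesis unfolding conv_def[of "\<lambda>n. u n + v n"] by (intro infsumI) (simp add: distrib_right)
qed

lemma conv_add_right:
  fixes u v w :: "int \<Rightarrow> 'a::{valued_field,complete_space}"
  assumes "laurent_bounded a b u" "laurent_bounded a b v" "laurent_bounded a b w" "0 < a" "a < b"
  shows "conv u (\<lambda>n. v n + w n) n = conv u v n + conv u w n"
proof -
  have "((\<lambda>m. u m * v (n - m) + u m * w (n - m)) has_sum (conv u v n + conv u w n)) UNIV"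
    using assms by (intro has_sum_add conv_has_sum[of a b])
  then show ?thesis unfolding conv_def[of u "\<lambda>n. v n + w n"] by (intro infsumI) (simp add: distrib_left)
qed

lemma conv_monom_left: "conv (laurent_monom c k) v n = c * v (n - k)"
  for v :: "int \<Rightarrow> 'a::{valued_field,complete_space}"
proof -
  have "((\<lambda>m. laurent_monom c k m * v (n - m)) has_sum (c * v (n - k))) {k}"
    by (rule has_sum_finiteI) (auto simp: laurent_monom_def)
  then have "((\<lambda>m. laurent_monom c k m * v (n - m)) has_sum (c * v (n - k))) UNIV"
    by (rule has_sum_cong_neutral[THEN iffD1, rotated -1]) (auto simp: laurent_monom_def)
  then show ?thesis unfolding conv_def by (rule infsumI)
qed

subsection \<open>Dominant terms\<close>

lemma powi_eq_exp: "0 < r \<Longrightarrow> r powi k = exp (of_int k * ln r)" for r :: real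
  by (simp add: powr_real_of_int'[symmetric] powr_def)

text \<open>Two given terms tie at one radius at most, and there are countably many pairs, so the
  interval contains a radius without ties. Decay of the terms makes the maximum exist there.\<close>

lemma exists_dominant:
  fixes v :: "int \<Rightarrow> 'a::valued_field"
  assumes v: "laurent_bounded a b v" "v n1 \<noteq> 0" and ab: "0 < a" "a \<le> x" "x < y" "y \<le> b"
  obtains r N \<kappa> where "x < r" "r < y" "0 \<le> \<kappa>" "\<kappa> < 1" "v N \<noteq> 0"
    "\<And>n. n \<noteq> N \<Longrightarrow> absval (v n) * r powi n \<le> \<kappa> * (absval (v N) * r powi N)"
proof -
  define X where "X = (\<lambda>(m, n). {r. x < r \<and> r < y \<and> m \<noteq> n \<and> v m \<noteq> 0 \<and> v n \<noteq> 0 \<and>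
    absval (v m) * r powi m = absval (v n) * r powi n})"
  have "countable (X p)" for p
  proof -
    obtain m n where p: "p = (m, n)" by (cases p) auto
    have "r = r'" if "r \<in> X p" "r' \<in> X p" for r r'
    proof -
      have pos: "0 < r" "0 < r'" and mn: "m \<noteq> n" and nz: "v m \<noteq> 0" "v n \<noteq> 0"
        using that ab by (auto simp: X_def p)
      have "absval (v m) * r powi m = absval (v n) * r powi n" "absval (v m) * r' powi m = absval (v n) * r' powi n"
        using that by (auto simp: X_def p)
      then have "r powi (m - n) = absval (v n) / absval (v m)" "r' powi (m - n) = absval (v n) / absval (v m)"
        using pos nz by (simp_all add: power_int_diff field_simps)
      then have "exp (of_int (m - n) * ln r) = exp (of_int (m - n) * ln r')"
        using pos by (simp add: powi_eq_exp)
      then show "r = r'" using mn pos by simp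
    qed
    then have "X p = {} \<or> (\<exists>r. X p = {r})" by blast
    then show ?thesis by auto
  qed
  then have "countable (\<Union>p. X p)" by (intro countable_UN) auto
  moreover have "uncountable {x<..<y}" using ab by (simp add: uncountable_open_interval)
  ultimately have "\<not> {x<..<y} \<subseteq> (\<Union>p. X p)" using countable_subset by blast
  then obtain r where "r \<in> {x<..<y}" "r \<notin> (\<Union>p. X p)" by blast
  then have r: "x < r" "r < y" and inj: "\<And>m n. r \<notin> X (m, n)" by simp_all
  define w where "w n = absval (v n) * r powi n" for n
  have rpos: "0 < r" using ab r by simp
  obtain C where C: "gauss_le a C v" "gauss_le b C v" using v(1) ab(1) by (rule laurent_boundedE)
  have "0 \<le> C" using gauss_le_nonneg[OF C(1) ab(1)] .
  have "a < r" "r < b" using ab r by auto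
  then obtain \<theta> where \<theta>: "0 \<le> \<theta>" "\<theta> < 1" "\<And>n. w n \<le> C * \<theta> ^ nat \<bar>n\<bar>"
    unfolding w_def using gauss_le_decay[OF C ab(1)] by blast
  have fin: "finite {n. e \<le> w n}" if "0 < e" for e
  proof -
    have "(\<lambda>k. C * \<theta> ^ k) \<longlonglongrightarrow> C * 0"
      using \<theta> by (intro tendsto_mult tendsto_const LIMSEQ_realpow_zero) auto
    then have "\<forall>\<^sub>F k in sequentially. C * \<theta> ^ k < e"
      using that by (intro order_tendstoD) auto
    then obtain K where K: "\<And>k. k \<ge> K \<Longrightarrow> C * \<theta> ^ k < e"
      by (auto simp: eventually_sequentially)
    have "{n. e \<le> w n} \<subseteq> {- int K..int K}"
    proof
      fix n assume "n \<in> {n. e \<le> w n}"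
      then have "\<not> C * \<theta> ^ nat \<bar>n\<bar> < e" using \<theta>(3)[of n] by simp
      then have "\<not> K \<le> nat \<bar>n\<bar>" using K by blast
      then show "n \<in> {- int K..int K}" by auto
    qed
    then show ?thesis by (rule finite_subset) simp
  qed
  have wpos: "0 < w n \<longleftrightarrow> v n \<noteq> 0" "0 \<le> w n" for n
    using rpos by (auto simp: w_def zero_less_mult_iff)
  let ?A = "{n. w n1 \<le> w n}"
  have A: "finite ?A" "?A \<noteq> {}" using fin[of "w n1"] wpos v(2) by auto
  have "Max (w ` ?A) \<in> w ` ?A" using A by (intro Max_in) auto
  then obtain N where N: "N \<in> ?A" "w N = Max (w ` ?A)" by auto
  have wN: "w n1 \<le> w N" using N by simp
  then have "0 < w N" using wpos(1)[of n1] v(2) by linarith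
  have max: "w n \<le> w N" for n
  proof (cases "n \<in> ?A")
    case True then show ?thesis unfolding N(2) using A by (intro Max_ge) auto
  qed (use wN in auto)
  have strict: "w n < w N" if "n \<noteq> N" for n
  proof (rule ccontr)
    assume "\<not> w n < w N"
    then have eq: "w n = w N" using max[of n] by simp
    moreover have "v n \<noteq> 0" "v N \<noteq> 0" using wpos(1)[of n] wpos(1)[of N] eq \<open>0 < w N\<close> by simp_all
    ultimately show False using inj[of n N] r that by (simp add: X_def w_def)
  qed
  \<comment> \<open>Only finitely many competitors reach half of the maximum and the others are
    covered by 1/2, so a uniform \<kappa> < 1 is obtained as a finite maximum.\<close>
  define B where "B = {n. w N / 2 \<le> w n} - {N}"
  have B: "finite B" using fin[of "w N / 2"] \<open>0 < w N\<close> by (simp add: B_def)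
  define \<kappa> where "\<kappa> = Max (insert (1 / 2) ((\<lambda>n. w n / w N) ` B))"
  have "1 / 2 \<le> \<kappa>" unfolding \<kappa>_def using B by (intro Max_ge) auto
  moreover have "\<kappa> < 1"
    unfolding \<kappa>_def using B strict \<open>0 < w N\<close> by (subst Max_less_iff) (auto simp: B_def)
  moreover have "w n \<le> \<kappa> * w N" if "n \<noteq> N" for n
  proof (cases "n \<in> B")
    case True
    then have "w n / w N \<le> \<kappa>" unfolding \<kappa>_def using B by (intro Max_ge) auto
    then show ?thesis using \<open>0 < w N\<close> by (simp add: pos_divide_le_eq)
  next
    case False
    then have "w n \<le> 1 / 2 * w N" using that by (simp add: B_def)
    also have "\<dots> \<le> \<kappa> * w N" using \<open>1 / 2 \<le> \<kappa>\<close> \<open>0 < w N\<close> by (intro mult_right_mono) auto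
    finally show ?thesis .
  qed
  moreover have "v N \<noteq> 0" using wpos(1) \<open>0 < w N\<close> by blast
  ultimately show ?thesis using that[of r \<kappa> N] r by (simp add: w_def)
qed

subsection \<open>Division with remainder\<close>

text \<open>
  When \<open>v\<close> has a unique dominant term at both radii, of degree \<open>N0\<close> at \<open>a\<close> and \<open>N1\<close> at \<open>b\<close>,
  every series agrees with a multiple of \<open>v\<close> outside degrees \<open>N0, \<dots>, N1\<close>.  The approximate
  quotient divides the high part by the dominant term at \<open>b\<close> and the low part by the one at \<open>a\<close>;
  the error contracts with respect to the bounds \<open>C * A\<close> at \<open>a\<close> and \<open>C * B\<close> at \<open>b\<close>.
\<close>

locale laurent_division =
  fixes v :: "int \<Rightarrow> 'a::{nonarch_valued_field,complete_space}"
    and a b \<kappa> :: real and N0 N1 :: int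
  assumes ab: "0 < a" "a < b" and \<kappa>: "0 \<le> \<kappa>" "\<kappa> < 1"
    and nz: "v N0 \<noteq> 0" "v N1 \<noteq> 0"
    and dom_a: "n \<noteq> N0 \<Longrightarrow> absval (v n) * a powi n \<le> \<kappa> * (absval (v N0) * a powi N0)"
    and dom_b: "n \<noteq> N1 \<Longrightarrow> absval (v n) * b powi n \<le> \<kappa> * (absval (v N1) * b powi N1)"
begin

text \<open>A and B are the Gauss norms of v at the two radii. The contraction factor L collects the
  two sources of gain: \<kappa> from the non-dominant terms of v, and a/b from carrying a bound to
  the opposite radius.\<close>

definition "A = absval (v N0) * a powi N0"
definition "B = absval (v N1) * b powi N1"
definition "L = max \<kappa> (a / b)"

lemma AB_pos: "0 < A" "0 < B"
  using ab nz by (auto simp: A_def B_def)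

lemma b_pos: "0 < b" using ab by simp

lemma L: "0 \<le> L" "L < 1" "\<kappa> \<le> L" "a / b \<le> L"
  using ab \<kappa> by (auto simp: L_def)

lemma gauss_v: "gauss_le a A v" "gauss_le b B v"
proof -
  have "absval (v n) * a powi n \<le> A" for n
  proof (cases "n = N0")
    case False
    have "\<kappa> * A \<le> 1 * A" using AB_pos \<kappa> by (intro mult_right_mono) auto
    then show ?thesis using dom_a[OF False] by (simp add: A_def)
  qed (simp add: A_def)
  then show "gauss_le a A v" by (simp add: gauss_le_def)
  have "absval (v n) * b powi n \<le> B" for n
  proof (cases "n = N1")
    case False
    have "\<kappa> * B \<le> 1 * B" using AB_pos \<kappa> by (intro mult_right_mono) auto
    then show ?thesis using dom_b[OF False] by (simp add: B_def)
  qed (simp add: B_def)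
  then show "gauss_le b B v" by (simp add: gauss_le_def)
qed

lemma bounded_v: "laurent_bounded a b v"
  using gauss_v by (rule laurent_boundedI)

lemma gauss_upd:
  "gauss_le a (\<kappa> * A) (v(N0 := 0))" "gauss_le b B (v(N0 := 0))"
  "gauss_le b (\<kappa> * B) (v(N1 := 0))" "gauss_le a A (v(N1 := 0))"
  using gauss_v dom_a dom_b \<kappa> AB_pos by (auto simp: gauss_le_def A_def B_def)

text \<open>Convexity of the Newton polygon: the dominant degree grows with the radius. Multiplying
  the two domination bounds gives (b/a)^(N0 - N1) \<le> 1.\<close>

lemma N0_le_N1: "N0 \<le> N1"
proof (rule ccontr)
  assume "\<not> N0 \<le> N1"
  then have "1 < (b / a) powi (N0 - N1)"
    using ab by (intro one_less_power_int) auto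
  moreover have "(absval (v N1) * a powi N1) * (absval (v N0) * b powi N0) \<le> A * B"
    using gauss_leD[OF gauss_v(1)] gauss_leD[OF gauss_v(2)] AB_pos ab by (intro mult_mono) auto
  then have "a powi N1 * b powi N0 \<le> a powi N0 * b powi N1"
    using nz by (simp add: A_def B_def mult_ac)
  then have "(b / a) powi (N0 - N1) \<le> 1"
    using ab by (simp add: power_int_diff power_int_divide_distrib field_simps)
  ultimately show False by simp
qed

text \<open>Index m belongs to degree m + N1 of F, so m \<ge> 1 is the part above the window;
  \<open>lo\<close> mirrors this below N0. That m is never 0 yields the factor a/b at the opposite
  radius.\<close>

definition hi :: "(int \<Rightarrow> 'a) \<Rightarrow> int \<Rightarrow> 'a" where
  "hi F m = (if 1 \<le> m then F (m + N1) / v N1 else 0)"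

definition lo :: "(int \<Rightarrow> 'a) \<Rightarrow> int \<Rightarrow> 'a" where
  "lo F m = (if m \<le> - 1 then F (m + N0) / v N0 else 0)"

definition quo :: "(int \<Rightarrow> 'a) \<Rightarrow> int \<Rightarrow> 'a" where
  "quo F m = hi F m + lo F m"

text \<open>The error left after one approximate division. Coefficients of F inside the window are
  dropped, since they belong to the remainder; only degrees outside the window have to be
  matched.\<close>

definition step :: "(int \<Rightarrow> 'a) \<Rightarrow> int \<Rightarrow> 'a" where
  "step F n = (if N0 \<le> n \<and> n \<le> N1 then 0 else F n) - conv v (quo F) n"

definition small :: "real \<Rightarrow> (int \<Rightarrow> 'a) \<Rightarrow> bool" where
  "small C F \<longleftrightarrow> gauss_le a (C * A) F \<and> gauss_le b (C * B) F"

lemma gauss_hi: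
  assumes "small C F"
  shows "gauss_le b C (hi F)" "gauss_le a (C * (a / b)) (hi F)"
proof -
  have C: "0 \<le> C"
    using assms gauss_le_nonneg[of a "C * A" F] ab AB_pos by (auto simp: small_def zero_le_mult_iff)
  have b: "absval (hi F m) * b powi m \<le> C" for m
  proof (cases "1 \<le> m")
    case True
    have "absval (F (m + N1)) * b powi (m + N1) \<le> C * B"
      using assms gauss_leD unfolding small_def by blast
    then show ?thesis
      using True b_pos nz by (simp add: hi_def B_def absval_divide power_int_add field_simps)
  qed (simp add: hi_def C)
  then show "gauss_le b C (hi F)" by (simp add: gauss_le_def)
  have "absval (hi F m) * a powi m \<le> C * (a / b)" for m
  proof (cases "1 \<le> m")
    case True
    have "(a / b) powi m \<le> (a / b) powi 1"
      using True ab by (intro power_int_decreasing) auto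
    then have "(absval (hi F m) * b powi m) * (a / b) powi m \<le> C * (a / b)"
      using b[of m] C ab by (intro mult_mono) auto
    then show ?thesis using ab by (simp add: power_int_divide_distrib)
  qed (use ab C in \<open>simp add: hi_def\<close>)
  then show "gauss_le a (C * (a / b)) (hi F)" by (simp add: gauss_le_def)
qed

lemma gauss_lo:
  assumes "small C F"
  shows "gauss_le a C (lo F)" "gauss_le b (C * (a / b)) (lo F)"
proof -
  have C: "0 \<le> C"
    using assms gauss_le_nonneg[of a "C * A" F] ab AB_pos by (auto simp: small_def zero_le_mult_iff)
  have a: "absval (lo F m) * a powi m \<le> C" for m
  proof (cases "m \<le> - 1")
    case True
    have "absval (F (m + N0)) * a powi (m + N0) \<le> C * A"
      using assms gauss_leD unfolding small_def by blast
    then show ?thesis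
      using True ab nz by (simp add: lo_def A_def absval_divide power_int_add field_simps)
  qed (simp add: lo_def C)
  then show "gauss_le a C (lo F)" by (simp add: gauss_le_def)
  have "absval (lo F m) * b powi m \<le> C * (a / b)" for m
  proof (cases "m \<le> - 1")
    case True
    have "(a / b) powi (- m) \<le> (a / b) powi 1"
      using True ab by (intro power_int_decreasing) auto
    then have "(absval (lo F m) * a powi m) * (a / b) powi (- m) \<le> C * (a / b)"
      using a[of m] C ab by (intro mult_mono) auto
    then show ?thesis using ab by (simp add: power_int_divide_distrib power_int_minus field_simps)
  qed (use ab C in \<open>simp add: lo_def\<close>)
  then show "gauss_le b (C * (a / b)) (lo F)" by (simp add: gauss_le_def)
qed

lemma small_nonneg: "small C F \<Longrightarrow> 0 \<le> C"
  using gauss_le_nonneg[OF gauss_hi(1)] b_pos by blast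

lemma gauss_quo:
  assumes "small C F"
  shows "gauss_le a C (quo F)" "gauss_le b C (quo F)"
proof -
  have "C * (a / b) \<le> C * 1" using small_nonneg[OF assms] ab by (intro mult_left_mono) auto
  then have "gauss_le a C (hi F)" "gauss_le b C (lo F)"
    using gauss_hi(2)[OF assms] gauss_lo(2)[OF assms] by (auto elim: gauss_le_mono)
  then show "gauss_le a C (quo F)" "gauss_le b C (quo F)"
    unfolding quo_def using gauss_hi(1)[OF assms] gauss_lo(1)[OF assms] ab by (auto intro!: gauss_le_add)
qed

lemma bounded_upd: "laurent_bounded a b (v(N0 := 0))" "laurent_bounded a b (v(N1 := 0))"
  using gauss_upd by (auto intro: laurent_boundedI)

lemma conv_split:
  assumes "laurent_bounded a b w" "laurent_bounded a b (v(N := 0))"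
  shows "conv v w n = v N * w (n - N) + conv (v(N := 0)) w n"
proof -
  have "v = (\<lambda>n. laurent_monom (v N) N n + (v(N := 0)) n)"
    by (auto simp: laurent_monom_def)
  then have "conv v w n = conv (\<lambda>n. laurent_monom (v N) N n + (v(N := 0)) n) w n" by simp
  then show ?thesis
    using conv_add_left[OF laurent_bounded_monom assms(2,1) ab] by (simp add: conv_monom_left)
qed

text \<open>The dominant terms reproduce F exactly above N1 and below N0, so they cancel; what
  remains are the products with v stripped of a dominant term.\<close>

lemma step_eq:
  assumes "small C F"
  shows "step F n = - (conv (v(N1 := 0)) (hi F) n + conv (v(N0 := 0)) (lo F) n)"
proof -
  have hl: "laurent_bounded a b (hi F)" "laurent_bounded a b (lo F)"
    using gauss_hi[OF assms] gauss_lo[OF assms] by (blast intro: laurent_boundedI)+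
  define x y where "x = conv (v(N1 := 0)) (hi F) n" and "y = conv (v(N0 := 0)) (lo F) n"
  have "conv v (quo F) n = conv v (hi F) n + conv v (lo F) n"
    unfolding quo_def[abs_def] by (rule conv_add_right[OF bounded_v hl ab])
  also have "conv v (hi F) n = v N1 * hi F (n - N1) + x"
    unfolding x_def by (rule conv_split[OF hl(1) bounded_upd(2)])
  also have "conv v (lo F) n = v N0 * lo F (n - N0) + y"
    unfolding y_def by (rule conv_split[OF hl(2) bounded_upd(1)])
  also have "v N1 * hi F (n - N1) = (if N1 < n then F n else 0)" using nz by (simp add: hi_def)
  also have "v N0 * lo F (n - N0) = (if n < N0 then F n else 0)" using nz by (simp add: lo_def)
  finally have "step F n = - (x + y)" using N0_le_N1 by (auto simp: step_def)
  then show ?thesis by (simp only: x_def y_def)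
qed

text \<open>Each product gains a factor at each radius: for \<open>hi\<close> the stripped v is
  smaller by \<kappa> at b, and \<open>hi\<close> itself by a/b at a; for \<open>lo\<close> the
  radii are exchanged. The ultrametric inequality keeps the sum within the common bound.\<close>

lemma small_step:
  assumes "small C F"
  shows "small (L * C) (step F)"
proof -
  have C: "0 \<le> C" by (rule small_nonneg[OF assms])
  have le: "A * (C * (a / b)) \<le> L * C * A" "\<kappa> * A * C \<le> L * C * A"
    "B * (C * (a / b)) \<le> L * C * B" "\<kappa> * B * C \<le> L * C * B"
    using mult_right_mono[OF L(3), of "A * C"] mult_right_mono[OF L(4), of "A * C"]
      mult_right_mono[OF L(3), of "B * C"] mult_right_mono[OF L(4), of "B * C"] C AB_pos by (simp_all add: mult_ac)
  have "gauss_le a (L * C * A) (\<lambda>n. conv (v(N1 := 0)) (hi F) n + conv (v(N0 := 0)) (lo F) n)"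
    using gauss_le_conv[OF gauss_upd(4) gauss_hi(2)[OF assms]] gauss_le_conv[OF gauss_upd(1) gauss_lo(1)[OF assms]] le ab
    by (intro gauss_le_add) (auto elim: gauss_le_mono)
  moreover have "gauss_le b (L * C * B) (\<lambda>n. conv (v(N1 := 0)) (hi F) n + conv (v(N0 := 0)) (lo F) n)"
    using gauss_le_conv[OF gauss_upd(3) gauss_hi(1)[OF assms]] gauss_le_conv[OF gauss_upd(2) gauss_lo(2)[OF assms]] le b_pos
    by (intro gauss_le_add) (auto elim: gauss_le_mono)
  ultimately show ?thesis
    unfolding small_def step_eq[OF assms, abs_def] gauss_le_uminus by blast
qed

primrec iter :: "(int \<Rightarrow> 'a) \<Rightarrow> nat \<Rightarrow> int \<Rightarrow> 'a" where
  "iter F 0 = F"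
| "iter F (Suc j) = step (iter F j)"

lemma small_iter: "small C F \<Longrightarrow> small (L ^ j * C) (iter F j)"
proof (induction j)
  case (Suc j)
  then show ?case using small_step[of "L ^ j * C" "iter F j"] by (simp add: mult.assoc)
qed simp

definition part :: "(int \<Rightarrow> 'a) \<Rightarrow> nat \<Rightarrow> int \<Rightarrow> 'a" where
  "part F J n = (\<Sum>j<J. quo (iter F j) n)"

lemma bounded_part:
  assumes "small C F" shows "laurent_bounded a b (part F J)"
proof (induction J)
  case 0
  have "part F 0 = laurent_monom 0 0" by (auto simp: part_def laurent_monom_def)
  then show ?case by simp
next
  case (Suc J)
  have "part F (Suc J) = (\<lambda>n. part F J n + quo (iter F J) n)" by (auto simp: part_def)
  then show ?case
    using laurent_bounded_add[OF Suc laurent_boundedI[OF gauss_quo[OF small_iter[OF assms]]] ab(1) b_pos] by simp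
qed

lemma iter_outside:
  assumes "small C F" "\<not> (N0 \<le> n \<and> n \<le> N1)"
  shows "iter F J n = F n - conv v (part F J) n"
proof (induction J)
  case 0
  have "conv v (part F 0) n = 0" by (simp add: part_def[abs_def] conv_def)
  then show ?case by simp
next
  case (Suc J)
  have "conv v (\<lambda>n. part F J n + quo (iter F J) n) n = conv v (part F J) n + conv v (quo (iter F J)) n"
    using bounded_v bounded_part[OF assms(1)] laurent_boundedI[OF gauss_quo[OF small_iter[OF assms(1)]]] ab
    by (rule conv_add_right)
  moreover have "part F (Suc J) = (\<lambda>n. part F J n + quo (iter F J) n)" by (auto simp: part_def)
  ultimately show ?case using Suc assms(2) by (auto simp: step_def)
qed

lemma part_converges:
  assumes "small C F"
  shows "\<exists>q. (\<lambda>J. part F J n) \<longlonglongrightarrow> q"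
proof -
  have "(\<lambda>j. quo (iter F j) n) summable_on UNIV"
  proof (rule absval_summable_on_comparison)
    show "(\<lambda>j. C / a powi n * L ^ j) summable_on UNIV"
      using has_sum_nat_geometric[OF L(1,2)] by (intro summable_on_cmult_right) (rule has_sum_imp_summable)
    show "absval (quo (iter F j) n) \<le> C / a powi n * L ^ j" for j
      using gauss_leD[OF gauss_quo(1)[OF small_iter[OF assms]], of j n] ab by (simp add: field_simps)
  qed
  then have "(\<lambda>j. quo (iter F j) n) sums infsum (\<lambda>j. quo (iter F j) n) UNIV"
    by (intro has_sum_imp_sums has_sum_infsum)
  then show ?thesis unfolding sums_def part_def by blast
qed

text \<open>The partial quotients converge uniformly in the Gauss norms at both radii.
  Coefficientwise limits alone would not pass through the infinite sums in
  \<open>conv\<close>.\<close>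

lemma gauss_tail:
  assumes F: "small C F" and q: "\<And>n. (\<lambda>J. part F J n) \<longlonglongrightarrow> q n" and r: "r = a \<or> r = b"
  shows "gauss_le r (L ^ J * C) (\<lambda>n. q n - part F J n)"
  unfolding gauss_le_def
proof
  fix n
  have rpos: "0 < r" using r ab by auto
  have C: "0 \<le> C" by (rule small_nonneg[OF F])
  have "absval (q n - part F J n) \<le> L ^ J * C / r powi n"
  proof (rule tendsto_upperbound)
    show "(\<lambda>K. absval (part F K n - part F J n)) \<longlonglongrightarrow> absval (q n - part F J n)"
      by (intro tendsto_absval tendsto_diff q tendsto_const)
    show "\<forall>\<^sub>F K in sequentially. absval (part F K n - part F J n) \<le> L ^ J * C / r powi n"
      using eventually_ge_at_top[of J]
    proof eventually_elim
      case (elim K)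
      have "part F K n - part F J n = (\<Sum>j\<in>{..<K} - {..<J}. quo (iter F j) n)"
        unfolding part_def using elim by (subst sum_diff) auto
      moreover have "absval (quo (iter F j) n) \<le> L ^ J * C / r powi n" if "j \<in> {..<K} - {..<J}" for j
      proof -
        have "absval (quo (iter F j) n) * r powi n \<le> L ^ j * C"
          using gauss_leD gauss_quo[OF small_iter[OF F]] r by blast
        also have "\<dots> \<le> L ^ J * C"
          using that C L by (intro mult_right_mono power_decreasing) auto
        finally show ?thesis using rpos by (simp add: pos_le_divide_eq)
      qed
      ultimately show ?case
        using C L rpos by (auto intro!: absval_sum_le_bound)
    qed
  qed simp
  then show "absval (q n - part F J n) * r powi n \<le> L ^ J * C"
    using rpos by (simp add: pos_le_divide_eq)
qed

text \<open>For each J the defect of Q is the convolution of v with the tail of the quotient minus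
  the J-th error; both are of order L^J in the Gauss norm at a.\<close>

theorem division:
  assumes "laurent_bounded a b F"
  shows "\<exists>Q. laurent_bounded a b Q \<and> (\<forall>n. \<not> (N0 \<le> n \<and> n \<le> N1) \<longrightarrow> conv v Q n = F n)"
proof -
  obtain D where D: "0 \<le> D" "gauss_le a D F" "gauss_le b D F" using assms ab(1) by (rule laurent_boundedE)
  define C where "C = D / min A B"
  have "D \<le> C * A" "D \<le> C * B"
    using D(1) AB_pos mult_left_mono[of "min A B" A D] mult_left_mono[of "min A B" B D]
    by (auto simp: C_def pos_le_divide_eq min_def)
  then have F: "small C F" unfolding small_def using D by (auto elim: gauss_le_mono)
  have C: "0 \<le> C" by (rule small_nonneg[OF F])
  obtain Q where Q: "\<And>n. (\<lambda>J. part F J n) \<longlonglongrightarrow> Q n"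
    using part_converges[OF F] by metis
  have part0: "part F 0 n = 0" for n by (simp add: part_def)
  have bQ: "laurent_bounded a b Q"
    using gauss_tail[OF F Q, of a 0] gauss_tail[OF F Q, of b 0] by (auto simp: part0 intro: laurent_boundedI)
  have "conv v Q n = F n" if n: "\<not> (N0 \<le> n \<and> n \<le> N1)" for n
  proof -
    have "absval (conv v Q n - F n) * a powi n \<le> L ^ J * (A * C)" for J
    proof -
      have tail: "laurent_bounded a b (\<lambda>n. Q n - part F J n)"
        by (rule laurent_bounded_diff[OF bQ bounded_part[OF F] ab(1) b_pos])
      have "conv v (\<lambda>n. (Q n - part F J n) + part F J n) n = conv v (\<lambda>n. Q n - part F J n) n + conv v (part F J) n"
        by (rule conv_add_right[OF bounded_v tail bounded_part[OF F] ab])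
      then have eq: "conv v Q n - F n = conv v (\<lambda>n. Q n - part F J n) n - iter F J n"
        using iter_outside[OF F n, of J] by simp
      have "gauss_le a (A * (L ^ J * C)) (conv v (\<lambda>n. Q n - part F J n))"
        using gauss_tail[OF F Q, of a J] gauss_v ab by (intro gauss_le_conv) auto
      moreover have "gauss_le a (L ^ J * C * A) (iter F J)"
        using small_iter[OF F, of J] by (simp add: small_def)
      ultimately have "gauss_le a (L ^ J * (A * C)) (\<lambda>n. conv v (\<lambda>n. Q n - part F J n) n - iter F J n)"
        using ab by (intro gauss_le_diff) (simp_all add: mult_ac)
      from gauss_leD[OF this, of n] show ?thesis by (simp add: eq)
    qed
    moreover have "(\<lambda>J. L ^ J * (A * C)) \<longlonglongrightarrow> 0 * (A * C)"
      using L by (intro tendsto_mult tendsto_const LIMSEQ_realpow_zero) auto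
    ultimately have "absval (conv v Q n - F n) * a powi n \<le> 0"
      by (intro LIMSEQ_le_const[of "\<lambda>J. L ^ J * (A * C)"]) auto
    moreover have "0 < a powi n" using ab by simp
    ultimately have "absval (conv v Q n - F n) \<le> 0" by (simp add: mult_le_0_iff)
    then show ?thesis using absval_nonneg[of "conv v Q n - F n"] by (metis absval_eq_0_iff eq_iff_diff_eq_0 order_antisym)
  qed
  with bQ show ?thesis by blast
qed

end

text \<open>The monomial of degree N1 + 1, just above the window, is divided by v. The product of v
  and Q then lives in degrees N0 to N1 + 1 and has coefficient 1 at the top, so up to the unit z^N0
  it is a nonzero polynomial.\<close>

lemma laurent_divides_polynomial:
  fixes v :: "int \<Rightarrow> 'a::{nonarch_valued_field,complete_space}"
  assumes v: "laurent_bounded a0 b0 v" "v n1 \<noteq> 0" and rad: "0 < a0" "a0 < a" "a < b" "b < b0"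
  obtains Q p k where "laurent_bounded a b Q" "p \<noteq> 0"
    "\<And>z. a < absval z \<Longrightarrow> absval z < b \<Longrightarrow> laurent_sum v z * laurent_sum Q z = z powi k * poly p z"
proof -
  obtain r0 N0 \<kappa>0 where r0: "a0 < r0" "r0 < a" "0 \<le> \<kappa>0" "\<kappa>0 < 1" "v N0 \<noteq> 0"
    "\<And>n. n \<noteq> N0 \<Longrightarrow> absval (v n) * r0 powi n \<le> \<kappa>0 * (absval (v N0) * r0 powi N0)"
    by (rule exists_dominant[OF v, of a0 a]) (use rad in auto)
  obtain r1 N1 \<kappa>1 where r1: "b < r1" "r1 < b0" "0 \<le> \<kappa>1" "\<kappa>1 < 1" "v N1 \<noteq> 0"
    "\<And>n. n \<noteq> N1 \<Longrightarrow> absval (v n) * r1 powi n \<le> \<kappa>1 * (absval (v N1) * r1 powi N1)"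
    by (rule exists_dominant[OF v, of b b0]) (use rad in auto)
  have mono: "x \<le> max \<kappa>0 \<kappa>1 * (absval y * r powi m)" if "0 < r" "x \<le> \<kappa>0 * (absval y * r powi m) \<or> x \<le> \<kappa>1 * (absval y * r powi m)"
    for x r m and y :: 'a
  proof -
    have "0 \<le> absval y * r powi m" using that by simp
    then have "\<kappa>0 * (absval y * r powi m) \<le> max \<kappa>0 \<kappa>1 * (absval y * r powi m)"
      "\<kappa>1 * (absval y * r powi m) \<le> max \<kappa>0 \<kappa>1 * (absval y * r powi m)"
      by (intro mult_right_mono; simp)+
    then show ?thesis using that(2) by linarith
  qed
  interpret laurent_division v r0 r1 "max \<kappa>0 \<kappa>1" N0 N1
    by unfold_locales (use r0 r1 rad mono in auto)
  obtain Q where Q: "laurent_bounded r0 r1 Q"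
    "\<And>n. \<not> (N0 \<le> n \<and> n \<le> N1) \<Longrightarrow> conv v Q n = laurent_monom 1 (N1 + 1) n"
    using division[OF laurent_bounded_monom[of r0 r1 1 "N1 + 1"]] by blast
  define M where "M = nat (N1 + 1 - N0)"
  have M: "N0 + int M = N1 + 1" using N0_le_N1 by (simp add: M_def)
  define p where "p = (\<Sum>i\<le>M. monom (conv v Q (N0 + int i)) i)"
  have "coeff p M = conv v Q (N0 + int M)"
    by (simp add: p_def coeff_sum)
  also have "\<dots> = 1" using Q(2)[of "N1 + 1"] by (simp add: M laurent_monom_def)
  finally have "p \<noteq> 0" by auto
  moreover have "laurent_bounded a b Q"
    by (rule laurent_bounded_subset[OF Q(1)]) (use r0 r1 rad in auto)
  moreover have "laurent_sum v z * laurent_sum Q z = z powi N0 * poly p z" if z: "a < absval z" "absval z < b" for z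
  proof -
    have zr: "0 < r0" "r0 < absval z" "absval z < r1" "z \<noteq> 0" using z r0 r1 rad by auto
    have "laurent_sum v z * laurent_sum Q z = laurent_sum (conv v Q) z"
      using laurent_sum_conv[OF bounded_v Q(1) zr(1-3)] by simp
    also have "\<dots> = (\<Sum>n\<in>(\<lambda>i. N0 + int i) ` {..M}. conv v Q n * z powi n)"
    proof (rule laurent_sum_finite)
      fix n assume n: "n \<notin> (\<lambda>i. N0 + int i) ` {..M}"
      have "\<not> (N0 \<le> n \<and> n \<le> N1 + 1)"
      proof
        assume "N0 \<le> n \<and> n \<le> N1 + 1"
        then have "n = N0 + int (nat (n - N0))" "nat (n - N0) \<in> {..M}" by (auto simp: M_def)
        with n show False by blast
      qed
      then show "conv v Q n = 0" using Q(2)[of n] N0_le_N1 by (auto simp: laurent_monom_def)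
    qed simp
    also have "\<dots> = (\<Sum>i\<le>M. conv v Q (N0 + int i) * z powi (N0 + int i))"
      by (subst sum.reindex) (auto simp: inj_on_def)
    also have "\<dots> = z powi N0 * poly p z"
      using zr by (simp add: p_def poly_sum poly_monom sum_distrib_left power_int_add mult_ac)
    finally show ?thesis .
  qed
  ultimately show ?thesis using that by blast
qed

subsection \<open>Polynomials and linear factors\<close>

definition laurent_poly :: "'a::zero poly \<Rightarrow> int \<Rightarrow> 'a" where
  "laurent_poly p n = (if 0 \<le> n then coeff p (nat n) else 0)"

lemma laurent_poly_outside: "n \<notin> int ` {..degree p} \<Longrightarrow> laurent_poly p n = 0"
  by (auto simp: laurent_poly_def intro!: coeff_eq_0) (metis atMost_iff image_eqI int_nat_eq not_le)

lemma laurent_bounded_poly [simp]: "laurent_bounded a b (laurent_poly p)"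
proof (rule laurent_bounded_finite)
  have "{n. laurent_poly p n \<noteq> 0} \<subseteq> int ` {..degree p}" using laurent_poly_outside by blast
  then show "finite {n. laurent_poly p n \<noteq> 0}" by (rule finite_subset) simp
qed

lemma laurent_sum_poly [simp]:
  "laurent_sum (laurent_poly p) z = poly p z" for z :: "'a::{valued_field,complete_space}"
proof -
  have "laurent_sum (laurent_poly p) z = (\<Sum>n\<in>int ` {..degree p}. laurent_poly p n * z powi n)"
    by (rule laurent_sum_finite) (auto intro: laurent_poly_outside)
  also have "\<dots> = poly p z"
    by (subst sum.reindex) (auto simp: poly_altdef laurent_poly_def)
  finally show ?thesis .
qed

lemma tendsto_poly_valued:
  fixes p :: "'a::valued_field poly"
  shows "(f \<longlongrightarrow> x) F \<Longrightarrow> ((\<lambda>z. poly p (f z)) \<longlongrightarrow> poly p x) F"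
  unfolding poly_altdef by (intro tendsto_sum tendsto_mult tendsto_const tendsto_power_valued)

lemma laurent_bounded_conv_poly:
  fixes h :: "int \<Rightarrow> 'a::nonarch_valued_field"
  shows "laurent_bounded a b h \<Longrightarrow> 0 < a \<Longrightarrow> 0 < b \<Longrightarrow> laurent_bounded a b (conv (laurent_poly p) h)"
  by (intro laurent_bounded_conv) auto

lemma laurent_sum_conv_poly:
  fixes h :: "int \<Rightarrow> 'a::{nonarch_valued_field,complete_space}"
  assumes "laurent_bounded a b h" "0 < a" "a < absval z" "absval z < b"
  shows "laurent_sum (conv (laurent_poly p) h) z = poly p z * laurent_sum h z"
  using laurent_sum_conv[OF laurent_bounded_poly assms, of p] by simp

lemma laurent_sum_linear_factor:
  fixes g :: "int \<Rightarrow> 'a::{nonarch_valued_field,complete_space}"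
  assumes "laurent_bounded a b g" "0 < a" "a < absval z" "absval z < b"
  shows "laurent_sum (\<lambda>n. g (n - 1) - \<beta> * g n) z = (z - \<beta>) * laurent_sum g z"
proof -
  have "laurent_bounded a b (conv (laurent_monom 1 1) g)"
    using assms by (intro laurent_bounded_conv) auto
  then show ?thesis
    using laurent_sum_diff[OF _ laurent_bounded_cmult[OF assms(1), of \<beta>] assms(2-4), of "conv (laurent_monom 1 1) g"]
      laurent_sum_conv[OF laurent_bounded_monom assms, of 1 1] laurent_sum_cmult[OF assms, of \<beta>]
    by (simp add: conv_monom_left left_diff_distrib)
qed

text \<open>Synthetic division: g(n) is the sum of h(m) \<beta>^(m-n-1) over m > n and, since h
  vanishes at \<beta>, also minus the sum over m \<le> n. The first form is estimated for n \<ge> 0,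
  the second for n < 0. The explicit bound C/a allows iteration in
  \<open>quotient_taylor\<close>.\<close>

lemma laurent_divide_linear:
  fixes h :: "int \<Rightarrow> 'a::{nonarch_valued_field,complete_space}"
  assumes h: "gauss_le a C h" "gauss_le b C h" and \<beta>: "0 < a" "a < absval \<beta>" "absval \<beta> < b"
    and zero: "laurent_sum h \<beta> = 0"
  obtains g where "gauss_le a (C / a) g" "gauss_le b (C / a) g"
    "\<And>z. a < absval z \<Longrightarrow> absval z < b \<Longrightarrow> laurent_sum h z = (z - \<beta>) * laurent_sum g z"
proof -
  have \<beta>0: "\<beta> \<noteq> 0" and ab: "0 < b" "a < b" using \<beta> by auto
  have C: "0 \<le> C" by (rule gauss_le_nonneg[OF h(1) \<beta>(1)])
  have bh: "laurent_bounded a b h" using h by (rule laurent_boundedI)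
  define t where "t n m = h m * \<beta> powi (m - n - 1)" for n m :: int
  have "((\<lambda>m. h m * \<beta> powi m * \<beta> powi (- n - 1)) has_sum 0 * \<beta> powi (- n - 1)) UNIV" for n
    using laurent_has_sum[OF bh \<beta>] zero by (intro has_sum_cmult_left) simp
  moreover have "h m * \<beta> powi m * \<beta> powi (- n - 1) = t n m" for n m
    using \<beta>0 power_int_add[of \<beta> m "- n - 1"] by (simp add: t_def algebra_simps)
  ultimately have t: "(t n has_sum 0) UNIV" for n by simp
  then have sub: "t n summable_on S" for n S
    using summable_on_subset[OF has_sum_imp_summable] by blast
  define g where "g n = infsum (t n) {n<..}" for n
  have g2: "g n = - infsum (t n) {..n}" for n
  proof -
    have "infsum (t n) ({n<..} \<union> {..n}) = infsum (t n) {n<..} + infsum (t n) {..n}"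
      by (intro infsum_Un_disjoint sub) auto
    moreover have "{n<..} \<union> {..n} = UNIV" by auto
    ultimately show ?thesis using infsumI[OF t[of n]] by (simp add: g_def eq_neg_iff_add_eq_0)
  qed
  have rec: "g (n - 1) - \<beta> * g n = h n" for n
  proof -
    have "{n - 1<..} = {n} \<union> {n<..}" by auto
    then have "g (n - 1) = infsum (t (n - 1)) {n} + infsum (t (n - 1)) {n<..}"
      unfolding g_def by (simp only:) (intro infsum_Un_disjoint sub, auto)
    also have "infsum (t (n - 1)) {n} = h n" by (simp add: t_def)
    also have "infsum (t (n - 1)) {n<..} = infsum (\<lambda>m. \<beta> * t n m) {n<..}"
    proof (rule infsum_cong)
      fix m
      have "\<beta> powi (m - (n - 1) - 1) = \<beta> powi (1 + (m - n - 1))" by (simp add: algebra_simps)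
      also have "\<dots> = \<beta> * \<beta> powi (m - n - 1)" using \<beta>0 by (subst power_int_add) auto
      finally show "t (n - 1) m = \<beta> * t n m" by (simp add: t_def)
    qed
    also have "\<dots> = \<beta> * g n" unfolding g_def by (rule infsum_cmult_right')
    finally show ?thesis by simp
  qed
  define \<rho> where "\<rho> = absval \<beta>"
  have \<rho>: "0 < \<rho>" "a < \<rho>" "\<rho> < b" using \<beta> by (auto simp: \<rho>_def)
  have t_le: "absval (t n m) * r powi n \<le> C / a"
    if r: "r = a \<or> r = b" and mn: "0 \<le> n \<and> n < m \<or> m \<le> n \<and> n < 0" for n m r
  proof -
    have hm: "absval (h m) * a powi m \<le> C" "absval (h m) * b powi m \<le> C" "absval (h m) * \<rho> powi m \<le> C"
      using gauss_leD[OF h(1)] gauss_leD[OF h(2)] gauss_leD[OF gauss_le_between[OF h \<beta>(1), of \<rho>]] \<rho> by auto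
    have "0 < r" using r ab \<beta> by auto
    have abs_t: "absval (t n m) * r powi n = absval (h m) * (\<rho> powi (m - n - 1) * r powi n)"
      by (simp add: t_def absval_mult absval_powi \<rho>_def)
    show ?thesis
    \<comment> \<open>Mixed powers of \<rho> and r must become powers of one radius. If the sign of
      n matches the boundary circle, \<rho>^(m-n-1) is at most r^(m-n-1); otherwise r^n is at most
      \<rho>^n. The loss is 1/r or 1/\<rho>, hence at most 1/a.\<close>
    proof (cases "0 \<le> n \<longleftrightarrow> r = b")
      case True
      have "\<rho> powi (m - n - 1) \<le> r powi (m - n - 1)"
      proof (cases "r = b")
        case True
        then show ?thesis using \<open>0 \<le> n \<longleftrightarrow> r = b\<close> mn \<rho> by (intro power_int_mono) auto
      next
        case False
        then show ?thesis using \<open>0 \<le> n \<longleftrightarrow> r = b\<close> mn \<rho> r \<beta>(1) by (intro power_int_antimono) auto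
      qed
      then have "absval (t n m) * r powi n \<le> absval (h m) * (r powi (m - n - 1) * r powi n)"
        unfolding abs_t using \<open>0 < r\<close> by (intro mult_left_mono mult_right_mono) auto
      also have "r powi (m - n - 1) * r powi n = r powi m / r"
        using \<open>0 < r\<close> by (simp add: power_int_diff)
      also have "absval (h m) * (r powi m / r) \<le> C / r"
        using hm r \<open>0 < r\<close> by (auto intro: divide_right_mono)
      also have "\<dots> \<le> C / a" using C r ab \<beta>(1) by (auto intro!: divide_left_mono)
      finally show ?thesis .
    next
      case False
      have "r powi n \<le> \<rho> powi n"
      proof (cases "0 \<le> n")
        case True
        then show ?thesis using False r \<rho> \<beta>(1) by (intro power_int_mono) auto
      next
        case neg: False
        then show ?thesis using False r \<rho> by (intro power_int_antimono) auto
      qed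
      then have "absval (t n m) * r powi n \<le> absval (h m) * (\<rho> powi (m - n - 1) * \<rho> powi n)"
        unfolding abs_t using \<rho> by (intro mult_left_mono) auto
      also have "\<rho> powi (m - n - 1) * \<rho> powi n = \<rho> powi m / \<rho>"
        using \<rho> by (simp add: power_int_diff)
      also have "absval (h m) * (\<rho> powi m / \<rho>) \<le> C / \<rho>"
        using hm(3) \<rho> by (auto intro: divide_right_mono)
      also have "\<dots> \<le> C / a" using C \<rho> \<beta>(1) by (auto intro!: divide_left_mono)
      finally show ?thesis .
    qed
  qed
  have gauss_g: "gauss_le r (C / a) g" if r: "r = a \<or> r = b" for r
    unfolding gauss_le_def
  proof
    fix n
    have rpos: "0 < r" using r ab \<beta> by auto
    have Ca: "0 \<le> C / a / r powi n" using C \<beta>(1) rpos by simp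
    have le: "absval (t n m) \<le> C / a / r powi n" if "0 \<le> n \<and> n < m \<or> m \<le> n \<and> n < 0" for m
      using t_le[OF r that] rpos by (subst pos_le_divide_eq) auto
    have "absval (g n) \<le> C / a / r powi n"
    proof (cases "0 \<le> n")
      case True
      then show ?thesis unfolding g_def by (intro absval_infsum_le_bound Ca le) auto
    next
      case False
      then show ?thesis unfolding g2 absval_minus by (intro absval_infsum_le_bound Ca le) auto
    qed
    then show "absval (g n) * r powi n \<le> C / a"
      using rpos by (subst (asm) pos_le_divide_eq) auto
  qed
  have "laurent_sum h z = (z - \<beta>) * laurent_sum g z" if "a < absval z" "absval z < b" for z
    using laurent_sum_linear_factor[OF laurent_boundedI[OF gauss_g gauss_g] \<beta>(1) that, of \<beta>] by (simp add: rec)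
  with gauss_g that show ?thesis by blast
qed

text \<open>A geometric series in \<beta>/z or in z/\<beta>. Roots on the boundary circles are
  included because boundedness, not convergence, is required at the radii.\<close>

lemma inverse_linear_outside:
  fixes \<beta> :: "'a::{nonarch_valued_field,complete_space}"
  assumes ab: "0 < a" "a < b" and \<beta>: "absval \<beta> \<le> a \<or> b \<le> absval \<beta>"
  obtains e where "laurent_bounded a b e"
    "\<And>z. a < absval z \<Longrightarrow> absval z < b \<Longrightarrow> (z - \<beta>) * laurent_sum e z = 1"
proof -
  have "\<exists>e. laurent_bounded a b e \<and> (\<forall>n. e (n - 1) - \<beta> * e n = laurent_monom 1 0 n)"
  proof (cases "absval \<beta> \<le> a")
    case True
    define e where "e n = (if n \<le> - 1 then \<beta> ^ nat (- n - 1) else 0)" for n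
    have "gauss_le r (1 / r) e" if "a \<le> r" for r
      unfolding gauss_le_def
    proof
      fix n
      have r: "0 < r" using that ab by simp
      show "absval (e n) * r powi n \<le> 1 / r"
      proof (cases "n \<le> - 1")
        case n: True
        have "absval \<beta> ^ nat (- n - 1) * r powi n \<le> r ^ nat (- n - 1) * r powi n"
          using True that r by (intro mult_right_mono power_mono) auto
        also have "r ^ nat (- n - 1) = r powi (- n - 1)"
          using n by (simp add: power_int_def)
        also have "r powi (- n - 1) * r powi n = 1 / r"
          using r by (simp add: power_int_diff power_int_minus)
        finally show ?thesis using n by (simp add: e_def absval_power)
      qed (use r in \<open>simp add: e_def\<close>)
    qed
    then have "laurent_bounded a b e" using ab by (intro laurent_boundedI[of a "1 / a" e b "1 / b"]) auto
    moreover have "e (n - 1) - \<beta> * e n = laurent_monom 1 0 n" for n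
    proof (cases "n \<le> - 1")
      case True
      then have "nat (- (n - 1) - 1) = Suc (nat (- n - 1))" by simp
      then show ?thesis using True by (simp add: e_def laurent_monom_def)
    qed (auto simp: e_def laurent_monom_def)
    ultimately show ?thesis by blast
  next
    case False
    with \<beta> have \<beta>b: "b \<le> absval \<beta>" by simp
    then have \<beta>0: "\<beta> \<noteq> 0" using ab by auto
    define e where "e n = (if 0 \<le> n then - (inverse \<beta> ^ Suc (nat n)) else 0)" for n
    have "gauss_le r (1 / b) e" if r: "0 < r" "r \<le> b" for r
      unfolding gauss_le_def
    proof
      fix n
      show "absval (e n) * r powi n \<le> 1 / b"
      proof (cases "0 \<le> n")
        case n: True
        have "inverse (absval \<beta>) \<le> inverse b" "inverse (absval \<beta>) \<le> inverse r"
          using r ab \<beta>b by (auto intro!: le_imp_inverse_le)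
        then have "inverse (absval \<beta>) * inverse (absval \<beta>) ^ nat n * r powi n \<le> inverse b * inverse r ^ nat n * r powi n"
          using r ab by (intro mult_mono power_mono) auto
        also have "\<dots> = 1 / b"
          using n r by (simp add: power_int_def power_inverse divide_inverse)
        finally show ?thesis using n by (simp add: e_def absval_power absval_inverse absval_mult)
      qed (use ab in \<open>simp add: e_def\<close>)
    qed
    then have "laurent_bounded a b e" using ab by (intro laurent_boundedI[of a "1 / b" e b "1 / b"]) auto
    moreover have "e (n - 1) - \<beta> * e n = laurent_monom 1 0 n" for n
    proof (cases "1 \<le> n")
      case True
      then have "nat n = Suc (nat (n - 1))" by simp
      then show ?thesis using True \<beta>0 by (simp add: e_def laurent_monom_def)
    qed (use \<beta>0 in \<open>auto simp: e_def laurent_monom_def\<close>)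
    ultimately show ?thesis by blast
  qed
  then obtain e where e: "laurent_bounded a b e" "\<And>n. e (n - 1) - \<beta> * e n = laurent_monom 1 0 n" by blast
  have "(z - \<beta>) * laurent_sum e z = 1" if "a < absval z" "absval z < b" for z
    using laurent_sum_linear_factor[OF e(1) ab(1) that, of \<beta>]
    by (simp add: e(2) flip: laurent_monom_def)
  with e(1) that show ?thesis by blast
qed

subsection \<open>Local behaviour of quotients\<close>

lemma eventually_in_annulus:
  fixes \<alpha> :: "'a::valued_field"
  assumes "a < absval \<alpha>" "absval \<alpha> < b"
  shows "\<forall>\<^sub>F z in at \<alpha>. a < absval z \<and> absval z < b"
proof -
  have lim: "((\<lambda>z. absval z) \<longlongrightarrow> absval \<alpha>) (at \<alpha>)" by (intro tendsto_absval tendsto_ident_at)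
  show ?thesis
    using order_tendstoD(1)[OF lim assms(1)] order_tendstoD(2)[OF lim assms(2)] by eventually_elim auto
qed

lemma laurent_sum_bdd_near:
  fixes h :: "int \<Rightarrow> 'a::{nonarch_valued_field,complete_space}"
  assumes "laurent_bounded a b h" "0 < a" "a < absval \<alpha>" "absval \<alpha> < b"
  shows "bdd_near (laurent_sum h) \<alpha>"
proof -
  obtain C where C: "gauss_le a C h" "gauss_le b C h" using assms(1,2) by (rule laurent_boundedE)
  have "\<forall>\<^sub>F z in at \<alpha>. absval (laurent_sum h z) \<le> C"
    using eventually_in_annulus[OF assms(3,4)]
    by eventually_elim (rule absval_laurent_sum_le[OF C assms(2)], auto)
  then show ?thesis by (rule bdd_nearI)
qed

lemma eventually_poly_nonzero:
  fixes p :: "'a::valued_field poly"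
  assumes "p \<noteq> 0"
  shows "\<forall>\<^sub>F z in at \<alpha>. poly p z \<noteq> 0"
  using eventually_at_not_in_finite[OF poly_roots_finite[OF assms], of \<alpha>] by simp

lemma quotient_bdd_near:
  fixes h :: "int \<Rightarrow> 'a::{nonarch_valued_field,complete_space}"
  assumes h: "laurent_bounded a b h" "0 < a" "a < absval \<alpha>" "absval \<alpha> < b"
    and p: "poly p \<alpha> \<noteq> 0"
    and f: "\<And>z. a < absval z \<Longrightarrow> absval z < b \<Longrightarrow> poly p z \<noteq> 0 \<Longrightarrow> f z = laurent_sum h z / poly p z"
  shows "bdd_near f \<alpha>"
proof (rule bdd_near_eventually_eq)
  have "p \<noteq> 0" using p by auto
  from eventually_poly_nonzero[OF this] eventually_in_annulus[OF h(3,4)]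
  show "\<forall>\<^sub>F z in at \<alpha>. f z = laurent_sum h z * inverse (poly p z)"
    by eventually_elim (simp add: f divide_inverse)
  have "bdd_near (\<lambda>z. inverse (poly p z)) \<alpha>"
    by (rule bdd_near_tendsto[OF tendsto_inverse_valued[OF tendsto_poly_valued[OF tendsto_ident_at] p]])
  then show "bdd_near (\<lambda>z. laurent_sum h z * inverse (poly p z)) \<alpha>"
    by (intro bdd_near_mult laurent_sum_bdd_near[OF h])
qed

text \<open>
  The Taylor coefficients at \<open>\<alpha>\<close> of \<open>h / p\<close>, where \<open>p\<close> does not vanish at \<open>\<alpha>\<close>, are split off one by one:
  \<open>h - c p\<close> with \<open>c = h(\<alpha>) / p(\<alpha>)\<close> is divisible by \<open>z - \<alpha>\<close>, with a bound on the quotient.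
\<close>

lemma quotient_taylor:
  fixes h :: "int \<Rightarrow> 'a::{nonarch_valued_field,complete_space}"
  assumes h: "laurent_bounded a b h" and \<alpha>: "0 < a" "a < absval \<alpha>" "absval \<alpha> < b"
    and p: "poly p \<alpha> \<noteq> 0"
  obtains t r where "0 < r"
    "\<And>z. absval (z - \<alpha>) < r \<Longrightarrow> a < absval z \<Longrightarrow> absval z < b \<Longrightarrow> poly p z \<noteq> 0 \<Longrightarrow>
      (\<lambda>j. t j * (z - \<alpha>) ^ j) sums (laurent_sum h z / poly p z)"
proof -
  have b: "0 < b" using \<alpha> by simp
  obtain C where C: "0 \<le> C" "gauss_le a C h" "gauss_le b C h" using h \<alpha>(1) by (rule laurent_boundedE)
  obtain P where P: "0 \<le> P" "gauss_le a P (laurent_poly p)" "gauss_le b P (laurent_poly p)"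
    using laurent_bounded_poly[of a b p] \<alpha>(1) by (rule laurent_boundedE)
  \<comment> \<open>Growth of the remainders per step: subtracting the multiple of p costs at most
    the maximum, and division by z - \<alpha> costs 1/a. The expansion then converges for |z -
    \<alpha>| < 1/\<kappa>.\<close>
  define \<kappa> where "\<kappa> = max 1 (P / absval (poly p \<alpha>)) / a"
  have \<kappa>: "0 < \<kappa>" using \<alpha> by (simp add: \<kappa>_def)
  define c where "c u = laurent_sum u \<alpha> / poly p \<alpha>" for u
  define good where "good u D \<longleftrightarrow> gauss_le a D u \<and> gauss_le b D u" for u :: "int \<Rightarrow> 'a" and D
  have "\<exists>g. good g (\<kappa> * D) \<and> (\<forall>z. a < absval z \<longrightarrow> absval z < b \<longrightarrow>
      laurent_sum u z = c u * poly p z + (z - \<alpha>) * laurent_sum g z)" if u: "good u D" for u D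
  proof -
    have D: "0 \<le> D" using u gauss_le_nonneg \<alpha>(1) unfolding good_def by blast
    have bu: "laurent_bounded a b u" using u by (auto simp: good_def intro: laurent_boundedI)
    let ?w = "\<lambda>n. u n - c u * laurent_poly p n"
    let ?K = "max 1 (P / absval (poly p \<alpha>)) * D"
    have "absval (laurent_sum u \<alpha>) \<le> D"
      using u \<alpha> by (intro absval_laurent_sum_le[of a _ _ b]) (auto simp: good_def)
    then have "absval (c u) \<le> D / absval (poly p \<alpha>)"
      by (simp add: c_def absval_divide divide_right_mono)
    then have "absval (c u) * P \<le> D / absval (poly p \<alpha>) * P"
      using P(1) by (intro mult_right_mono)
    also have "\<dots> = P / absval (poly p \<alpha>) * D" by simp
    also have "\<dots> \<le> ?K" using D by (intro mult_right_mono) auto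
    finally have cP: "absval (c u) * P \<le> ?K" .
    have DK: "D \<le> ?K" using D mult_right_mono[of 1 "max 1 (P / absval (poly p \<alpha>))" D] by simp
    have w: "gauss_le r ?K ?w" if "r = a \<or> r = b" for r
    proof (rule gauss_le_diff)
      show "gauss_le r ?K u" using u that DK unfolding good_def by (auto elim: gauss_le_mono)
      have "gauss_le r (absval (c u) * P) (\<lambda>n. c u * laurent_poly p n)"
        using P that by (auto intro: gauss_le_cmult)
      then show "gauss_le r ?K (\<lambda>n. c u * laurent_poly p n)" using cP by (rule gauss_le_mono)
    qed (use that \<alpha> in auto)
    have sum_w: "laurent_sum ?w z = laurent_sum u z - c u * poly p z" if "a < absval z" "absval z < b" for z
      using laurent_sum_diff[OF bu laurent_bounded_cmult[OF laurent_bounded_poly] \<alpha>(1) that, of "c u" p]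
        laurent_sum_cmult[OF laurent_bounded_poly \<alpha>(1) that, of "c u" p] by simp
    have "laurent_sum ?w \<alpha> = 0" using sum_w[OF \<alpha>(2,3)] p by (simp add: c_def)
    from laurent_divide_linear[OF w w \<alpha> this] obtain g where
      g: "gauss_le a (?K / a) g" "gauss_le b (?K / a) g"
      "\<And>z. a < absval z \<Longrightarrow> absval z < b \<Longrightarrow> laurent_sum ?w z = (z - \<alpha>) * laurent_sum g z" by blast
    have "?K / a = \<kappa> * D" by (simp add: \<kappa>_def)
    then have "good g (\<kappa> * D)" using g(1,2) by (simp add: good_def)
    moreover have "laurent_sum u z = c u * poly p z + (z - \<alpha>) * laurent_sum g z"
      if z: "a < absval z" "absval z < b" for z
    proof -
      have "laurent_sum u z - c u * poly p z = (z - \<alpha>) * laurent_sum g z"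
        unfolding sum_w[OF z, symmetric] by (rule g(3)[OF z])
      then show ?thesis by (simp add: diff_eq_eq add.commute)
    qed
    ultimately show ?thesis by blast
  qed
  then obtain G where G: "\<And>u D. good u D \<Longrightarrow> good (G u D) (\<kappa> * D)"
    "\<And>u D z. good u D \<Longrightarrow> a < absval z \<Longrightarrow> absval z < b \<Longrightarrow>
      laurent_sum u z = c u * poly p z + (z - \<alpha>) * laurent_sum (G u D) z" by metis
  \<comment> \<open>\<open>H j\<close> is the j-th remainder; its bound is carried along because the
    choice function G takes the bound as an argument.\<close>
  define H where "H = rec_nat h (\<lambda>j u. G u (\<kappa> ^ j * C))"
  have H0: "H 0 = h" and HS: "H (Suc j) = G (H j) (\<kappa> ^ j * C)" for j by (simp_all add: H_def)
  have good_H: "good (H j) (\<kappa> ^ j * C)" for j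
  proof (induction j)
    case 0 then show ?case using C by (simp add: H0 good_def)
  next
    case (Suc j) then show ?case using G(1)[OF Suc] by (simp add: HS mult.assoc)
  qed
  have "(\<lambda>j. c (H j) * (z - \<alpha>) ^ j) sums (laurent_sum h z / poly p z)"
    if z: "absval (z - \<alpha>) < 1 / \<kappa>" "a < absval z" "absval z < b" "poly p z \<noteq> 0" for z
  proof -
    have expand: "laurent_sum h z / poly p z =
        (\<Sum>j<J. c (H j) * (z - \<alpha>) ^ j) + (z - \<alpha>) ^ J * laurent_sum (H J) z / poly p z" for J
    proof (induction J)
      case (Suc J)
      have HJ: "laurent_sum (H J) z = c (H J) * poly p z + (z - \<alpha>) * laurent_sum (H (Suc J)) z"
        unfolding HS by (rule G(2)[OF good_H z(2,3)])
      have "(z - \<alpha>) ^ J * laurent_sum (H J) z / poly p z =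
          c (H J) * (z - \<alpha>) ^ J + (z - \<alpha>) ^ Suc J * laurent_sum (H (Suc J)) z / poly p z"
        unfolding HJ using z(4) by (simp add: distrib_left add_divide_distrib mult_ac)
      with Suc show ?case by simp
    qed (simp add: H0)
    have le: "absval ((z - \<alpha>) ^ J * laurent_sum (H J) z / poly p z) \<le>
        (absval (z - \<alpha>) * \<kappa>) ^ J * (C / absval (poly p z))" for J
    proof -
      have "absval (laurent_sum (H J) z) \<le> \<kappa> ^ J * C"
        using good_H[of J] z \<alpha>(1) by (intro absval_laurent_sum_le[of a _ _ b]) (auto simp: good_def)
      then have "absval (z - \<alpha>) ^ J * absval (laurent_sum (H J) z) / absval (poly p z) \<le>
          absval (z - \<alpha>) ^ J * (\<kappa> ^ J * C) / absval (poly p z)"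
        by (intro divide_right_mono mult_left_mono) auto
      then show ?thesis by (simp add: absval_divide absval_mult absval_power power_mult_distrib mult_ac)
    qed
    have "absval (z - \<alpha>) * \<kappa> < 1" using z(1) \<kappa> by (simp add: pos_less_divide_eq)
    then have "(\<lambda>J. (absval (z - \<alpha>) * \<kappa>) ^ J * (C / absval (poly p z))) \<longlonglongrightarrow> 0"
      using \<kappa> by (intro tendsto_mult_left_zero LIMSEQ_realpow_zero) auto
    then have "(\<lambda>J. absval ((z - \<alpha>) ^ J * laurent_sum (H J) z / poly p z)) \<longlonglongrightarrow> 0"
      by (rule tendsto_sandwich[OF always_eventually always_eventually tendsto_const, rotated 2])
         (simp_all only: absval_nonneg le simp_thms)
    then have "(\<lambda>J. (z - \<alpha>) ^ J * laurent_sum (H J) z / poly p z) \<longlonglongrightarrow> 0"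
      by (subst tendsto_absval_zero_iff)
    then have "(\<lambda>J. laurent_sum h z / poly p z - (z - \<alpha>) ^ J * laurent_sum (H J) z / poly p z) \<longlonglongrightarrow>
        laurent_sum h z / poly p z - 0" by (intro tendsto_diff tendsto_const)
    moreover have "laurent_sum h z / poly p z - (z - \<alpha>) ^ J * laurent_sum (H J) z / poly p z =
        (\<Sum>j<J. c (H j) * (z - \<alpha>) ^ j)" for J
      using expand[of J] by simp
    ultimately show ?thesis unfolding sums_def by simp
  qed
  moreover have "0 < 1 / \<kappa>" using \<kappa> by simp
  ultimately show ?thesis by (intro that[of "1 / \<kappa>" "\<lambda>j. c (H j)"])
qed

text \<open>The full power of z - \<alpha> in p is multiplied out, leaving a denominator that does
  not vanish at \<alpha>.\<close>

lemma quotient_polar_expansion: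
  fixes h :: "int \<Rightarrow> 'a::{nonarch_valued_field,complete_space}"
  assumes h: "laurent_bounded a b h" and \<alpha>: "0 < a" "a < absval \<alpha>" "absval \<alpha> < b"
    and p: "p \<noteq> 0"
    and f: "\<And>z. a < absval z \<Longrightarrow> absval z < b \<Longrightarrow> poly p z \<noteq> 0 \<Longrightarrow> f z = laurent_sum h z / poly p z"
  shows "\<exists>c. polar_expansion f \<alpha> c"
proof -
  obtain p1 where p1: "p = [:- \<alpha>, 1:] ^ order \<alpha> p * p1" "\<not> [:- \<alpha>, 1:] dvd p1"
    using order_decomp[OF p] by blast
  then have p1\<alpha>: "poly p1 \<alpha> \<noteq> 0" by (simp add: poly_eq_0_iff_dvd)
  define K where "K = order \<alpha> p"
  obtain t r where r: "0 < r" and t: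
    "\<And>z. absval (z - \<alpha>) < r \<Longrightarrow> a < absval z \<Longrightarrow> absval z < b \<Longrightarrow> poly p1 z \<noteq> 0 \<Longrightarrow>
      (\<lambda>j. t j * (z - \<alpha>) ^ j) sums (laurent_sum h z / poly p1 z)"
    using quotient_taylor[OF h \<alpha> p1\<alpha>] by blast
  have "\<forall>\<^sub>F z in at \<alpha>. poly p z \<noteq> 0 \<and> a < absval z \<and> absval z < b"
    using eventually_poly_nonzero[OF p, of \<alpha>] eventually_in_annulus[OF \<alpha>(2,3)] by eventually_elim auto
  then obtain r' where r': "0 < r'" "\<And>z. z \<noteq> \<alpha> \<Longrightarrow> absval (z - \<alpha>) < r' \<Longrightarrow> poly p z \<noteq> 0 \<and> a < absval z \<and> absval z < b"
    unfolding eventually_at by (auto simp: dist_eq_absval)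
  have \<alpha>0: "\<alpha> \<noteq> 0" using \<alpha> by auto
  show ?thesis
  proof (rule polar_expansion_of_sums[OF \<alpha>0, where r = "min r r'" and K = K and t = t])
    fix z assume z: "z \<noteq> \<alpha>" "absval (z - \<alpha>) < min r r'"
    have z': "poly p z \<noteq> 0" "a < absval z" "absval z < b" using r'(2)[OF z(1)] z(2) by auto
    have pz: "poly p z = (z - \<alpha>) ^ K * poly p1 z"
      using arg_cong[OF p1(1), of "\<lambda>p. poly p z"] by (simp add: K_def poly_power)
    then have "poly p1 z \<noteq> 0" using z' by auto
    then have "(\<lambda>j. t j * (z - \<alpha>) ^ j) sums (laurent_sum h z / poly p1 z)"
      using t z z' by simp
    also have "laurent_sum h z / poly p1 z = f z * (z - \<alpha>) ^ K"
      using f[OF z'(2,3,1)] z(1) by (simp add: pz)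
    finally show "(\<lambda>j. t j * (z - \<alpha>) ^ j) sums (f z * (z - \<alpha>) ^ K)" .
  qed (use r r' in auto)
qed

text \<open>Induction on the degree of p, splitting off a root \<beta>. For \<beta> outside the open
  annulus 1/(z - \<beta>) is itself a Laurent series; for \<beta> inside, boundedness of the
  quotient forces h to vanish at \<beta>, so z - \<beta> divides h.\<close>

lemma bounded_quotient_is_laurent:
  fixes h :: "int \<Rightarrow> 'a::{nonarch_valued_field,complete_space,alg_closed_field}"
    and q :: 'a
  assumes q: "q \<noteq> 0" "absval q < 1"
    and "laurent_bounded a b h" and ab: "0 < a" "a < b" and "p \<noteq> 0"
    and "\<And>\<alpha>. a < absval \<alpha> \<Longrightarrow> absval \<alpha> < b \<Longrightarrow> bdd_near (\<lambda>z. laurent_sum h z / poly p z) \<alpha>"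
  shows "\<exists>H. laurent_bounded a b H \<and>
    (\<forall>z. a < absval z \<and> absval z < b \<and> poly p z \<noteq> 0 \<longrightarrow> laurent_sum h z / poly p z = laurent_sum H z)"
  using assms(3,6,7)
proof (induction "degree p" arbitrary: p h)
  case 0
  then obtain d where p: "p = [:d:]" by (metis degree_eq_zeroE)
  then have "laurent_sum h z / poly p z = laurent_sum (\<lambda>n. inverse d * h n) z" if "a < absval z" "absval z < b" for z
    using laurent_sum_cmult[OF 0(2) ab(1) that] by (simp add: divide_inverse mult.commute)
  then show ?case using laurent_bounded_cmult[OF 0(2)] by blast
next
  case (Suc n)
  obtain \<beta> where \<beta>: "poly p \<beta> = 0" using alg_closed_imp_poly_has_root[of p] Suc(2) by auto
  then obtain p1 where p1: "p = [:- \<beta>, 1:] * p1" by (metis dvdE poly_eq_0_iff_dvd)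
  have p1nz: "p1 \<noteq> 0" using Suc(4) p1 by auto
  have "degree p = Suc (degree p1)" unfolding p1 using p1nz by (subst degree_mult_eq) auto
  then have deg: "n = degree p1" using Suc(2) by simp
  have pz: "poly p z = (z - \<beta>) * poly p1 z" for z by (simp add: p1 algebra_simps)
  have "\<exists>g. laurent_bounded a b g \<and> (\<forall>z. a < absval z \<longrightarrow> absval z < b \<longrightarrow> z \<noteq> \<beta> \<longrightarrow>
      laurent_sum h z / (z - \<beta>) = laurent_sum g z)"
  proof (cases "a < absval \<beta> \<and> absval \<beta> < b")
    case True
    then have \<beta>_in: "a < absval \<beta>" "absval \<beta> < b" by auto
    obtain C where C: "gauss_le a C h" "gauss_le b C h" using Suc(3) ab(1) by (rule laurent_boundedE)
    let ?l = "laurent_sum h \<beta>"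
    have bl: "laurent_bounded a b (\<lambda>n. h n - laurent_monom ?l 0 n)"
      using Suc(3) ab by (intro laurent_bounded_diff) auto
    have sl: "laurent_sum (\<lambda>n. h n - laurent_monom ?l 0 n) z = laurent_sum h z - ?l"
      if "a < absval z" "absval z < b" for z
      using laurent_sum_diff[OF Suc(3) laurent_bounded_monom ab(1) that] by simp
    obtain C where C: "gauss_le a C (\<lambda>n. h n - laurent_monom ?l 0 n)" "gauss_le b C (\<lambda>n. h n - laurent_monom ?l 0 n)"
      using bl ab(1) by (rule laurent_boundedE)
    obtain g where g: "gauss_le a (C / a) g" "gauss_le b (C / a) g"
      "\<And>z. a < absval z \<Longrightarrow> absval z < b \<Longrightarrow> laurent_sum (\<lambda>n. h n - laurent_monom ?l 0 n) z = (z - \<beta>) * laurent_sum g z"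
      using laurent_divide_linear[OF C ab(1) \<beta>_in] sl[OF \<beta>_in] by auto
    have bg: "laurent_bounded a b g" using g(1,2) by (rule laurent_boundedI)
    have hz: "laurent_sum h z = ?l + (z - \<beta>) * laurent_sum g z" if "a < absval z" "absval z < b" for z
      using g(3)[OF that] sl[OF that] by (simp add: algebra_simps)
    have "?l = 0"
    proof (rule ccontr)
      assume l: "?l \<noteq> 0"
      \<comment> \<open>Multiplying by the cofactor p1 and subtracting g isolates h(\<beta>)/(z -
        \<beta>), a bounded principal part of order 1, whose coefficient must be 0.\<close>
      have "bdd_near (\<lambda>z. (laurent_sum h z / poly p z) * poly p1 z - laurent_sum g z) \<beta>"
        by (intro bdd_near_diff bdd_near_mult Suc(5)[OF \<beta>_in] laurent_sum_bdd_near[OF bg ab(1) \<beta>_in]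
            bdd_near_tendsto[OF tendsto_poly_valued[OF tendsto_ident_at]])
      moreover have "\<forall>\<^sub>F z in at \<beta>. (\<Sum>k\<in>{1::nat}. (?l / (- \<beta>)) / (1 - z / \<beta>) ^ k) =
          (laurent_sum h z / poly p z) * poly p1 z - laurent_sum g z"
        using eventually_in_annulus[OF \<beta>_in] eventually_poly_nonzero[OF Suc(4)]
      proof eventually_elim
        case (elim z)
        have \<beta>0: "\<beta> \<noteq> 0" using \<beta>_in ab by auto
        have nz: "z - \<beta> \<noteq> 0" "poly p1 z \<noteq> 0" using elim pz by auto
        have "(laurent_sum h z / poly p z) * poly p1 z - laurent_sum g z = ?l / (z - \<beta>)"
        proof -
          have "(laurent_sum h z / poly p z) * poly p1 z = laurent_sum h z / (z - \<beta>)"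
            using nz by (simp add: pz)
          also have "\<dots> = ?l / (z - \<beta>) + laurent_sum g z"
            using hz[of z] elim nz by (simp add: add_divide_distrib)
          finally show ?thesis by simp
        qed
        moreover have "- \<beta> * (1 - z / \<beta>) = z - \<beta>" using \<beta>0 by (simp add: field_simps)
        then have "?l / (- \<beta>) / (1 - z / \<beta>) ^ 1 = ?l / (z - \<beta>)"
          by (simp only: power_one_right divide_divide_eq_left)
        ultimately show ?case by simp
      qed
      ultimately have "bdd_near (\<lambda>z. \<Sum>k\<in>{1::nat}. (?l / (- \<beta>)) / (1 - z / \<beta>) ^ k) \<beta>"
        by (rule bdd_near_eventually_eq[rotated])
      then have "?l / (- \<beta>) = 0"
        using bdd_near_principal_zero[OF q, of \<beta> "{1}" "\<lambda>_. ?l / (- \<beta>)" 1] \<beta>_in ab by auto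
      then show False using l \<beta>_in ab by auto
    qed
    then have "laurent_sum h z / (z - \<beta>) = laurent_sum g z" if "a < absval z" "absval z < b" "z \<noteq> \<beta>" for z
      using hz[OF that(1,2)] that(3) by simp
    then show ?thesis using bg by blast
  next
    case False
    then have "absval \<beta> \<le> a \<or> b \<le> absval \<beta>" by auto
    from inverse_linear_outside[OF ab this] obtain e where e: "laurent_bounded a b e"
      "\<And>z. a < absval z \<Longrightarrow> absval z < b \<Longrightarrow> (z - \<beta>) * laurent_sum e z = 1" by blast
    have "laurent_sum h z / (z - \<beta>) = laurent_sum (conv h e) z" if "a < absval z" "absval z < b" "z \<noteq> \<beta>" for z
      using laurent_sum_conv[OF Suc(3) e(1) ab(1) that(1,2)] e(2)[OF that(1,2)] that(3)
      by (simp add: divide_inverse inverse_unique)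
    moreover have "laurent_bounded a b (conv h e)"
      using Suc(3) e(1) ab by (intro laurent_bounded_conv) auto
    ultimately show ?thesis by blast
  qed
  then obtain g where g: "laurent_bounded a b g"
    "\<And>z. a < absval z \<Longrightarrow> absval z < b \<Longrightarrow> z \<noteq> \<beta> \<Longrightarrow> laurent_sum h z / (z - \<beta>) = laurent_sum g z" by blast
  have eq: "laurent_sum h z / poly p z = laurent_sum g z / poly p1 z"
    if "a < absval z" "absval z < b" "z \<noteq> \<beta>" for z
    using g(2)[OF that] by (simp add: pz flip: divide_divide_eq_left)
  have "bdd_near (\<lambda>z. laurent_sum g z / poly p1 z) \<alpha>" if \<alpha>: "a < absval \<alpha>" "absval \<alpha> < b" for \<alpha>
  proof (rule bdd_near_eventually_eq[OF _ Suc(5)[OF \<alpha>]])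
    have "\<forall>\<^sub>F z in at \<alpha>. z \<noteq> \<beta>" using eventually_at_not_in_finite[of "{\<beta>}" \<alpha>] by simp
    with eventually_in_annulus[OF \<alpha>] show "\<forall>\<^sub>F z in at \<alpha>. laurent_sum g z / poly p1 z = laurent_sum h z / poly p z"
      by eventually_elim (simp add: eq)
  qed
  from Suc(1)[OF deg g(1) p1nz this] obtain H where H: "laurent_bounded a b H"
    "\<And>z. a < absval z \<and> absval z < b \<and> poly p1 z \<noteq> 0 \<Longrightarrow> laurent_sum g z / poly p1 z = laurent_sum H z" by blast
  have "laurent_sum h z / poly p z = laurent_sum H z" if "a < absval z" "absval z < b" "poly p z \<noteq> 0" for z
  proof -
    have "z \<noteq> \<beta>" "poly p1 z \<noteq> 0" using that(3) by (auto simp: pz)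
    then show ?thesis using eq H(2) that by simp
  qed
  with H(1) show ?case by blast
qed

subsection \<open>Power series with integral coefficients\<close>

definition ser :: "(nat \<Rightarrow> 'a::valued_field) \<Rightarrow> 'a \<Rightarrow> 'a" where
  "ser e y = (\<Sum>\<^sub>\<infinity>n. e n * y ^ n)"

lemma ser_has_sum:
  fixes y :: "'a::{valued_field,complete_space}"
  assumes "\<And>n. absval (e n) \<le> 1" "absval y < 1"
  shows "((\<lambda>n. e n * y ^ n) has_sum ser e y) UNIV"
proof -
  have "(\<lambda>n. e n * y ^ n) summable_on UNIV"
  proof (rule absval_summable_on_comparison)
    show "(\<lambda>n. absval y ^ n) summable_on UNIV"
      using has_sum_nat_geometric[of "absval y"] assms(2) by (auto intro: has_sum_imp_summable)
    show "absval (e n * y ^ n) \<le> absval y ^ n" for n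
      using mult_right_mono[OF assms(1), of "absval y ^ n" n] by (simp add: absval_mult absval_power)
  qed
  then show ?thesis unfolding ser_def by (rule has_sum_infsum)
qed

lemma absval_ser_le:
  fixes y :: "'a::{nonarch_valued_field,complete_space}"
  assumes e: "\<And>n. absval (e n) \<le> 1" "e 0 = 0" and y: "absval y < 1"
  shows "absval (ser e y) \<le> absval y"
  unfolding ser_def
proof (rule absval_infsum_le_bound)
  fix n :: nat
  show "absval (e n * y ^ n) \<le> absval y"
  proof (cases n)
    case (Suc m)
    have "absval (e n) * absval y ^ n \<le> 1 * absval y ^ 1"
      using e y Suc by (intro mult_mono power_decreasing) auto
    then show ?thesis by (simp add: absval_mult absval_power)
  qed (simp add: e)
qed simp

text \<open>Division by 1 - y replaces coefficients by their partial sums, and over an ultrametric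
  field these stay in the unit ball.\<close>

lemma ser_partial_sums:
  fixes y :: "'a::{nonarch_valued_field,complete_space}"
  assumes e: "\<And>n. absval (e n) \<le> 1" and y: "absval y < 1"
  shows "absval (\<Sum>m\<le>n. e m) \<le> 1" "(1 - y) * ser (\<lambda>n. \<Sum>m\<le>n. e m) y = ser e y"
proof -
  let ?s = "\<lambda>n. \<Sum>m\<le>n. e m"
  show s: "absval (?s n) \<le> 1" for n by (intro absval_sum_le_bound e) auto
  define f where "f n = (case n of 0 \<Rightarrow> 0 | Suc m \<Rightarrow> y * (?s m * y ^ m))" for n
  have hs: "((\<lambda>n. ?s n * y ^ n) has_sum ser ?s y) UNIV" by (rule ser_has_sum[OF s y])
  have "((\<lambda>n. f (Suc n)) has_sum y * ser ?s y) UNIV"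
    unfolding f_def nat.case by (rule has_sum_cmult_right[OF hs])
  from has_sum_Suc[where f = f, OF this] have "(f has_sum y * ser ?s y) UNIV" by (simp add: f_def[of 0])
  from has_sum_add[OF hs has_sum_cmult_right[OF this, of "-1"]]
  have "((\<lambda>n. ?s n * y ^ n + - 1 * f n) has_sum (ser ?s y + - 1 * (y * ser ?s y))) UNIV" .
  also have "(\<lambda>n. ?s n * y ^ n + - 1 * f n) = (\<lambda>n. e n * y ^ n)"
  proof
    fix n show "?s n * y ^ n + - 1 * f n = e n * y ^ n"
      by (cases n) (simp_all add: f_def algebra_simps)
  qed
  finally show "(1 - y) * ser ?s y = ser e y"
    unfolding ser_def[of e] by (simp add: infsumI left_diff_distrib)
qed

text \<open>Induction on the exponent of 1/(1 - y). As j \<ge> 1 the constant term vanishes, which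
  later gives |psi| \<le> |y| on the open unit disc.\<close>

lemma psi_eq_ser:
  fixes j k :: nat
  assumes j: "1 \<le> j"
  obtains e :: "nat \<Rightarrow> 'a::{nonarch_valued_field,complete_space}"
  where "\<And>n. absval (e n) \<le> 1" "e 0 = 0" "\<And>y. absval y < 1 \<Longrightarrow> psi j k y = ser e y"
proof -
  have "\<exists>e. (\<forall>n. absval (e n) \<le> 1) \<and> e 0 = 0 \<and> (\<forall>y::'a. absval y < 1 \<longrightarrow> y ^ j / (1 - y) ^ k = ser e y)" for k
  proof (induction k)
    case 0
    define e where "e n = (if n = j then 1 else 0 :: 'a)" for n
    have "ser e y = y ^ j" for y :: 'a
    proof -
      have "((\<lambda>n. e n * y ^ n) has_sum y ^ j) {j}" by (rule has_sum_finiteI) (auto simp: e_def)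
      then have "((\<lambda>n. e n * y ^ n) has_sum y ^ j) UNIV"
        by (rule has_sum_cong_neutral[THEN iffD1, rotated -1]) (auto simp: e_def)
      then show ?thesis unfolding ser_def by (rule infsumI)
    qed
    moreover have "absval (e n) \<le> 1" "e 0 = 0" for n using j by (auto simp: e_def)
    ultimately show ?case by (intro exI[of _ e]) simp
  next
    case (Suc k)
    then obtain e where e: "\<And>n. absval (e n) \<le> 1" "e 0 = 0" "\<And>y::'a. absval y < 1 \<Longrightarrow> y ^ j / (1 - y) ^ k = ser e y"
      by blast
    have "y ^ j / (1 - y) ^ Suc k = ser (\<lambda>n. \<Sum>m\<le>n. e m) y" if y: "absval y < 1" for y :: 'a
    proof -
      have "1 - y \<noteq> 0" using y by auto
      have "y ^ j / (1 - y) ^ Suc k = (y ^ j / (1 - y) ^ k) / (1 - y)" by simp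
      also have "\<dots> = (1 - y) * ser (\<lambda>n. \<Sum>m\<le>n. e m) y / (1 - y)"
        unfolding e(3)[OF y] ser_partial_sums(2)[OF e(1) y] ..
      finally show ?thesis using \<open>1 - y \<noteq> 0\<close> by simp
    qed
    moreover have "absval (\<Sum>m\<le>n. e m) \<le> 1" for n
      using ser_partial_sums(1)[OF e(1), of 0] by simp
    ultimately show ?case using e(2) by (intro exI[of _ "\<lambda>n. \<Sum>m\<le>n. e m"]) auto
  qed
  from this[of "k + 1"] show ?thesis using that unfolding psi_def by blast
qed

text \<open>Multiplication by d maps the annulus into the open unit disc, so the coefficients e(n)
  d^n have Gauss norm at most 1 at both radii.\<close>

lemma laurent_of_ser:
  fixes d :: "'a::{nonarch_valued_field,complete_space}"
  assumes e: "\<And>n. absval (e n) \<le> 1" and ab: "0 < a" "a < b" and d: "absval d * b \<le> 1"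
  obtains u where "laurent_bounded a b u"
    "\<And>z. a < absval z \<Longrightarrow> absval z < b \<Longrightarrow> laurent_sum u z = ser e (d * z)"
proof -
  define u where "u n = (if 0 \<le> n then e (nat n) * d ^ nat n else 0)" for n
  have "gauss_le r 1 u" if r: "0 < r" "r \<le> b" for r
    unfolding gauss_le_def
  proof
    fix n
    show "absval (u n) * r powi n \<le> 1"
    proof (cases "0 \<le> n")
      case True
      have "absval d * r \<le> 1" using d r by (meson absval_nonneg mult_left_mono order.trans)
      then have "absval (e (nat n)) * (absval d * r) ^ nat n \<le> 1 * 1"
        using e r by (intro mult_mono power_le_one) auto
      then show ?thesis using True
        by (simp add: u_def absval_mult absval_power power_mult_distrib power_int_def mult.assoc)
    qed (simp add: u_def)
  qed
  then have "laurent_bounded a b u" using ab by (intro laurent_boundedI[of a 1 u b 1]) auto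
  moreover have "laurent_sum u z = ser e (d * z)" if z: "a < absval z" "absval z < b" for z
  proof (rule laurent_sum_eqI)
    have z0: "z \<noteq> 0" using z ab by auto
    have "absval (d * z) < 1"
    proof (cases "d = 0")
      case False
      then have "absval d * absval z < absval d * b" using z by (intro mult_strict_left_mono) auto
      then show ?thesis using d by (simp add: absval_mult)
    qed simp
    from ser_has_sum[OF e this]
    have "((\<lambda>n. u (int n) * z powi int n) has_sum ser e (d * z)) UNIV"
      by (simp add: u_def power_mult_distrib mult.assoc)
    moreover have "((\<lambda>n. u (- int (Suc n)) * z powi (- int (Suc n))) has_sum 0) UNIV"
      by (simp add: u_def)
    ultimately show "((\<lambda>n. u n * z powi n) has_sum ser e (d * z)) UNIV"
      using has_sum_int_split[of "\<lambda>n. u n * z powi n"] by fastforce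
  qed
  ultimately show ?thesis using that by blast
qed

lemma laurent_sum_reflect:
  fixes u :: "int \<Rightarrow> 'a::{valued_field,complete_space}"
  shows "laurent_sum (\<lambda>n. u (- n)) z = laurent_sum u (inverse z)"
proof -
  have bij: "bij_betw uminus UNIV (UNIV :: int set)" by (rule bij_betwI[of _ _ _ uminus]) auto
  have "laurent_sum u (inverse z) = infsum (\<lambda>n. u (- n) * inverse z powi (- n)) UNIV"
    unfolding laurent_sum_def by (rule infsum_reindex_bij_betw[OF bij, symmetric])
  also have "\<dots> = laurent_sum (\<lambda>n. u (- n)) z"
    unfolding laurent_sum_def by (simp add: power_int_minus power_int_inverse)
  finally show ?thesis by simp
qed

lemma laurent_bounded_reflect:
  assumes "laurent_bounded a b u" "0 < a" "0 < b"
  shows "laurent_bounded (inverse b) (inverse a) (\<lambda>n. u (- n))"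
proof -
  obtain C where C: "gauss_le a C u" "gauss_le b C u" using assms by (auto elim: laurent_boundedE)
  have "gauss_le (inverse r) C (\<lambda>n. u (- n))" if "gauss_le r C u" for r
    unfolding gauss_le_def
  proof
    fix n show "absval (u (- n)) * inverse r powi n \<le> C"
      using gauss_leD[OF that, of "- n"] by (simp add: power_int_minus power_int_inverse)
  qed
  then show ?thesis using C by (intro laurent_boundedI)
qed

text \<open>Outside a suitable finite set each term is the difference of two partial sums within 1
  of the limit. This extracts Gauss bounds from convergence on a closed annulus.\<close>

lemma summable_on_terms_bounded:
  fixes f :: "'b \<Rightarrow> 'a::valued_field"
  assumes "f summable_on UNIV"
  shows "\<exists>C. \<forall>x. absval (f x) \<le> C"
proof -
  obtain s where "(f has_sum s) UNIV" using assms by (auto simp: summable_on_def)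
  then have "\<forall>\<^sub>F S in finite_subsets_at_top UNIV. dist (sum f S) s < 1"
    unfolding has_sum_def by (rule tendstoD) simp
  then obtain S where S: "finite S" "\<And>T. finite T \<Longrightarrow> S \<subseteq> T \<Longrightarrow> dist (sum f T) s < 1"
    unfolding eventually_finite_subsets_at_top by auto
  have out: "absval (f x) \<le> 2" if "x \<notin> S" for x
  proof -
    have "absval (f x) = dist (sum f (insert x S)) (sum f S)"
      using that S(1) by (simp add: dist_eq_absval)
    also have "\<dots> \<le> dist (sum f (insert x S)) s + dist (sum f S) s"
      by (rule dist_triangle2)
    also have "\<dots> \<le> 1 + 1" 
      using S(2)[OF _ subset_insertI, of x] S(2)[of S] S(1) by (intro add_mono) auto
    finally show ?thesis by simp
  qed
  have "absval (f x) \<le> Max (insert 2 ((\<lambda>x. absval (f x)) ` S))" for x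
  proof (cases "x \<in> S")
    case True then show ?thesis using S(1) by (intro Max_ge) auto
  next
    case False
    then have "absval (f x) \<le> 2" by (rule out)
    also have "\<dots> \<le> Max (insert 2 ((\<lambda>x. absval (f x)) ` S))" using S(1) by (intro Max_ge) auto
    finally show ?thesis .
  qed
  then show ?thesis by blast
qed

subsection \<open>Rigid meromorphic functions\<close>

locale rigid_multiplier = multiplier q
  for q :: "'a::{nonarch_valued_field,complete_space,alg_closed_field}"
begin

text \<open>The circles of radius |q|^i and |q|^(-i) contain points of the field, so convergence
  there yields Gauss bounds; and multiplication by q carries each inner circle to the next.\<close>

definition ra :: "nat \<Rightarrow> real" where "ra i = absval q ^ i"
definition rb :: "nat \<Rightarrow> real" where "rb i = inverse (absval q ^ i)"

lemma r_pos [simp]: "0 < ra i" "0 < rb i"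
  by (simp_all add: ra_def rb_def)

lemma r_less: "1 \<le> i \<Longrightarrow> ra i < 1" "1 \<le> i \<Longrightarrow> 1 < rb i" "1 \<le> i \<Longrightarrow> ra i < rb i"
proof -
  assume "1 \<le> i"
  then show "ra i < 1" unfolding ra_def using q_lt by (simp add: power_less_one_iff)
  then show "1 < rb i" by (simp add: rb_def ra_def one_less_inverse_iff)
  with \<open>ra i < 1\<close> show "ra i < rb i" by linarith
qed

lemma r_Suc: "ra (Suc i) < ra i" "rb i < rb (Suc i)"
proof -
  have "absval q * absval q ^ i < 1 * absval q ^ i"
    using q_lt by (intro mult_strict_right_mono) auto
  then show "ra (Suc i) < ra i" by (simp add: ra_def)
  then show "rb i < rb (Suc i)" unfolding rb_def ra_def by (intro less_imp_inverse_less) auto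
qed

lemma annulus_nonzero: "ra i < absval z \<Longrightarrow> z \<noteq> (0::'a)"
  using r_pos(1)[of i] by (metis absval_0 less_asym)

lemma ex_annulus:
  assumes "0 < a" obtains i where "k \<le> i" "ra i < a" "b < rb i"
proof -
  have lim: "(\<lambda>i. absval q ^ i) \<longlonglongrightarrow> 0" using q_lt by (intro LIMSEQ_realpow_zero) auto
  have "\<forall>\<^sub>F i in sequentially. absval q ^ i < a" "\<forall>\<^sub>F i in sequentially. absval q ^ i < inverse (max 1 b)"
    using assms by (auto intro!: order_tendstoD(2)[OF lim])
  then have "\<forall>\<^sub>F i in sequentially. k \<le> i \<and> absval q ^ i < a \<and> absval q ^ i < inverse (max 1 b)"
    using eventually_ge_at_top[of k] by eventually_elim auto
  then obtain i where i: "k \<le> i" "absval q ^ i < a" "absval q ^ i < inverse (max 1 b)"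
    by (auto simp: eventually_sequentially)
  have "inverse (inverse (max 1 b)) < inverse (absval q ^ i)"
    using i(3) by (intro less_imp_inverse_less) auto
  then show ?thesis using i that by (simp add: ra_def rb_def)
qed

text \<open>A Laurent series over a polynomial on the i-th annulus. Values at the roots of p are
  left free, in keeping with the irrelevance of values at poles.\<close>

definition quot :: "nat \<Rightarrow> ('a \<Rightarrow> 'a) \<Rightarrow> bool" where
  "quot i f \<longleftrightarrow> (\<exists>h p. laurent_bounded (ra i) (rb i) h \<and> p \<noteq> 0 \<and>
    (\<forall>z. ra i < absval z \<longrightarrow> absval z < rb i \<longrightarrow> poly p z \<noteq> 0 \<longrightarrow> f z = laurent_sum h z / poly p z))"

lemma laurent_converges_imp_bounded:
  assumes "laurent_converges (ra i) (rb i) (u :: int \<Rightarrow> 'a)" "1 \<le> i"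
  shows "laurent_bounded (ra i) (rb i) u"
proof -
  have "\<exists>C. gauss_le (absval z) C u" if "ra i \<le> absval z" "absval z \<le> rb i" for z :: 'a
  proof -
    have "(\<lambda>n. u n * z powi n) summable_on UNIV"
      using assms that by (simp add: laurent_converges_def)
    from summable_on_terms_bounded[OF this] show ?thesis
      by (simp add: gauss_le_def absval_mult absval_powi)
  qed
  from this[of "q ^ i"] this[of "inverse (q ^ i)"] show ?thesis
    using r_less(3)[OF assms(2)]
    by (auto simp: absval_power absval_inverse ra_def rb_def intro: laurent_boundedI)
qed

text \<open>The fraction u/v is taken on the next larger annulus, since making the denominator
  polynomial shrinks the annulus. Both parts are multiplied by Q, and the unit z^k is absorbed in
  the numerator.\<close>

lemma rigid_imp_quot:
  assumes f: "f \<in> rigid_meromorphic" and i: "1 \<le> i"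
  shows "quot i f"
proof -
  let ?a = "ra (Suc i)" and ?b = "rb (Suc i)"
  have "0 < ?a \<and> ?a < ?b" using r_less(3)[of "Suc i"] by simp
  with f obtain u v n1 where uv: "laurent_converges ?a ?b u" "laurent_converges ?a ?b v" "v n1 \<noteq> 0"
    and fz: "\<And>z. ?a \<le> absval z \<Longrightarrow> absval z \<le> ?b \<Longrightarrow> laurent_sum v z \<noteq> 0 \<Longrightarrow> f z = laurent_sum u z / laurent_sum v z"
    unfolding rigid_meromorphic_def by blast
  have bu: "laurent_bounded ?a ?b u" and bv: "laurent_bounded ?a ?b v"
    using uv by (auto intro: laurent_converges_imp_bounded)
  obtain Q p k where Q: "laurent_bounded (ra i) (rb i) Q" "p \<noteq> 0"
    "\<And>z. ra i < absval z \<Longrightarrow> absval z < rb i \<Longrightarrow> laurent_sum v z * laurent_sum Q z = z powi k * poly p z"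
    using laurent_divides_polynomial[OF bv uv(3) _ r_Suc(1) r_less(3)[OF i] r_Suc(2)] by auto
  have bu': "laurent_bounded (ra i) (rb i) u"
    using r_Suc[of i] r_less(3)[OF i] by (intro laurent_bounded_subset[OF bu]) auto
  let ?uQ = "conv u Q"
  have buQ: "laurent_bounded (ra i) (rb i) ?uQ" by (intro laurent_bounded_conv bu' Q) auto
  let ?h = "conv (laurent_monom 1 (- k)) ?uQ"
  have "f z = laurent_sum ?h z / poly p z" if z: "ra i < absval z" "absval z < rb i" "poly p z \<noteq> 0" for z
  proof -
    have z0: "z \<noteq> 0" using z(1) by (rule annulus_nonzero)
    have nz: "laurent_sum v z \<noteq> 0" "laurent_sum Q z \<noteq> 0" using Q(3)[OF z(1,2)] z(3) z0 by auto
    have "f z = laurent_sum u z / laurent_sum v z"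
      using z r_Suc[of i] nz by (intro fz) auto
    also have "\<dots> = laurent_sum u z * laurent_sum Q z / (laurent_sum v z * laurent_sum Q z)"
      using nz by simp
    also have "\<dots> = laurent_sum ?h z / poly p z"
      unfolding Q(3)[OF z(1,2)]
      using laurent_sum_conv[OF laurent_bounded_monom buQ r_pos(1) z(1,2), of 1 "- k"]
        laurent_sum_conv[OF bu' Q(1) r_pos(1) z(1,2)] z0
      by (simp add: power_int_minus divide_inverse mult_ac)
    finally show ?thesis .
  qed
  moreover have "laurent_bounded (ra i) (rb i) ?h" by (intro laurent_bounded_conv buQ) auto
  ultimately show ?thesis using Q(2) unfolding quot_def by blast
qed

lemma quot_imp_rigid:
  assumes "\<And>i. 1 \<le> i \<Longrightarrow> quot i f"
  shows "f \<in> rigid_meromorphic"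
  unfolding rigid_meromorphic_def
proof (intro CollectI allI impI)
  fix a b :: real assume ab: "0 < a \<and> a < b"
  then obtain i where i: "1 \<le> i" "ra i < a" "b < rb i" using ex_annulus by blast
  from assms[OF i(1)] obtain h p where h: "laurent_bounded (ra i) (rb i) h" "p \<noteq> 0"
    "\<And>z. ra i < absval z \<Longrightarrow> absval z < rb i \<Longrightarrow> poly p z \<noteq> 0 \<Longrightarrow> f z = laurent_sum h z / poly p z"
    unfolding quot_def by blast
  have conv: "laurent_converges a b u" if "laurent_bounded (ra i) (rb i) u" for u :: "int \<Rightarrow> 'a"
    unfolding laurent_converges_def
    using i by (auto intro!: has_sum_imp_summable[OF laurent_has_sum[OF that r_pos(1)]])
  have "laurent_poly p (int (degree p)) \<noteq> 0" using h(2) by (simp add: laurent_poly_def)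
  moreover have "f z = laurent_sum h z / laurent_sum (laurent_poly p) z"
    if "a \<le> absval z \<and> absval z \<le> b \<and> laurent_sum (laurent_poly p) z \<noteq> 0" for z
    using that i by (simp add: h(3))
  ultimately show "\<exists>u v. laurent_converges a b u \<and> laurent_converges a b v \<and> (\<exists>n. v n \<noteq> 0) \<and>
      (\<forall>z. a \<le> absval z \<and> absval z \<le> b \<and> laurent_sum v z \<noteq> 0 \<longrightarrow> f z = laurent_sum u z / laurent_sum v z)"
    using conv[OF h(1)] conv[OF laurent_bounded_poly] by blast
qed

lemma rigid_iff_quot: "f \<in> rigid_meromorphic \<longleftrightarrow> (\<forall>i\<ge>1. quot i f)"
  using rigid_imp_quot quot_imp_rigid by blast

section \<open>Closure properties of quotients with polynomial denominators\<close>

lemma quot_add: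
  assumes "quot i f" "quot i g"
  shows "quot i (\<lambda>z. f z + g z)"
proof -
  from assms obtain h1 p1 h2 p2 where h1: "laurent_bounded (ra i) (rb i) h1" "p1 \<noteq> 0"
    "\<And>z. ra i < absval z \<Longrightarrow> absval z < rb i \<Longrightarrow> poly p1 z \<noteq> 0 \<Longrightarrow> f z = laurent_sum h1 z / poly p1 z"
    and h2: "laurent_bounded (ra i) (rb i) h2" "p2 \<noteq> 0"
    "\<And>z. ra i < absval z \<Longrightarrow> absval z < rb i \<Longrightarrow> poly p2 z \<noteq> 0 \<Longrightarrow> g z = laurent_sum h2 z / poly p2 z"
    unfolding quot_def by blast
  let ?u1 = "conv (laurent_poly p2) h1" and ?u2 = "conv (laurent_poly p1) h2"
  have b: "laurent_bounded (ra i) (rb i) ?u1" "laurent_bounded (ra i) (rb i) ?u2"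
    by (intro laurent_bounded_conv_poly h1 h2 r_pos)+
  have "f z + g z = laurent_sum (\<lambda>n. ?u1 n + ?u2 n) z / poly (p1 * p2) z"
    if z: "ra i < absval z" "absval z < rb i" "poly (p1 * p2) z \<noteq> 0" for z
    using z h1(3)[OF z(1,2)] h2(3)[OF z(1,2)]
    by (simp add: laurent_sum_add[OF b r_pos(1) z(1,2)] laurent_sum_conv_poly[OF h1(1) r_pos(1) z(1,2)]
        laurent_sum_conv_poly[OF h2(1) r_pos(1) z(1,2)] add_divide_distrib)
  moreover have "laurent_bounded (ra i) (rb i) (\<lambda>n. ?u1 n + ?u2 n)" by (intro laurent_bounded_add b r_pos)
  moreover have "p1 * p2 \<noteq> 0" using h1(2) h2(2) by simp
  ultimately show ?thesis unfolding quot_def by blast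
qed

lemma quot_cmult:
  assumes "quot i f" shows "quot i (\<lambda>z. c * f z)"
proof -
  from assms obtain h p where h: "laurent_bounded (ra i) (rb i) h" "p \<noteq> 0"
    "\<And>z. ra i < absval z \<Longrightarrow> absval z < rb i \<Longrightarrow> poly p z \<noteq> 0 \<Longrightarrow> f z = laurent_sum h z / poly p z"
    unfolding quot_def by blast
  have "c * f z = laurent_sum (\<lambda>n. c * h n) z / poly p z"
    if z: "ra i < absval z" "absval z < rb i" "poly p z \<noteq> 0" for z
    using h(3)[OF z] laurent_sum_cmult[OF h(1) r_pos(1) z(1,2), of c] by simp
  then show ?thesis using h laurent_bounded_cmult unfolding quot_def by blast
qed

lemma quot_cong:
  assumes "quot i g" "\<And>z. ra i < absval z \<Longrightarrow> absval z < rb i \<Longrightarrow> f z = g z"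
  shows "quot i f"
  using assms unfolding quot_def by simp

lemma quot_laurent:
  assumes "laurent_bounded (ra i) (rb i) u"
    and "\<And>z. ra i < absval z \<Longrightarrow> absval z < rb i \<Longrightarrow> f z = laurent_sum u z"
  shows "quot i f"
  unfolding quot_def using assms by (intro exI[of _ u] exI[of _ 1]) auto

lemma quot_rational:
  assumes "p \<noteq> 0"
    and "\<And>z. ra i < absval z \<Longrightarrow> absval z < rb i \<Longrightarrow> poly p z \<noteq> 0 \<Longrightarrow> f z = poly r z / poly p z"
  shows "quot i f"
  unfolding quot_def using assms by (intro exI[of _ "laurent_poly r"] exI[of _ p]) auto

lemma quot_sum:
  "finite A \<Longrightarrow> (\<And>x. x \<in> A \<Longrightarrow> quot i (F x)) \<Longrightarrow> quot i (\<lambda>z. \<Sum>x\<in>A. F x z)"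
proof (induction A rule: finite_induct)
  case empty
  then show ?case by (intro quot_rational[of 1 _ _ 0]) auto
qed (auto intro: quot_add)

section \<open>The zeta functions are rigid meromorphic\<close>

lemma quot_psi: "quot i (\<lambda>z. psi j k (d * z))"
proof (rule quot_rational)
  show "[:1, - d:] ^ (k + 1) \<noteq> 0" by (rule power_not_zero) simp
  show "psi j k (d * z) = poly (monom (d ^ j) j) z / poly ([:1, - d:] ^ (k + 1)) z" for z
  proof -
    have "poly ([:1, - d:] ^ (k + 1)) z = (1 - d * z) ^ (k + 1)"
      unfolding poly_power by (simp add: mult.commute)
    then show ?thesis by (simp only: psi_def poly_monom power_mult_distrib)
  qed
qed

lemma quot_psi_inverse: "quot i (\<lambda>z. psi 1 k (d * inverse z))"
proof (rule quot_rational)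
  show "[:- d, 1:] ^ (k + 1) \<noteq> 0" by (rule power_not_zero) simp
  fix z assume "ra i < absval z" and nz: "poly ([:- d, 1:] ^ (k + 1)) z \<noteq> 0"
  then have z: "z \<noteq> 0" by (intro annulus_nonzero)
  have zd: "z - d \<noteq> 0" using nz by auto
  have "1 - d * inverse z = (z - d) / z" using z by (simp add: field_simps)
  then have "psi 1 k (d * inverse z) = d * inverse z * z ^ (k + 1) / (z - d) ^ (k + 1)"
    by (simp add: psi_def power_divide)
  also have "\<dots> = d * z ^ k / (z - d) ^ (k + 1)" using z by simp
  also have "(z - d) ^ (k + 1) = poly ([:- d, 1:] ^ (k + 1)) z"
    unfolding poly_power by simp
  also have "d * z ^ k = poly (monom d k) z" by (simp add: poly_monom)
  finally show "psi 1 k (d * inverse z) = poly (monom d k) z / poly ([:- d, 1:] ^ (k + 1)) z" .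
qed

text \<open>
  The series is forced by \<open>G y - G (q * y) = psi j k (q * y)\<close>, which \<open>W j k\<close> satisfies as well;
  the difference is invariant under \<open>q\<close> and tends to \<open>0\<close> at \<open>0\<close>.
\<close>

lemma W_eq_ser:
  assumes j: "1 \<le> j"
  obtains e where "\<And>n. absval (e n) \<le> 1" "\<And>y. absval y < 1 \<Longrightarrow> W j k y = ser e y"
proof -
  obtain c :: "nat \<Rightarrow> 'a" where c: "\<And>n. absval (c n) \<le> 1" "c 0 = 0"
    "\<And>y. absval y < 1 \<Longrightarrow> psi j k y = ser c y" using psi_eq_ser[OF j] by blast
  define e where "e n = c n * q ^ n / (1 - q ^ n)" for n
  \<comment> \<open>By the ultrametric inequality the divisors 1 - q^n cannot be small, so solving
    the recursion keeps the coefficients integral.\<close>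
  have one: "1 \<le> absval (1 - q ^ n)" if "n \<noteq> 0" for n
  proof (rule ccontr)
    assume "\<not> 1 \<le> absval (1 - q ^ n)"
    moreover have "absval (q ^ n) < 1" using q_lt that by (simp add: absval_power power_less_one_iff)
    moreover have "absval 1 \<le> max (absval (1 - q ^ n)) (absval (q ^ n))"
      using absval_add_le[of "1 - q ^ n" "max (absval (1 - q ^ n)) (absval (q ^ n))" "q ^ n"] by simp
    ultimately show False by simp
  qed
  have qn: "absval (q ^ n) \<le> 1" for n using q_lt by (simp add: absval_power power_le_one)
  have e: "absval (e n) \<le> 1" "e 0 = 0" for n
  proof -
    have "absval (c n) * absval (q ^ n) / absval (1 - q ^ n) \<le> 1 * 1 / 1" if "n \<noteq> 0"
      using c(1)[of n] qn[of n] one[OF that] by (intro frac_le mult_mono) auto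
    then show "absval (e n) \<le> 1" by (cases "n = 0") (auto simp: e_def absval_divide absval_mult c(2))
  qed (simp add: e_def c(2))
  have qy: "absval (q * y) \<le> absval y" for y
    using q_lt by (simp add: absval_mult mult_left_le_one_le)
  have rec: "ser e y - ser e (q * y) = psi j k (q * y)" if y: "absval y < 1" for y
  proof -
    have qy1: "absval (q * y) < 1" using qy[of y] y by linarith
    have "((\<lambda>n. e n * y ^ n + - 1 * (e n * (q * y) ^ n)) has_sum (ser e y + - 1 * ser e (q * y))) UNIV"
      by (intro has_sum_add has_sum_cmult_right ser_has_sum e y qy1)
    moreover have "e n * y ^ n + - 1 * (e n * (q * y) ^ n) = c n * (q * y) ^ n" for n
    proof (cases "n = 0")
      case False
      then have "1 - q ^ n \<noteq> 0" using one[of n] by auto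
      have "e n * y ^ n + - 1 * (e n * (q * y) ^ n) = e n * (1 - q ^ n) * y ^ n"
        by (simp add: power_mult_distrib algebra_simps)
      also have "e n * (1 - q ^ n) = c n * q ^ n" using \<open>1 - q ^ n \<noteq> 0\<close> by (simp add: e_def)
      finally show ?thesis by (simp add: power_mult_distrib mult.assoc)
    qed (simp add: e c)
    ultimately have "((\<lambda>n. c n * (q * y) ^ n) has_sum (ser e y + - 1 * ser e (q * y))) UNIV" by simp
    from has_sum_unique[OF ser_has_sum[OF c(1) qy1] this] show ?thesis
      by (simp add: c(3)[OF qy1])
  qed
  have Wle: "absval (W j k y) \<le> absval y" if y: "absval y < 1" for y
    unfolding W_def
  proof (rule absval_infsum_le_bound)
    fix m :: nat
    have "absval (q ^ Suc m * y) \<le> 1 * absval y"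
      unfolding absval_mult[of "q ^ Suc m"] by (intro mult_right_mono qn) auto
    then have le: "absval (q ^ Suc m * y) \<le> absval y" by simp
    then have "absval (psi j k (q ^ Suc m * y)) \<le> absval (q ^ Suc m * y)"
      using y c by (subst c(3)) (auto intro!: absval_ser_le)
    with le show "absval (psi j k (q ^ Suc m * y)) \<le> absval y" by linarith
  qed simp
  have "W j k y = ser e y" if y: "absval y < 1" for y
  proof (rule ccontr)
    assume ne: "W j k y \<noteq> ser e y"
    define D where "D y = W j k y - ser e y" for y
    have Dq: "D y = D (q ^ J * y)" for J
    proof (induction J)
      case (Suc J)
      have "absval (q ^ J * y) \<le> 1 * absval y"
        unfolding absval_mult using qn by (intro mult_right_mono) auto
      then have "absval (q ^ J * y) < 1" using y by simp
      from rec[OF this] W_rec[OF j, of k "q ^ J * y"] have "D (q ^ J * y) = D (q ^ Suc J * y)"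
        by (simp add: D_def algebra_simps)
      with Suc show ?case by simp
    qed simp
    have "0 < absval (D y)" using ne by (simp add: D_def)
    then obtain J where J: "absval (q ^ J * y) < min 1 (absval (D y))"
      using ex_small_power[of "min 1 (absval (D y))" y] by auto
    have "absval (D (q ^ J * y)) \<le> absval (q ^ J * y)"
      unfolding D_def using J by (intro absval_diff_le Wle absval_ser_le e) auto
    then show False using J Dq[of J] by simp
  qed
  with e(1) that show ?thesis by blast
qed

text \<open>J is chosen so large that q^J d z stays in the open unit disc over the entire annulus,
  where W is a power series; the split terms are rational.\<close>

lemma quot_W:
  assumes j: "1 \<le> j" and i: "1 \<le> i"
  shows "quot i (\<lambda>z. W j k (d * z))"
proof -
  obtain e where e: "\<And>n. absval (e n) \<le> 1" "\<And>y. absval y < 1 \<Longrightarrow> W j k y = ser e y"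
    using W_eq_ser[OF j] by blast
  obtain J where J: "absval (q ^ J * d) < inverse (rb i)"
    using ex_small_power[of "inverse (rb i)" d] by auto
  have J': "absval (q ^ J * d) * rb i < 1"
    using mult_strict_right_mono[OF J, of "rb i"] r_pos(2)[of i] by simp
  obtain u where u: "laurent_bounded (ra i) (rb i) u"
    "\<And>z. ra i < absval z \<Longrightarrow> absval z < rb i \<Longrightarrow> laurent_sum u z = ser e (q ^ J * d * z)"
    using laurent_of_ser[where e = e, OF e(1) r_pos(1) r_less(3)[OF i], of "q ^ J * d"] J' by auto
  have "quot i (\<lambda>z. W j k (q ^ J * d * z))"
  proof (rule quot_laurent[OF u(1)])
    fix z :: 'a assume z: "ra i < absval z" "absval z < rb i"
    have "absval (q ^ J * d * z) \<le> absval (q ^ J * d) * rb i"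
      unfolding absval_mult[of "q ^ J * d"] using z by (intro mult_left_mono) auto
    with J' show "W j k (q ^ J * d * z) = laurent_sum u z"
      using u(2)[OF z] e(2) by simp
  qed
  moreover have "quot i (\<lambda>z. \<Sum>m<J. psi j k ((q ^ Suc m * d) * z))" by (intro quot_sum quot_psi) auto
  ultimately have "quot i (\<lambda>z. (\<Sum>m<J. psi j k ((q ^ Suc m * d) * z)) + W j k (q ^ J * d * z))"
    by (rule quot_add[rotated])
  then show ?thesis
    by (rule quot_cong) (subst W_rec_sum[OF j, of k _ J], simp only: mult.assoc)
qed

text \<open>Passing from z to 1/z reverses the coefficient sequence and exchanges the two radii,
  which are inverse to each other.\<close>

lemma quot_W_inverse:
  assumes i: "1 \<le> i"
  shows "quot i (\<lambda>z. W 1 k (d * inverse z))"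
proof -
  obtain e where e: "\<And>n. absval (e n) \<le> 1" "\<And>y. absval y < 1 \<Longrightarrow> W 1 k y = ser e y"
    using W_eq_ser[of 1 k] by blast
  obtain J where J: "absval (q ^ J * d) < inverse (rb i)"
    using ex_small_power[of "inverse (rb i)" d] by auto
  have J': "absval (q ^ J * d) * rb i < 1"
    using mult_strict_right_mono[OF J, of "rb i"] r_pos(2)[of i] by simp
  obtain u where u: "laurent_bounded (ra i) (rb i) u"
    "\<And>z. ra i < absval z \<Longrightarrow> absval z < rb i \<Longrightarrow> laurent_sum u z = ser e (q ^ J * d * z)"
    using laurent_of_ser[where e = e, OF e(1) r_pos(1) r_less(3)[OF i], of "q ^ J * d"] J' by auto
  have inv: "inverse (rb i) = ra i" "inverse (ra i) = rb i" by (simp_all add: ra_def rb_def)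
  have "laurent_bounded (ra i) (rb i) (\<lambda>n. u (- n))"
    using laurent_bounded_reflect[OF u(1)] by (simp add: inv)
  then have "quot i (\<lambda>z. W 1 k (q ^ J * d * inverse z))"
  proof (rule quot_laurent)
    fix z :: 'a assume z: "ra i < absval z" "absval z < rb i"
    then have "z \<noteq> 0" by (intro annulus_nonzero)
    with z have z': "ra i < absval (inverse z)" "absval (inverse z) < rb i"
      using less_imp_inverse_less[OF z(1)] less_imp_inverse_less[OF z(2)] r_pos(1)[of i]
      by (auto simp: absval_inverse inv)
    have "absval (q ^ J * d * inverse z) \<le> absval (q ^ J * d) * rb i"
      unfolding absval_mult[of "q ^ J * d"] using z' by (intro mult_left_mono) auto
    with J' show "W 1 k (q ^ J * d * inverse z) = laurent_sum (\<lambda>n. u (- n)) z"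
      unfolding laurent_sum_reflect using u(2)[OF z'] e(2) by simp
  qed
  moreover have "quot i (\<lambda>z. \<Sum>m<J. psi 1 k ((q ^ Suc m * d) * inverse z))"
    by (intro quot_sum quot_psi_inverse) auto
  ultimately have "quot i (\<lambda>z. (\<Sum>m<J. psi 1 k ((q ^ Suc m * d) * inverse z)) + W 1 k (q ^ J * d * inverse z))"
    by (rule quot_add[rotated])
  then show ?thesis
    by (rule quot_cong) (subst W_rec_sum[OF order_refl, of k _ J], simp only: mult.assoc)
qed

lemma quot_zeta:
  assumes c: "c \<noteq> 0" and i: "1 \<le> i"
  shows "quot i (\<lambda>z. zeta_q q k (c * z))"
proof (rule quot_cong)
  show "quot i (\<lambda>z. psi k k (c * z) + W (max 1 k) k (c * z) + (-1) ^ (k + 1) * W 1 k (inverse c * inverse z))"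
    by (intro quot_add quot_cmult quot_psi quot_W quot_W_inverse i) auto
  fix z :: 'a assume "ra i < absval z"
  then have z: "z \<noteq> 0" by (intro annulus_nonzero)
  then show "zeta_q q k (c * z) =
      psi k k (c * z) + W (max 1 k) k (c * z) + (-1) ^ (k + 1) * W 1 k (inverse c * inverse z)"
    using zeta_q_eq[of "c * z" k] c by simp
qed

section \<open>The Liouville theorem for rigid meromorphic functions\<close>

lemma infinite_unit_circle: "infinite {z::'a. absval z = 1}"
proof -
  have "inj (\<lambda>n. 1 + q ^ Suc n)"
  proof (rule injI)
    fix m n :: nat assume "1 + q ^ Suc m = 1 + q ^ Suc n"
    then have "absval q ^ Suc m = absval q ^ Suc n" by (metis add_left_cancel absval_power)
    then show "m = n" using q_lt absval_pos_iff[of q]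
      by (metis Suc_inject power_inject_exp' q_nz order_less_irrefl power_strict_decreasing_iff not_less_iff_gr_or_eq)
  qed
  then have "infinite (range (\<lambda>n. 1 + q ^ Suc n))" by (rule range_inj_infinite)
  moreover have "absval (1 + q ^ Suc n) = 1" for n
  proof -
    have qn: "absval (q ^ Suc n) < 1" unfolding absval_power using q_lt by (intro power_Suc_less_one) auto
    have "absval (1 + q ^ Suc n) \<le> 1" using qn by (intro absval_add_le) auto
    moreover have "absval ((1 + q ^ Suc n) - q ^ Suc n) \<le> max (absval (1 + q ^ Suc n)) (absval (q ^ Suc n))"
      by (rule absval_diff_le) auto
    ultimately show ?thesis using qn by (simp del: power_Suc)
  qed
  then have "range (\<lambda>n. 1 + q ^ Suc n) \<subseteq> {z. absval z = 1}" by auto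
  ultimately show ?thesis using finite_subset by blast
qed

text \<open>Identity theorem: a nonzero w would divide z^k p with p nonzero, and so have only
  finitely many zeros on the unit circle, which is infinite.\<close>

lemma laurent_zero_on_circle:
  assumes w: "laurent_bounded a b w" and ab: "0 < a" "a < 1" "1 < b"
    and zero: "finite {z. absval z = 1 \<and> laurent_sum w z \<noteq> 0}"
  shows "w n = (0::'a)"
proof (rule ccontr)
  assume "w n \<noteq> 0"
  obtain a1 b1 where a1: "a < a1" "a1 < 1" and b1: "1 < b1" "b1 < b" using ab dense by metis
  obtain Q p k where "laurent_bounded a1 b1 Q" and Q: "p \<noteq> 0"
    "\<And>z. a1 < absval z \<Longrightarrow> absval z < b1 \<Longrightarrow> laurent_sum w z * laurent_sum Q z = z powi k * poly p z"
    by (rule laurent_divides_polynomial[OF w \<open>w n \<noteq> 0\<close> ab(1) a1(1) order.strict_trans[OF a1(2) b1(1)] b1(2)]) (rule that)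
  have "{z. absval z = 1} \<subseteq> {z. absval z = 1 \<and> laurent_sum w z \<noteq> 0} \<union> {z. poly p z = 0}"
  proof
    fix z :: 'a assume z: "z \<in> {z. absval z = 1}"
    then have "z \<noteq> 0" by auto
    then show "z \<in> {z. absval z = 1 \<and> laurent_sum w z \<noteq> 0} \<union> {z. poly p z = 0}"
      using Q(2)[of z] z a1 b1 by (cases "laurent_sum w z = 0") auto
  qed
  then show False
    using infinite_unit_circle zero poly_roots_finite[OF Q(1)] finite_subset by blast
qed

text \<open>The functional equation is tested on the unit circle. Both z and q z must lie in the
  annulus of H, so the inner radius is raised one step, from \<open>ra i\<close> to
  \<open>ra j\<close> with i = j + 1; the assumption i \<ge> 2 keeps 1 strictly inside.\<close>

lemma rigid_liouville_annulus:
  assumes g: "g \<in> rigid_meromorphic" and bdd: "\<And>\<alpha>. \<alpha> \<noteq> 0 \<Longrightarrow> bdd_near g \<alpha>"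
    and shift: "mero_eq (\<lambda>z. g (q * z)) (\<lambda>z. g z + d)" and i: "2 \<le> i"
  shows "d = 0 \<and> (\<exists>c. finite {z. ra i < absval z \<and> absval z < rb i \<and> g z \<noteq> c})"
proof -
  let ?a = "ra i" and ?b = "rb i"
  have ab: "?a < ?b" using r_less(3)[of i] i by simp
  have "quot i g" using rigid_imp_quot[OF g, of i] i by simp
  then obtain h p where h: "laurent_bounded ?a ?b h" "p \<noteq> 0"
    "\<And>z. ?a < absval z \<Longrightarrow> absval z < ?b \<Longrightarrow> poly p z \<noteq> 0 \<Longrightarrow> g z = laurent_sum h z / poly p z"
    unfolding quot_def by blast
  have "bdd_near (\<lambda>z. laurent_sum h z / poly p z) \<alpha>" if \<alpha>: "?a < absval \<alpha>" "absval \<alpha> < ?b" for \<alpha>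
  proof (rule bdd_near_eventually_eq[OF _ bdd])
    show "\<forall>\<^sub>F z in at \<alpha>. laurent_sum h z / poly p z = g z"
      using eventually_in_annulus[OF \<alpha>] eventually_poly_nonzero[OF h(2)] by eventually_elim (simp add: h(3))
    show "\<alpha> \<noteq> 0" using \<alpha>(1) by (rule annulus_nonzero)
  qed
  from bounded_quotient_is_laurent[OF q_nz q_lt h(1) r_pos(1) ab h(2) this]
  obtain H where H: "laurent_bounded ?a ?b H"
    "\<And>z. ?a < absval z \<and> absval z < ?b \<and> poly p z \<noteq> 0 \<Longrightarrow> laurent_sum h z / poly p z = laurent_sum H z" by blast
  define B where "B = {z. poly p z = 0}"
  have B: "finite B" using poly_roots_finite[OF h(2)] by (simp add: B_def)
  have gH: "g z = laurent_sum H z" if "?a < absval z" "absval z < ?b" "z \<notin> B" for z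
    using h(3) H(2) that by (simp add: B_def)
  obtain j where j: "i = Suc j" "1 \<le> j" using i by (cases i) auto
  let ?a' = "ra j"
  have a': "?a < ?a'" "?a' < 1" using r_Suc(1)[of j] r_less(1)[of j] j by simp_all
  have b: "1 < ?b" using r_less(2)[of i] i by simp
  have aq: "?a = absval q * ?a'" by (simp add: ra_def j)
  \<comment> \<open>The coefficients of H(q z) - H(z) - d. Degree 0 yields d = 0; in degree n
    \<noteq> 0 the coefficient is H(n) (q^n - 1), and q^n is not 1.\<close>
  define w where "w n = (H n * q powi n - H n) - laurent_monom d 0 n" for n
  have bHq: "laurent_bounded ?a' ?b (\<lambda>n. H n * q powi n)"
  proof -
    obtain C where C: "gauss_le ?a C H" "gauss_le ?b C H" using H(1) r_pos(1) by (rule laurent_boundedE)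
    have "gauss_le r C (\<lambda>n. H n * q powi n)" if r: "r = ?a' \<or> r = ?b" for r
    proof -
      have "?a \<le> absval q * r" "absval q * r \<le> ?b"
      proof -
        have "absval q * ?a' \<le> absval q * r" using r a' b by (intro mult_left_mono) auto
        then show "?a \<le> absval q * r" by (simp add: aq)
        have "0 \<le> r" using r less_imp_le[OF r_pos(1)[of j]] less_imp_le[OF r_pos(2)[of i]] by auto
        then have "absval q * r \<le> 1 * ?b" using r a' b q_lt by (intro mult_mono) auto
        then show "absval q * r \<le> ?b" by simp
      qed
      from gauss_le_between[OF C r_pos(1) this] show ?thesis
        unfolding gauss_le_def by (simp add: absval_mult absval_powi power_int_mult_distrib mult.assoc)
    qed
    then show ?thesis by (intro laurent_boundedI[of _ C _ _ C]) auto
  qed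
  have bH: "laurent_bounded ?a' ?b H"
    using a' b by (intro laurent_bounded_subset[OF H(1)]) auto
  have bD: "laurent_bounded ?a' ?b (\<lambda>n. H n * q powi n - H n)"
    by (intro laurent_bounded_diff bHq bH r_pos)
  have bw: "laurent_bounded ?a' ?b w"
    unfolding w_def[abs_def] by (intro laurent_bounded_diff bD laurent_bounded_monom r_pos)
  have sum_Hq: "laurent_sum (\<lambda>n. H n * q powi n) z = laurent_sum H (q * z)" for z
    by (simp add: laurent_sum_def power_int_mult_distrib mult.assoc)
  have sum_w: "laurent_sum w z = laurent_sum H (q * z) - laurent_sum H z - d"
    if z: "?a' < absval z" "absval z < ?b" for z
    using laurent_sum_diff[OF bD laurent_bounded_monom r_pos(1) z, of d 0] laurent_sum_diff[OF bHq bH r_pos(1) z]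
    by (simp add: w_def[abs_def] sum_Hq)
  have "finite {z. absval z = 1 \<and> laurent_sum w z \<noteq> 0}"
  proof (rule finite_subset)
    show "finite ({z. 1 \<le> absval z \<and> absval z \<le> 1 \<and> g (q * z) \<noteq> g z + d} \<union> B \<union> (\<lambda>z. q * z) -` B)"
      using shift B unfolding mero_eq_def by (auto intro!: finite_vimageI simp: inj_def)
    show "{z. absval z = 1 \<and> laurent_sum w z \<noteq> 0} \<subseteq>
        {z. 1 \<le> absval z \<and> absval z \<le> 1 \<and> g (q * z) \<noteq> g z + d} \<union> B \<union> (\<lambda>z. q * z) -` B"
    proof (rule ccontr)
      assume "\<not> ?thesis"
      then obtain z where z: "absval z = 1" "laurent_sum w z \<noteq> 0" "g (q * z) = g z + d" "z \<notin> B" "q * z \<notin> B"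
        by auto
      have "absval (q * z) = absval q" using z(1) by (simp add: absval_mult)
      moreover have "?a < absval q"
        using mult_strict_left_mono[OF a'(2), of "absval q"] by (simp add: aq)
      ultimately have "g (q * z) = laurent_sum H (q * z)" using z q_lt b by (intro gH) auto
      moreover have "g z = laurent_sum H z" using z a' b by (intro gH) auto
      ultimately have "laurent_sum H (q * z) = laurent_sum H z + d" using z(3) by simp
      then have "laurent_sum w z = 0" using sum_w[of z] z(1) a' b by simp
      with z(2) show False by contradiction
    qed
  qed
  then have w0: "w n = 0" for n
    using laurent_zero_on_circle[OF bw r_pos(1) a'(2) b] by blast
  have "d = 0" using w0[of 0] by (simp add: w_def laurent_monom_def)
  have "H n = 0" if "n \<noteq> 0" for n
  proof -
    have "q powi n \<noteq> 1"
    proof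
      assume "q powi n = 1"
      then have "q ^ nat \<bar>n\<bar> = 1"
        by (cases "0 \<le> n") (auto simp: power_int_def power_inverse)
      then show False using q_power_neq_1[of "nat \<bar>n\<bar>"] that by simp
    qed
    moreover have "H n * (q powi n - 1) = 0"
      using w0[of n] that by (simp add: w_def laurent_monom_def algebra_simps)
    ultimately show ?thesis by simp
  qed
  then have "H = laurent_monom (H 0) 0" by (auto simp: laurent_monom_def)
  then have "laurent_sum H z = H 0" for z
    using laurent_sum_monom[of "H 0" 0 z] by simp
  then have "{z. ?a < absval z \<and> absval z < ?b \<and> g z \<noteq> H 0} \<subseteq> B" using gH by auto
  then have "finite {z. ?a < absval z \<and> absval z < ?b \<and> g z \<noteq> H 0}" using B finite_subset by blast
  with \<open>d = 0\<close> show ?thesis by blast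
qed

text \<open>All the annuli contain the infinite unit circle, so the constants found on them
  agree.\<close>

lemma rigid_liouville:
  assumes g: "g \<in> rigid_meromorphic" and bdd: "\<And>\<alpha>. \<alpha> \<noteq> 0 \<Longrightarrow> bdd_near g \<alpha>"
    and shift: "mero_eq (\<lambda>z. g (q * z)) (\<lambda>z. g z + d)"
  shows "d = 0 \<and> (\<exists>c. mero_eq g (\<lambda>_. c))"
proof -
  note ann = rigid_liouville_annulus[OF g bdd shift]
  obtain c where c: "finite {z. ra 2 < absval z \<and> absval z < rb 2 \<and> g z \<noteq> c}" using ann[of 2] by auto
  have "mero_eq g (\<lambda>_. c)"
    unfolding mero_eq_def
  proof (intro allI impI)
    fix a b :: real assume "0 < a"
    then obtain i where i: "2 \<le> i" "ra i < a" "b < rb i" using ex_annulus by blast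
    obtain c' where c': "finite {z. ra i < absval z \<and> absval z < rb i \<and> g z \<noteq> c'}" using ann[OF _ i(1)] by auto
    have "c' = c"
    proof (rule ccontr)
      assume "c' \<noteq> c"
      have "{z. absval z = 1} \<subseteq> {z. ra 2 < absval z \<and> absval z < rb 2 \<and> g z \<noteq> c} \<union>
          {z. ra i < absval z \<and> absval z < rb i \<and> g z \<noteq> c'}"
        using r_less(1,2)[of 2] r_less(1,2)[of i] i \<open>c' \<noteq> c\<close> by auto
      then show False using c c' infinite_unit_circle finite_subset by blast
    qed
    have "{z. a \<le> absval z \<and> absval z \<le> b \<and> g z \<noteq> c} \<subseteq> {z. ra i < absval z \<and> absval z < rb i \<and> g z \<noteq> c'}"
      using i \<open>c' = c\<close> by auto
    then show "finite {z. a \<le> absval z \<and> absval z \<le> b \<and> g z \<noteq> c}" using c' finite_subset by blast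
  qed
  moreover have "d = 0" using ann[of 2] by simp
  ultimately show ?thesis by blast
qed

lemma rigid_mero_setting: "mero_setting q rigid_meromorphic"
proof
  fix f g :: "'a \<Rightarrow> 'a" and \<alpha> c d :: 'a and a b :: real and k :: nat
  show "\<exists>c. polar_expansion f \<alpha> c" if f: "f \<in> rigid_meromorphic" and \<alpha>: "\<alpha> \<noteq> 0"
  proof -
    obtain i where i: "1 \<le> i" "ra i < absval \<alpha>" "absval \<alpha> < rb i"
      using ex_annulus[of "absval \<alpha>" 1 "absval \<alpha>"] \<alpha> by auto
    from rigid_imp_quot[OF f i(1)] obtain h p where h: "laurent_bounded (ra i) (rb i) h" "p \<noteq> 0"
      "\<And>z. ra i < absval z \<Longrightarrow> absval z < rb i \<Longrightarrow> poly p z \<noteq> 0 \<Longrightarrow> f z = laurent_sum h z / poly p z"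
      unfolding quot_def by blast
    show ?thesis by (rule quotient_polar_expansion[OF h(1) r_pos(1) i(2,3) h(2,3)])
  qed
  show "finite {\<alpha>. a \<le> absval \<alpha> \<and> absval \<alpha> \<le> b \<and> \<not> bdd_near f \<alpha>}"
    if f: "f \<in> rigid_meromorphic" and a: "0 < a"
  proof -
    obtain i where i: "1 \<le> i" "ra i < a" "b < rb i" using ex_annulus[OF a] by blast
    from rigid_imp_quot[OF f i(1)] obtain h p where h: "laurent_bounded (ra i) (rb i) h" "p \<noteq> 0"
      "\<And>z. ra i < absval z \<Longrightarrow> absval z < rb i \<Longrightarrow> poly p z \<noteq> 0 \<Longrightarrow> f z = laurent_sum h z / poly p z"
      unfolding quot_def by blast
    have "{\<alpha>. a \<le> absval \<alpha> \<and> absval \<alpha> \<le> b \<and> \<not> bdd_near f \<alpha>} \<subseteq> {z. poly p z = 0}"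
      using quotient_bdd_near[OF h(1) r_pos(1) _ _ _ h(3)] i by force
    then show ?thesis using poly_roots_finite[OF h(2)] finite_subset by blast
  qed
  show "f \<in> rigid_meromorphic \<Longrightarrow> (\<And>\<alpha>. \<alpha> \<noteq> 0 \<Longrightarrow> bdd_near f \<alpha>) \<Longrightarrow>
      mero_eq (\<lambda>z. f (q * z)) (\<lambda>z. f z + d) \<Longrightarrow> d = 0 \<and> (\<exists>c. mero_eq f (\<lambda>_. c))"
    by (rule rigid_liouville)
  show "f \<in> rigid_meromorphic \<Longrightarrow> g \<in> rigid_meromorphic \<Longrightarrow> (\<lambda>z. f z + g z) \<in> rigid_meromorphic"
    by (simp add: rigid_iff_quot quot_add)
  show "f \<in> rigid_meromorphic \<Longrightarrow> (\<lambda>z. c * f z) \<in> rigid_meromorphic"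
    by (simp add: rigid_iff_quot quot_cmult)
  show "c \<noteq> 0 \<Longrightarrow> (\<lambda>z. zeta_q q k (c * z)) \<in> rigid_meromorphic"
    by (simp add: rigid_iff_quot quot_zeta)
qed

end

section \<open>The criterion for elliptic summability\<close>

theorem theorem3p8:
  shows
    "(\<forall>(q :: 'a::{nonarch_valued_field, complete_space, alg_closed_field}) s \<alpha> f.
        0 < absval q \<and> absval q < 1 \<and> s \<noteq> 0 \<and> mult_independent s q \<and> tau_pinning q s \<alpha> \<and>
        f \<in> elliptic_functions rigid_meromorphic q \<longrightarrow>
        (elliptically_summable rigid_meromorphic q s f \<longleftrightarrow>
           panores_0 q s \<alpha> f = 0 \<and> panores_1 q s \<alpha> f = 0 \<and>
           (\<forall>\<omega>\<in>tau_orbits q s. \<forall>k\<ge>1. ores f \<omega> k = 0)))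
     \<and>
     (\<forall>(q :: complex) s \<alpha> f.
        0 < norm q \<and> norm q < 1 \<and> s \<noteq> 0 \<and> mult_independent s q \<and> tau_pinning q s \<alpha> \<and>
        f \<in> elliptic_functions complex_meromorphic q \<longrightarrow>
        (elliptically_summable complex_meromorphic q s f \<longleftrightarrow>
           panores_0 q s \<alpha> f = 0 \<and> panores_1 q s \<alpha> f = 0 \<and>
           (\<forall>\<omega>\<in>tau_orbits q s. \<forall>k\<ge>1. ores f \<omega> k = 0)))"
proof (intro conjI allI impI; elim conjE)
  fix q s :: 'a and \<alpha> f
  assume q: "0 < absval q" "absval q < 1" and s: "s \<noteq> 0" "mult_independent s q" "tau_pinning q s \<alpha>"
    and f: "f \<in> elliptic_functions rigid_meromorphic q"
  interpret rigid_multiplier q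
    using q by unfold_locales auto
  interpret pinned_mero_setting q rigid_meromorphic s \<alpha>
    using rigid_mero_setting s by (intro pinned_mero_setting.intro pinned_mero_setting_axioms.intro)
  show "elliptically_summable rigid_meromorphic q s f \<longleftrightarrow>
      panores_0 q s \<alpha> f = 0 \<and> panores_1 q s \<alpha> f = 0 \<and> (\<forall>\<omega>\<in>tau_orbits q s. \<forall>k\<ge>1. ores f \<omega> k = 0)"
    by (rule elliptically_summable_iff[OF f])
next
  fix q s :: complex and \<alpha> f
  assume q: "0 < norm q" "norm q < 1" and s: "s \<noteq> 0" "mult_independent s q" "tau_pinning q s \<alpha>"
    and f: "f \<in> elliptic_functions complex_meromorphic q"
  have "mero_setting q complex_meromorphic"
    using q by (intro complex_mero_setting) auto
  then interpret pinned_mero_setting q complex_meromorphic s \<alpha>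
    using s by (intro pinned_mero_setting.intro pinned_mero_setting_axioms.intro)
  show "elliptically_summable complex_meromorphic q s f \<longleftrightarrow>
      panores_0 q s \<alpha> f = 0 \<and> panores_1 q s \<alpha> f = 0 \<and> (\<forall>\<omega>\<in>tau_orbits q s. \<forall>k\<ge>1. ores f \<omega> k = 0)"
    by (rule elliptically_summable_iff[OF f])
qed

end
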